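(* There is a ring embedding $$D:\ A_g\to\mathrm{Mat}(2,\mathcal{D})$$ of $A_g$ into the ring of $2\times2$-matrix differential operators in the variables $x$ and $y$.
   Context: Let $\Omega=\mathbb{C}P^1\times\mathbb{C}P^1/\{(1:0,t_1:t_2)\sim(t_1:t_2,0:1)\}$, the variety obtained from $\mathbb{C}P^1\times\mathbb{C}P^1$ (homogeneous coordinates $(z_1:z_2,w_1:w_2)$) by identifying $(1:0,t)$ with $(t,0:1)$ for all $t\in\mathbb{C}P^1$. Fix $B\in\mathbb{C}^*$ and $g(z_1,z_2,w_1,w_2)=\alpha z_1w_1+\beta z_1w_2+\gamma z_2w_1+\delta z_2w_2$ with $\alpha,\beta,\gamma,\delta\in\mathbb{C}$, such that $g(1,0,t_1,t_2)-B\,g(t_1,t_2,0,1)=0$ for all $(t_1,t_2)\in\mathbb{C}^2$ and $g(0,1,0,1)\neq0$. Let $g_i(z_1,z_2,w_1,w_2)=\alpha_iz_1w_1+\beta_iz_1w_2+\gamma_iz_2w_1+\delta_iz_2w_2$, $i=1,2$, be such that for some $c_i\in\mathbb{C}$ one has $g_i(1,0,t_1,t_2)-B\,g_i(t_1,t_2,0,1)-c_i\,g(1,0,t_1,t_2)=0$ for all $(t_1,t_2)\in\mathbb{C}^2$. Assume that $g,g_1,g_2$ are linearly independent and that for $i=1,2$ $$(\gamma\delta_i-\gamma_i\delta)^2+2\gamma\delta c_i(\gamma\delta_i-\gamma_i\delta)+\delta^2(\gamma-2B\delta)^2c_i^2\neq0.$$ Put $G_i(P)=g_i(P)/g(P)$.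 Let $(x_0,y_0)\in\mathbb{C}^2$ be a fixed point, let $\mathcal{O}$ be the ring of analytic functions of $(x,y)$ in a neighbourhood of $(x_0,y_0)$, and $\mathcal{D}=\mathcal{O}[\partial_x,\partial_y]$. Fix $\Lambda\in\mathbb{C}$. For $k\geq1$ let $M_\Omega(k)$ be the set of functions $$\varphi(x,y,P)=\frac{\tilde h(x,y,P)}{g^k(P)}\exp\big(xG_1(P)+yG_2(P)\big),$$ where $P=(z_1:z_2,w_1:w_2)$ and $\tilde h(x,y,P)$ is a bihomogeneous polynomial of bidegree $(k,k)$ in $(z_1,z_2)$ and $(w_1,w_2)$ with coefficients in $\mathcal{O}$, satisfying $\varphi(x,y,1:0,t_1:t_2)-\Lambda\varphi(x,y,t_1:t_2,0:1)=0$ for all $(t_1:t_2)\in\mathbb{C}P^1$. Put $M_\Omega=\bigcup_{k\ge1}M_\Omega(k)$, a $\mathcal{D}$-module (operators act in $x,y$). It is free of rank $2$, generated by two functions from $M_\Omega(1)$. $A_g$ is the ring of meromorphic functions on $\Omega$ with poles only on the curve $g(P)=0$, i.e. rational functions $\lambda$ on $\mathbb{C}P^1\times\mathbb{C}P^1$ that are regular outside $g=0$ and satisfy $\lambda(1:0,t)=\lambda(t,0:1)$ for $t\in\mathbb{C}P^1$. A ring embedding is an injective ring homomorphism. The embedding arises as follows: for a basis $\varphi_1,\varphi_2$ of $M_\Omega$ over $\mathcal{D}$ and $\Psi=(\varphi_1,\varphi_2)^\top$, $D(\lambda)$ is the unique $2\times2$ matrix differential operator such that $D(\lambda)\Psi=\lambda(P)\Psi$.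 *)

theory Defs
  imports "HOL-Analysis.Analysis" "HOL-Algebra.RingHom"
begin

type_synonym plane = "complex \<times> complex"

definition analytic_at2 :: "(plane \<Rightarrow> complex) \<Rightarrow> plane \<Rightarrow> bool" where
  "analytic_at2 f p \<longleftrightarrow>
     (\<exists>r>0. \<exists>a :: nat \<Rightarrow> nat \<Rightarrow> complex. \<forall>s t. cmod s < r \<longrightarrow> cmod t < r \<longrightarrow>
        ((\<lambda>(i, j). a i j * s ^ i * t ^ j) has_sum f (fst p + s, snd p + t)) UNIV)"

type_synonym germ = "(plane \<Rightarrow> complex) set"

definition germ :: "plane \<Rightarrow> (plane \<Rightarrow> complex) \<Rightarrow> germ" where
  "germ p f = {h. eventually (\<lambda>q. h q = f q) (nhds p)}"

(* Lifting of operations on functions to germs.  The union over all representatives is a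
   single germ whenever the operation is local, as all the operations below are. *)
definition germ_map :: "plane \<Rightarrow> ((plane \<Rightarrow> complex) \<Rightarrow> plane \<Rightarrow> complex) \<Rightarrow> germ \<Rightarrow> germ" where
  "germ_map p F u = (\<Union>f\<in>u. germ p (F f))"

definition germ_map2 ::
  "plane \<Rightarrow> ((plane \<Rightarrow> complex) \<Rightarrow> (plane \<Rightarrow> complex) \<Rightarrow> plane \<Rightarrow> complex) \<Rightarrow> germ \<Rightarrow> germ \<Rightarrow> germ" where
  "germ_map2 p F u v = (\<Union>f\<in>u. \<Union>h\<in>v. germ p (F f h))"

definition germ_ring :: "plane \<Rightarrow> germ ring" where
  "germ_ring p =
     \<lparr> carrier = {germ p f | f. analytic_at2 f p},
       mult = germ_map2 p (\<lambda>f h q. f q * h q),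
       one = germ p (\<lambda>_. 1),
       zero = germ p (\<lambda>_. 0),
       add = germ_map2 p (\<lambda>f h q. f q + h q) \<rparr>"

definition ddx :: "(plane \<Rightarrow> complex) \<Rightarrow> plane \<Rightarrow> complex" where
  "ddx f = (\<lambda>(x, y). deriv (\<lambda>s. f (s, y)) x)"

definition ddy :: "(plane \<Rightarrow> complex) \<Rightarrow> plane \<Rightarrow> complex" where
  "ddy f = (\<lambda>(x, y). deriv (\<lambda>t. f (x, t)) y)"

definition diff_op :: "plane \<Rightarrow> nat \<Rightarrow> (nat \<Rightarrow> nat \<Rightarrow> plane \<Rightarrow> complex) \<Rightarrow> germ \<Rightarrow> germ" where
  "diff_op p n a =
     restrict (germ_map p (\<lambda>f q. \<Sum>i\<le>n. \<Sum>j\<le>n. a i j q * (ddx ^^ i) ((ddy ^^ j) f) q))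
       (carrier (germ_ring p))"

(* A differential operator is identified with the map that it induces on the ring of germs;
   this action is faithful.  The product is composition. *)
definition diff_ring :: "plane \<Rightarrow> (germ \<Rightarrow> germ) ring" where
  "diff_ring p =
     \<lparr> carrier = {diff_op p n a | n a. \<forall>i j. analytic_at2 (a i j) p},
       mult = compose (carrier (germ_ring p)),
       one = (\<lambda>u\<in>carrier (germ_ring p). u),
       zero = (\<lambda>u\<in>carrier (germ_ring p). \<zero>\<^bsub>germ_ring p\<^esub>),
       add = (\<lambda>S T. \<lambda>u\<in>carrier (germ_ring p). S u \<oplus>\<^bsub>germ_ring p\<^esub> T u) \<rparr>"

definition mat2_ring :: "('a, 'b) ring_scheme \<Rightarrow> ('a ^ 2 ^ 2) ring" where
  "mat2_ring R =
     \<lparr> carrier = {A. \<forall>i j. A $ i $ j \<in> carrier R},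
       mult = (\<lambda>A C. \<chi> i j. A $ i $ 1 \<otimes>\<^bsub>R\<^esub> C $ 1 $ j \<oplus>\<^bsub>R\<^esub> A $ i $ 2 \<otimes>\<^bsub>R\<^esub> C $ 2 $ j),
       one = (\<chi> i j. if i = j then \<one>\<^bsub>R\<^esub> else \<zero>\<^bsub>R\<^esub>),
       zero = (\<chi> i j. \<zero>\<^bsub>R\<^esub>),
       add = (\<lambda>A C. \<chi> i j. A $ i $ j \<oplus>\<^bsub>R\<^esub> C $ i $ j) \<rparr>"

(* A point of CP1 x CP1 is given by homogeneous coordinates (z1, z2, w1, w2).  All functions
   below live on the set where a form g of bidegree (1,1) does not vanish; there
   (z1, z2) and (w1, w2) are automatically nonzero.  They are built from quotients of forms of
   equal bidegree, so they are invariant under rescaling (z1, z2) and (w1, w2) and are the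
   same thing as functions on the complement of the curve g = 0 in CP1 x CP1. *)
type_synonym hcoord = "complex \<times> complex \<times> complex \<times> complex"

definition bilin :: "complex \<Rightarrow> complex \<Rightarrow> complex \<Rightarrow> complex \<Rightarrow> hcoord \<Rightarrow> complex" where
  "bilin a b c d = (\<lambda>(z1, z2, w1, w2). a * z1 * w1 + b * z1 * w2 + c * z2 * w1 + d * z2 * w2)"

definition bihom :: "nat \<Rightarrow> nat \<Rightarrow> (nat \<Rightarrow> nat \<Rightarrow> complex) \<Rightarrow> hcoord \<Rightarrow> complex" where
  "bihom m n a = (\<lambda>(z1, z2, w1, w2).
     \<Sum>i\<le>m. \<Sum>j\<le>n. a i j * z1 ^ i * z2 ^ (m - i) * w1 ^ j * w2 ^ (n - j))"

definition nonvanishing :: "(hcoord \<Rightarrow> complex) \<Rightarrow> hcoord set" where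
  "nonvanishing g = {P. g P \<noteq> 0}"

(* Rational functions regular outside g = 0, with the gluing condition imposed wherever the
   values are defined.  Once g (1,0,t1,t2) = B * g (t1,t2,0,1) with B nonzero, the points
   (1:0,t) and (t,0:1) lie in the domain for the same t. *)
definition A_ring :: "(hcoord \<Rightarrow> complex) \<Rightarrow> (hcoord \<Rightarrow> complex) ring" where
  "A_ring g =
     \<lparr> carrier =
         {l \<in> extensional (nonvanishing g).
            (\<forall>P\<^sub>0\<in>nonvanishing g. \<exists>m n a b. bihom m n b P\<^sub>0 \<noteq> 0 \<and>
               (\<forall>P\<in>nonvanishing g. bihom m n b P \<noteq> 0 \<longrightarrow> l P = bihom m n a P / bihom m n b P)) \<and>
            (\<forall>t1 t2. (1, 0, t1, t2) \<in> nonvanishing g \<longrightarrow> l (1, 0, t1, t2) = l (t1, t2, 0, 1))},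
       mult = (\<lambda>k l. \<lambda>P\<in>nonvanishing g. k P * l P),
       one = (\<lambda>P\<in>nonvanishing g. 1),
       zero = (\<lambda>P\<in>nonvanishing g. 0),
       add = (\<lambda>k l. \<lambda>P\<in>nonvanishing g. k P + l P) \<rparr>"

(* A function of (x, y, P) is represented as a map from points P to germs in (x, y). *)
definition M_Omega_level ::
  "plane \<Rightarrow> complex \<Rightarrow> (hcoord \<Rightarrow> complex) \<Rightarrow> (hcoord \<Rightarrow> complex) \<Rightarrow> (hcoord \<Rightarrow> complex) \<Rightarrow>
   nat \<Rightarrow> (hcoord \<Rightarrow> germ) set" where
  "M_Omega_level p \<Lambda> g g\<^sub>1 g\<^sub>2 k =
     {\<phi>. (\<exists>h :: nat \<Rightarrow> nat \<Rightarrow> plane \<Rightarrow> complex.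
            (\<forall>i j. analytic_at2 (h i j) p) \<and>
            \<phi> = (\<lambda>P\<in>nonvanishing g. germ p (\<lambda>(x, y).
                   bihom k k (\<lambda>i j. h i j (x, y)) P / g P ^ k
                     * exp (x * (g\<^sub>1 P / g P) + y * (g\<^sub>2 P / g P))))) \<and>
         (\<forall>t1 t2. (1, 0, t1, t2) \<in> nonvanishing g \<longrightarrow>
            \<phi> (1, 0, t1, t2) = germ p (\<lambda>_. \<Lambda>) \<otimes>\<^bsub>germ_ring p\<^esub> \<phi> (t1, t2, 0, 1))}"

definition M_Omega ::
  "plane \<Rightarrow> complex \<Rightarrow> (hcoord \<Rightarrow> complex) \<Rightarrow> (hcoord \<Rightarrow> complex) \<Rightarrow> (hcoord \<Rightarrow> complex) \<Rightarrow>
   (hcoord \<Rightarrow> germ) set" where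
  "M_Omega p \<Lambda> g g\<^sub>1 g\<^sub>2 = (\<Union>k\<in>{1..}. M_Omega_level p \<Lambda> g g\<^sub>1 g\<^sub>2 k)"

definition op_comb ::
  "plane \<Rightarrow> (hcoord \<Rightarrow> complex) \<Rightarrow> (germ \<Rightarrow> germ) ^ 2 \<Rightarrow> (hcoord \<Rightarrow> germ) ^ 2 \<Rightarrow> hcoord \<Rightarrow> germ" where
  "op_comb p g T \<Psi> = (\<lambda>P\<in>nonvanishing g. (T $ 1) ((\<Psi> $ 1) P) \<oplus>\<^bsub>germ_ring p\<^esub> (T $ 2) ((\<Psi> $ 2) P))"

definition is_basis ::
  "plane \<Rightarrow> (hcoord \<Rightarrow> complex) \<Rightarrow> (hcoord \<Rightarrow> germ) set \<Rightarrow> (hcoord \<Rightarrow> germ) ^ 2 \<Rightarrow> bool" where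
  "is_basis p g M \<Psi> \<longleftrightarrow>
     (\<forall>i. \<Psi> $ i \<in> M) \<and>
     (\<forall>\<phi>\<in>M. \<exists>T. (\<forall>i. T $ i \<in> carrier (diff_ring p)) \<and> \<phi> = op_comb p g T \<Psi>) \<and>
     (\<forall>T. (\<forall>i. T $ i \<in> carrier (diff_ring p)) \<longrightarrow>
        op_comb p g T \<Psi> = (\<lambda>P\<in>nonvanishing g. \<zero>\<^bsub>germ_ring p\<^esub>) \<longrightarrow>
        (\<forall>i. T $ i = \<zero>\<^bsub>diff_ring p\<^esub>))"

definition mat_act ::
  "plane \<Rightarrow> (hcoord \<Rightarrow> complex) \<Rightarrow> (germ \<Rightarrow> germ) ^ 2 ^ 2 \<Rightarrow> (hcoord \<Rightarrow> germ) ^ 2 \<Rightarrow> (hcoord \<Rightarrow> germ) ^ 2" where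
  "mat_act p g T \<Psi> = (\<chi> i. op_comb p g (T $ i) \<Psi>)"

definition fun_mult ::
  "plane \<Rightarrow> (hcoord \<Rightarrow> complex) \<Rightarrow> (hcoord \<Rightarrow> complex) \<Rightarrow> (hcoord \<Rightarrow> germ) ^ 2 \<Rightarrow> (hcoord \<Rightarrow> germ) ^ 2" where
  "fun_mult p g l \<Psi> =
     (\<chi> i. (\<lambda>P\<in>nonvanishing g. germ p (\<lambda>_. l P) \<otimes>\<^bsub>germ_ring p\<^esub> (\<Psi> $ i) P))"

definition ring_embedding :: "('a, 'c) ring_scheme \<Rightarrow> ('b, 'd) ring_scheme \<Rightarrow> ('a \<Rightarrow> 'b) \<Rightarrow> bool" where
  "ring_embedding R S f \<longleftrightarrow> ring_hom_ring R S f \<and> inj_on f (carrier R)"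

end

theory Submission
  imports Defs "HOL-Complex_Analysis.Cauchy_Integral_Formula"
    "HOL-Computational_Algebra.Fundamental_Theorem_Algebra"
begin

text \<open>
Let U be the complement of the curve g = 0.  The forms of bidegree (1, 1) divided by g span a
space of dimension four.  The gluing conditions turn out to say that G_1 = g_1 / g and G_2 = g_2 / g
are affine functions, with invertible linear part, of two functions u and v on U, and that there is a fourth basis vector
s of this space with s^2 = v^2 + 4 u + 4 \<kappa> u^2 (lemmas \<open>pencil\<close>, \<open>\<Delta>0\<close>, \<open>s_square\<close>).  So U is an affine quadric that covers the
plane with coordinates (G_1, G_2) twice, and a form of bidegree (k, k) divided by g^k is A + s C with polynomials A and C in
G_1 and G_2 (lemma \<open>quadric_poly_bihom\<close>).  On the exponential e = exp (x G_1 + y G_2) the derivatives act as multiplication by G_1 and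
G_2, so polynomials with analytic coefficients in G_1 and G_2 are the same as differential operators: without
gluing condition, the functions in question form a free module over the differential operators with basis e and s e.

Gluing identifies the points (u, v, s) = (0, r, r) and (0, r - 1, 1 - r) for all r, and the condition on (A + s C) e reads
A(0, r) + r C(0, r) = L (A(0, r - 1) + (1 - r) C(0, r - 1)) with L = \<Lambda> exp (- (c_1 x + c_2 y)).  If L is not 1 at the base
point, then u e and (s + m v + n) e satisfy it for suitable analytic m and n, and they are a basis of the module
(\<open>Gen_is_basis\<close>).  Indeed, the second one generates any prescribed s-component C by
the operator with symbol C.  Subtracting it leaves A e, where the condition A(0, r) = L A(0, r - 1)
forces A(0, r) = 0, by comparison of leading coefficients in r.  So A is divisible by u and A e is obtained from u e.  A
relation between the two generators has no s-component, which kills the second operator, and then the first.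

Multiplication by a regular function l on U that respects the gluing maps the module to itself, because l is globally a form of
bidegree (N, N) divided by g^N (\<open>A_ring_global\<close>).  The coordinates of the multiples by l of
a basis form the matrix D l.  Differential operators in (x, y) commute with multiplication by functions of the
point, which makes D a ring homomorphism, and it is injective since the module contains
a function that is nonzero on a dense set (\<open>embedding_of_basis\<close>).  An embedding exists without a
condition on the base point, as the multiplier L vanishes for \<Lambda> = 0.
\<close>

section \<open>Analytic functions of two variables\<close>

definition double_series :: "(nat \<Rightarrow> nat \<Rightarrow> complex) \<Rightarrow> real \<Rightarrow> plane \<Rightarrow> (plane \<Rightarrow> complex) \<Rightarrow> bool" where
  "double_series a r p f \<longleftrightarrow>
     (\<forall>s t. cmod s < r \<longrightarrow> cmod t < r \<longrightarrow>
        ((\<lambda>(i, j). a i j * s ^ i * t ^ j) has_sum f (fst p + s, snd p + t)) UNIV)"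

lemma analytic_at2_iff: "analytic_at2 f p \<longleftrightarrow> (\<exists>r>0. \<exists>a. double_series a r p f)"
  by (simp add: analytic_at2_def double_series_def)

lemma double_series_mono: "double_series a r p f \<Longrightarrow> r' \<le> r \<Longrightarrow> double_series a r' p f"
  by (auto simp: double_series_def)

lemma double_series_norm_summable:
  assumes "double_series a r p f" "cmod s < r" "cmod t < r"
  shows "(\<lambda>(i, j). cmod (a i j) * cmod s ^ i * cmod t ^ j) summable_on UNIV"
proof -
  have "(\<lambda>(i, j). a i j * s ^ i * t ^ j) summable_on UNIV"
    using assms by (auto simp: double_series_def summable_on_def)
  then have "(\<lambda>z. cmod (case z of (i, j) \<Rightarrow> a i j * s ^ i * t ^ j)) summable_on UNIV"
    by (simp add: summable_on_iff_abs_summable_on_complex)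
  then show ?thesis
    by (simp add: case_prod_unfold norm_mult norm_power)
qed

definition polydisc :: "plane \<Rightarrow> real \<Rightarrow> plane set" where
  "polydisc p r = ball (fst p) r \<times> ball (snd p) r"

lemma eventually_polydisc:
  assumes "r > 0" "\<And>q. q \<in> polydisc p r \<Longrightarrow> Q q"
  shows "eventually Q (nhds p)"
proof -
  have "open (polydisc p r)" "p \<in> polydisc p r"
    using assms(1) by (auto simp: polydisc_def open_Times mem_Times_iff)
  then show ?thesis using assms(2) eventually_nhds by blast
qed

lemma eventually_polydiscD:
  assumes "eventually Q (nhds p)"
  shows "\<exists>r>0. \<forall>q\<in>polydisc p r. Q q"
proof -
  obtain S where S: "open S" "p \<in> S" "\<forall>q\<in>S. Q q"
    using assms unfolding eventually_nhds by blast
  obtain A B where AB: "open A" "open B" "p \<in> A \<times> B" "A \<times> B \<subseteq> S"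
    using open_prod_elim[OF S(1,2)] by metis
  obtain r1 where r1: "r1 > 0" "ball (fst p) r1 \<subseteq> A"
    using AB open_contains_ball by (metis mem_Times_iff)
  obtain r2 where r2: "r2 > 0" "ball (snd p) r2 \<subseteq> B"
    using AB open_contains_ball by (metis mem_Times_iff)
  have "polydisc p (min r1 r2) \<subseteq> S"
    using r1 r2 AB(4) unfolding polydisc_def by (force simp: subset_iff)
  then show ?thesis using r1 r2 S(3) by (intro exI[of _ "min r1 r2"]) auto
qed

lemma double_series_cong:
  assumes "double_series a r p f" "\<And>q. q \<in> polydisc p r \<Longrightarrow> h q = f q"
  shows "double_series a r p h"
proof -
  have "h (fst p + s, snd p + t) = f (fst p + s, snd p + t)" if "cmod s < r" "cmod t < r" for s t
    using that by (intro assms(2)) (auto simp: polydisc_def dist_norm)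
  then show ?thesis using assms(1) by (auto simp: double_series_def)
qed

lemma analytic_at2_cong:
  assumes "analytic_at2 f p" "eventually (\<lambda>q. h q = f q) (nhds p)"
  shows "analytic_at2 h p"
proof -
  obtain r a where r: "r > 0" "double_series a r p f" using assms(1) by (auto simp: analytic_at2_iff)
  obtain r' where r': "r' > 0" "\<forall>q\<in>polydisc p r'. h q = f q"
    using eventually_polydiscD[OF assms(2)] by blast
  have "double_series a (min r r') p h"
    by (rule double_series_cong[OF double_series_mono[OF r(2)]]) (use r'(2) in \<open>auto simp: polydisc_def\<close>)
  then show ?thesis using r r' by (auto simp: analytic_at2_iff intro!: exI[of _ "min r r'"])
qed

lemma analytic_at2_const [simp, intro]: "analytic_at2 (\<lambda>_. c) p"
proof -
  have "double_series (\<lambda>i j. if i = 0 \<and> j = 0 then c else 0) 1 p (\<lambda>_. c)"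
    unfolding double_series_def
  proof (intro allI impI)
    fix s t :: complex
    show "((\<lambda>(i, j). (if i = 0 \<and> j = 0 then c else 0) * s ^ i * t ^ j) has_sum c) (UNIV :: (nat \<times> nat) set)"
      by (rule has_sum_finiteI[of "{(0::nat, 0::nat)}", THEN iffD1[OF has_sum_cong_neutral, rotated -1]])
        (auto split: if_splits)
  qed
  then show ?thesis by (auto simp: analytic_at2_iff intro!: exI[of _ 1])
qed

lemma analytic_at2_add [intro]:
  assumes "analytic_at2 f p" "analytic_at2 h p"
  shows "analytic_at2 (\<lambda>q. f q + h q) p"
proof -
  obtain r a r' b where *: "r > 0" "double_series a r p f" "r' > 0" "double_series b r' p h"
    using assms by (auto simp: analytic_at2_iff)
  have "double_series (\<lambda>i j. a i j + b i j) (min r r') p (\<lambda>q. f q + h q)"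
    unfolding double_series_def
  proof (intro allI impI)
    fix s t assume "cmod s < min r r'" "cmod t < min r r'"
    then have "((\<lambda>x. (case x of (i, j) \<Rightarrow> a i j * s ^ i * t ^ j) + (case x of (i, j) \<Rightarrow> b i j * s ^ i * t ^ j))
        has_sum f (fst p + s, snd p + t) + h (fst p + s, snd p + t)) UNIV"
      using *(2,4) by (intro has_sum_add) (auto simp: double_series_def)
    then show "((\<lambda>(i, j). (a i j + b i j) * s ^ i * t ^ j) has_sum
        f (fst p + s, snd p + t) + h (fst p + s, snd p + t)) UNIV"
      by (simp add: case_prod_unfold algebra_simps)
  qed
  then show ?thesis using * by (auto simp: analytic_at2_iff intro!: exI[of _ "min r r'"])
qed

text \<open>The Cauchy product.  In the complex numbers summability is absolute, so the product of the
two series is summable over pairs of indices and may be summed along the finite sets of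
pairs with a given sum.\<close>

lemma analytic_at2_mult [intro]:
  assumes "analytic_at2 f p" "analytic_at2 h p"
  shows "analytic_at2 (\<lambda>q. f q * h q) p"
proof -
  obtain r0 a r' b where *: "r0 > 0" "double_series a r0 p f" "r' > 0" "double_series b r' p h"
    using assms by (auto simp: analytic_at2_iff)
  define r where "r = min r0 r'"
  define c where "c = (\<lambda>k l. \<Sum>(i, j)\<in>{..k}\<times>{..l}. a i j * b (k - i) (l - j))"
  have "double_series c r p (\<lambda>q. f q * h q)"
    unfolding double_series_def
  proof (intro allI impI)
    fix s t assume st: "cmod s < r" "cmod t < r"
    let ?A = "\<lambda>(i, j). a i j * s ^ i * t ^ j" and ?B = "\<lambda>(i, j). b i j * s ^ i * t ^ j"
    let ?F = "f (fst p + s, snd p + t)" and ?H = "h (fst p + s, snd p + t)"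
    have A: "(?A has_sum ?F) UNIV" and B: "(?B has_sum ?H) UNIV"
      using *(2,4) st by (auto simp: double_series_def r_def)
    have absA: "(\<lambda>x. cmod (?A x)) summable_on UNIV" and absB: "(\<lambda>x. cmod (?B x)) summable_on UNIV"
      using A B summable_on_iff_abs_summable_on_complex by (auto simp: summable_on_def)
    have abs: "(\<lambda>x. cmod (case x of (x, y) \<Rightarrow> ?A x * ?B y)) summable_on UNIV \<times> UNIV"
    proof (rule summable_on_SigmaI)
      show "((\<lambda>y. cmod (case (x, y) of (x, y) \<Rightarrow> ?A x * ?B y)) has_sum cmod (?A x) * (\<Sum>\<^sub>\<infinity>y. cmod (?B y))) UNIV" for x
        using has_sum_cmult_right[OF has_sum_infsum[OF absB], of "cmod (?A x)"] by (simp add: norm_mult)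
      show "(\<lambda>x. cmod (?A x) * (\<Sum>\<^sub>\<infinity>y. cmod (?B y))) summable_on UNIV"
        by (rule summable_on_cmult_left[OF absA])
    qed simp
    have S: "((\<lambda>(x, y). ?A x * ?B y) has_sum ?F * ?H) (UNIV \<times> UNIV)"
    proof (rule has_sum_SigmaI[where g = "\<lambda>x. ?A x * ?H"])
      show "((\<lambda>y. (case (x, y) of (x, y) \<Rightarrow> ?A x * ?B y)) has_sum ?A x * ?H) UNIV" for x
        using has_sum_cmult_right[OF B, of "?A x"] by simp
      show "((\<lambda>x. ?A x * ?H) has_sum ?F * ?H) UNIV"
        by (rule has_sum_cmult_left[OF A])
      show "(\<lambda>(x, y). ?A x * ?B y) summable_on UNIV \<times> UNIV"
        by (rule abs_summable_summable[OF abs])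
    qed
    let ?T = "\<lambda>((k, l), (i, j)). a i j * b (k - i) (l - j) * s ^ k * t ^ l"
    have "(?T has_sum ?F * ?H) (Sigma UNIV (\<lambda>(k, l). {..k} \<times> {..l}))"
    proof (rule iffD1[OF has_sum_reindex_bij_witness S])
      fix x :: "(nat \<times> nat) \<times> (nat \<times> nat)"
      let ?j = "\<lambda>((i, j), (i', j')). ((i + i', j + j'), (i, j)) :: (nat \<times> nat) \<times> (nat \<times> nat)"
      let ?i = "\<lambda>((k, l), (i, j)). ((i, j), (k - i, l - j)) :: (nat \<times> nat) \<times> (nat \<times> nat)"
      show "?i (?j x) = x" "?j x \<in> Sigma UNIV (\<lambda>(k, l). {..k} \<times> {..l})"
        "?T (?j x) = (case x of (x, y) \<Rightarrow> ?A x * ?B y)"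
        by (auto split: prod.splits simp: power_add)
      show "?j (?i x) = x" if "x \<in> Sigma UNIV (\<lambda>(k, l). {..k} \<times> {..l})"
        using that by (auto split: prod.splits)
      show "?i x \<in> UNIV \<times> UNIV" by simp
    qed simp
    then have "((\<lambda>(k, l). c k l * s ^ k * t ^ l) has_sum ?F * ?H) UNIV"
    proof (rule has_sum_SigmaD)
      fix x :: "nat \<times> nat"
      obtain k l where x: "x = (k, l)" by (cases x)
      have "(\<Sum>y\<in>{..k} \<times> {..l}. ?T (x, y)) = c k l * s ^ k * t ^ l"
        by (simp add: c_def x sum_distrib_right case_prod_unfold)
      then show "((\<lambda>y. ?T (x, y)) has_sum (case x of (k, l) \<Rightarrow> c k l * s ^ k * t ^ l))
          (case x of (k, l) \<Rightarrow> {..k} \<times> {..l})"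
        by (auto simp only: x prod.case intro!: has_sum_finiteI)
    qed
    then show "((\<lambda>(k, l). c k l * s ^ k * t ^ l) has_sum ?F * ?H) UNIV" .
  qed
  then show ?thesis using * by (auto simp: analytic_at2_iff r_def intro!: exI[of _ "min r0 r'"])
qed

lemma analytic_at2_sum [intro]:
  assumes "\<And>i. i \<in> I \<Longrightarrow> analytic_at2 (f i) p"
  shows "analytic_at2 (\<lambda>q. \<Sum>i\<in>I. f i q) p"
  using assms by (induction I rule: infinite_finite_induct) auto

lemma analytic_at2_cmult: "analytic_at2 f p \<Longrightarrow> analytic_at2 (\<lambda>q. c * f q) p"
  by auto

text \<open>The binomial expansion of the powers of the linear form turns the power series of
\<psi> into a double series.  It converges absolutely where the sum of the absolute values of the
two terms of the linear form stays below R.  The lemma supplies all concrete analytic functions of the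
construction: exponentials of linear forms and rational expressions in them.\<close>

lemma analytic_at2_compose_linear:
  assumes hol: "\<psi> holomorphic_on ball (b * fst p + c * snd p) R" and R: "R > 0"
  shows "analytic_at2 (\<lambda>q. \<psi> (b * fst q + c * snd q)) p"
proof -
  define z0 where "z0 = b * fst p + c * snd p"
  define k where "k = (\<lambda>n. (deriv ^^ n) \<psi> z0 / fact n)"
  have series: "(\<lambda>n. k n * w ^ n) sums \<psi> (z0 + w)" if "cmod w < R" for w
    using holomorphic_power_series[of \<psi> z0 R "z0 + w"] hol that
    by (simp add: z0_def k_def dist_norm)
  define r where "r = R / (cmod b + cmod c + 1)"
  have r: "r > 0" using R by (simp add: r_def add_nonneg_pos)
  define a where "a = (\<lambda>i j. k (i + j) * of_nat (i + j choose i) * b ^ i * c ^ j)"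
  have "double_series a r p (\<lambda>q. \<psi> (b * fst q + c * snd q))"
    unfolding double_series_def
  proof (intro allI impI)
    fix s t assume st: "cmod s < r" "cmod t < r"
    define \<rho> where "\<rho> = cmod (b * s) + cmod (c * t)"
    have "\<rho> \<le> (cmod b + cmod c) * r"
      using st by (auto simp: \<rho>_def norm_mult distrib_right intro!: add_mono mult_left_mono)
    also have "\<dots> < R"
    proof -
      have "(cmod b + cmod c) * r < (cmod b + cmod c + 1) * r" using r by simp
      also have "cmod b + cmod c + 1 \<noteq> 0" using norm_ge_zero[of b] norm_ge_zero[of c] by linarith
      then have "(cmod b + cmod c + 1) * r = R" by (simp add: r_def)
      finally show ?thesis .
    qed
    finally have \<rho>: "\<rho> < R" "\<rho> \<ge> 0" by (auto simp: \<rho>_def)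
    let ?T = "\<lambda>(n, i). k n * of_nat (n choose i) * (b * s) ^ i * (c * t) ^ (n - i)"
    have inner: "(\<Sum>i\<le>n. ?T (n, i)) = k n * (b * s + c * t) ^ n" for n
      by (simp add: binomial_ring sum_distrib_left mult.assoc)
    have innern: "(\<Sum>i\<le>n. cmod (?T (n, i))) = cmod (k n) * \<rho> ^ n" for n
      by (simp add: \<rho>_def binomial_ring sum_distrib_left mult.assoc norm_mult norm_power)
    obtain \<rho>' where \<rho>': "\<rho> < \<rho>'" "\<rho>' < R" using \<rho>(1) dense by blast
    have "summable (\<lambda>n. cmod (k n * of_real \<rho> ^ n))"
    proof (rule powser_insidea)
      show "summable (\<lambda>n. k n * of_real \<rho>' ^ n)"
        using series[of "of_real \<rho>'"] \<rho>' \<rho>(2) by (auto simp: summable_def)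
      show "norm (of_real \<rho> :: complex) < norm (of_real \<rho>' :: complex)"
        using \<rho>' \<rho>(2) by simp
    qed
    then have sn: "summable (\<lambda>n. cmod (k n) * \<rho> ^ n)"
      using \<rho>(2) by (simp add: norm_mult norm_power)
    have "(\<lambda>x. cmod (?T x)) summable_on Sigma UNIV (\<lambda>n. {..n})"
    proof (rule summable_on_SigmaI)
      fix n :: nat
      show "((\<lambda>y. cmod (?T (n, y))) has_sum cmod (k n) * \<rho> ^ n) {..n}"
        by (rule has_sum_finiteI) (simp_all only: finite_atMost innern)
    next
      show "(\<lambda>n. cmod (k n) * \<rho> ^ n) summable_on UNIV"
        using norm_summable_imp_summable_on[of "\<lambda>n. cmod (k n) * \<rho> ^ n"] sn \<rho>(2) by (simp add: abs_mult)
    qed simp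
    then have summ: "?T summable_on Sigma UNIV (\<lambda>n. {..n})"
      by (rule abs_summable_summable)
    have bt: "cmod (b * s + c * t) \<le> \<rho>" by (simp add: \<rho>_def norm_triangle_ineq)
    have "summable (\<lambda>n. cmod (k n * (b * s + c * t) ^ n))"
      by (rule summable_comparison_test'[OF sn, of 0])
        (auto simp: norm_mult norm_power bt intro!: mult_left_mono power_mono)
    then have outer: "((\<lambda>n. k n * (b * s + c * t) ^ n) has_sum \<psi> (z0 + (b * s + c * t))) UNIV"
      using series[of "b * s + c * t"] bt \<rho> by (intro norm_summable_imp_has_sum) auto
    have "(?T has_sum \<psi> (z0 + (b * s + c * t))) (Sigma UNIV (\<lambda>n. {..n}))"
    proof (rule has_sum_SigmaI[OF _ outer summ])
      fix n :: nat
      show "((\<lambda>y. ?T (n, y)) has_sum k n * (b * s + c * t) ^ n) {..n}"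
        by (rule has_sum_finiteI) (simp_all only: finite_atMost inner)
    qed
    moreover have "(?T has_sum \<psi> (z0 + (b * s + c * t))) (Sigma UNIV (\<lambda>n. {..n})) \<longleftrightarrow>
      ((\<lambda>(i, j). a i j * s ^ i * t ^ j) has_sum \<psi> (z0 + (b * s + c * t))) UNIV"
    proof (rule has_sum_reindex_bij_witness)
      let ?j = "\<lambda>(n, i). (i, n - i) :: nat \<times> nat" and ?i = "\<lambda>(i, j). (i + j, i) :: nat \<times> nat"
      fix x :: "nat \<times> nat"
      show "?j (?i x) = x" "?i x \<in> Sigma UNIV (\<lambda>n. {..n})" by (auto split: prod.splits)
      show "?i (?j x) = x" if "x \<in> Sigma UNIV (\<lambda>n. {..n})"
        using that by (auto split: prod.splits)
      show "(case ?j x of (i, j) \<Rightarrow> a i j * s ^ i * t ^ j) = ?T x" if "x \<in> Sigma UNIV (\<lambda>n. {..n})"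
        using that by (auto split: prod.splits simp: a_def power_mult_distrib)
      show "?j x \<in> UNIV" by simp
    qed simp
    moreover have "z0 + (b * s + c * t) = b * (fst p + s) + c * (snd p + t)"
      by (simp add: z0_def algebra_simps)
    ultimately show "((\<lambda>(i, j). a i j * s ^ i * t ^ j) has_sum
        \<psi> (b * fst (fst p + s, snd p + t) + c * snd (fst p + s, snd p + t))) UNIV" by simp
  qed
  then show ?thesis using r by (auto simp: analytic_at2_iff)
qed

text \<open>Divided by (y - x), this bounds the terms of a differentiated power series at x by those of the
series itself at any larger y, so that differentiation does not shrink the polydisc of convergence.\<close>

lemma Suc_power_bound:
  fixes x y :: real
  assumes "0 \<le> x" "x \<le> y"
  shows "real (Suc n) * x ^ n * (y - x) \<le> y ^ Suc n"
proof (induction n)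
  case (Suc n)
  have "real (Suc (Suc n)) * x ^ Suc n * (y - x)
      = x * (real (Suc n) * x ^ n * (y - x)) + x ^ Suc n * (y - x)"
    by (simp add: algebra_simps)
  also have "\<dots> \<le> x * y ^ Suc n + y ^ Suc n * (y - x)"
    using assms Suc by (intro add_mono mult_left_mono mult_right_mono power_mono) auto
  also have "\<dots> = y ^ Suc (Suc n)" by (simp add: algebra_simps)
  finally show ?case .
qed (use assms in simp)

text \<open>The coefficients of the termwise derivative.\<close>

definition shift_fst :: "(nat \<Rightarrow> nat \<Rightarrow> complex) \<Rightarrow> nat \<Rightarrow> nat \<Rightarrow> complex" where
  "shift_fst a = (\<lambda>i j. of_nat (Suc i) * a (Suc i) j)"

text \<open>For fixed t the double series is a power series in s, which may be differentiated termwise;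
absolute convergence of the differentiated double series then allows it to be rearranged again.\<close>

lemma double_series_ddx:
  assumes ds: "double_series a r p f" and r: "r > 0"
  shows "double_series (shift_fst a) r p (ddx f)"
    and "q \<in> polydisc p r \<Longrightarrow> ((\<lambda>s. f (s, snd q)) has_field_derivative ddx f q) (at (fst q))"
proof -
  define b where "b = (\<lambda>t i. \<Sum>\<^sub>\<infinity>j. a i j * t ^ j)"
  have abs: "(\<lambda>x. cmod (case x of (i, j) \<Rightarrow> a i j * s ^ i * t ^ j)) summable_on UNIV \<times> UNIV"
    if "cmod s < r" "cmod t < r" for s t
    using double_series_norm_summable[OF ds that] by (simp add: case_prod_unfold norm_mult norm_power)
  have b: "((\<lambda>j. a i j * t ^ j) has_sum b t i) UNIV" if "cmod t < r" for t i
  proof -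
    let ?s = "of_real (r / 2) :: complex"
    have "(\<lambda>j. a i j * ?s ^ i * t ^ j) summable_on UNIV"
      using abs_summable_summable[OF abs[of ?s t]] r that
      by (intro summable_on_SigmaD1[of "\<lambda>i j. a i j * ?s ^ i * t ^ j" UNIV "\<lambda>_. UNIV"]) auto
    then have "(\<lambda>j. (1 / ?s ^ i) * (a i j * ?s ^ i * t ^ j)) summable_on UNIV"
      by (rule summable_on_cmult_right)
    then have "(\<lambda>j. a i j * t ^ j) summable_on UNIV" using r by simp
    then show ?thesis by (simp add: b_def)
  qed
  have sums: "(\<lambda>i. b t i * s ^ i) sums f (fst p + s, snd p + t)" if "cmod s < r" "cmod t < r" for s t
  proof (rule has_sum_imp_sums, rule has_sum_SigmaD)
    show "((\<lambda>(i, j). a i j * s ^ i * t ^ j) has_sum f (fst p + s, snd p + t)) (UNIV \<times> UNIV)"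
      using ds that by (simp add: double_series_def)
    show "((\<lambda>j. case (i, j) of (i, j) \<Rightarrow> a i j * s ^ i * t ^ j) has_sum b t i * s ^ i) UNIV" for i
      using has_sum_cmult_left[OF b[OF that(2)], of i "s ^ i"] by (simp add: mult_ac)
  qed
  have deriv: "((\<lambda>s. f (s, snd p + t)) has_field_derivative (\<Sum>i. diffs (b t) i * s ^ i)) (at (fst p + s))"
    if "cmod s < r" "cmod t < r" for s t
  proof -
    have "((\<lambda>s. \<Sum>i. b t i * s ^ i) has_field_derivative (\<Sum>i. diffs (b t) i * s ^ i)) (at s)"
      by (rule termdiffs_strong'[of r]) (use sums that in \<open>auto simp: summable_def\<close>)
    moreover have "eventually (\<lambda>s. f (fst p + s, snd p + t) = (\<Sum>i. b t i * s ^ i)) (nhds s)"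
    proof -
      have "eventually (\<lambda>s. s \<in> ball 0 r) (nhds s)"
        using that by (intro eventually_nhds_in_open) auto
      then show ?thesis
        by eventually_elim (use sums[OF _ that(2)] in \<open>auto simp: sums_iff\<close>)
    qed
    ultimately have "((\<lambda>s. f (fst p + s, snd p + t)) has_field_derivative (\<Sum>i. diffs (b t) i * s ^ i)) (at s)"
      by (subst DERIV_cong_ev[OF refl _ refl])
    then show ?thesis
      using DERIV_shift[of "\<lambda>s. f (s, snd p + t)" _ s "fst p"] by (simp add: add.commute)
  qed
  have ddx: "ddx f (fst p + s, snd p + t) = (\<Sum>i. diffs (b t) i * s ^ i)" if "cmod s < r" "cmod t < r" for s t
    using DERIV_imp_deriv[OF deriv[OF that]] by (simp add: ddx_def)
  show "((\<lambda>s. f (s, snd q)) has_field_derivative ddx f q) (at (fst q))" if "q \<in> polydisc p r"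
  proof -
    have "cmod (fst q - fst p) < r" "cmod (snd q - snd p) < r"
      using that by (auto simp: polydisc_def dist_norm norm_minus_commute)
    from deriv[OF this] ddx[OF this] show ?thesis by simp
  qed
  show "double_series (shift_fst a) r p (ddx f)"
    unfolding double_series_def
  proof (intro allI impI)
    fix s t assume st: "cmod s < r" "cmod t < r"
    obtain \<rho> where \<rho>: "cmod s < \<rho>" "\<rho> < r" using st(1) dense by blast
    have \<rho>0: "\<rho> > 0" using \<rho>(1) norm_ge_zero[of s] by linarith
    let ?T = "\<lambda>(i, j). shift_fst a i j * s ^ i * t ^ j"
    have "(\<lambda>(i, j). cmod (a i j) * \<rho> ^ i * cmod t ^ j) summable_on UNIV"
      using double_series_norm_summable[OF ds, of "of_real \<rho>" t] \<rho> \<rho>0 st by simp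
    then have "(\<lambda>(i, j). cmod (a i j) * \<rho> ^ i * cmod t ^ j) summable_on {1..} \<times> UNIV"
      by (rule summable_on_subset_banach) simp
    moreover have "(\<lambda>(i, j). cmod (a (Suc i) j) * \<rho> ^ Suc i * cmod t ^ j) summable_on UNIV \<longleftrightarrow>
      (\<lambda>(i, j). cmod (a i j) * \<rho> ^ i * cmod t ^ j) summable_on {1..} \<times> UNIV"
      by (rule summable_on_reindex_bij_witness[of _ "\<lambda>(i, j). (i - 1, j)" "\<lambda>(i, j). (Suc i, j)"]) auto
    ultimately have "(\<lambda>(i, j). cmod (a (Suc i) j) * \<rho> ^ Suc i * cmod t ^ j) summable_on UNIV" by simp
    then have *: "(\<lambda>x. 1 / (\<rho> - cmod s) * (case x of (i, j) \<Rightarrow> cmod (a (Suc i) j) * \<rho> ^ Suc i * cmod t ^ j)) summable_on UNIV"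
      by (rule summable_on_cmult_right)
    have "(\<lambda>x. cmod (?T x)) summable_on UNIV"
    proof (rule Infinite_Sum.abs_summable_on_comparison_test'[OF *])
      fix x :: "nat \<times> nat"
      obtain i j where x: "x = (i, j)" by (cases x)
      have "real (Suc i) * cmod s ^ i \<le> \<rho> ^ Suc i / (\<rho> - cmod s)"
        using Suc_power_bound[of "cmod s" \<rho> i] \<rho> by (simp add: field_simps)
      then have "(cmod (a (Suc i) j) * cmod t ^ j) * (real (Suc i) * cmod s ^ i)
          \<le> (cmod (a (Suc i) j) * cmod t ^ j) * (\<rho> ^ Suc i / (\<rho> - cmod s))"
        by (intro mult_left_mono) auto
      then show "cmod (?T x) \<le> 1 / (\<rho> - cmod s) *
          (case x of (i, j) \<Rightarrow> cmod (a (Suc i) j) * \<rho> ^ Suc i * cmod t ^ j)"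
        by (simp add: x shift_fst_def norm_mult norm_power mult_ac del: of_nat_Suc power_Suc)
    qed
    then have summ: "?T summable_on UNIV" by (rule abs_summable_summable)
    then have "(?T has_sum infsum ?T UNIV) (UNIV \<times> UNIV)" by simp
    then have "((\<lambda>i. diffs (b t) i * s ^ i) has_sum infsum ?T UNIV) UNIV"
    proof (rule has_sum_SigmaD)
      fix i
      show "((\<lambda>j. ?T (i, j)) has_sum diffs (b t) i * s ^ i) UNIV"
        using has_sum_cmult_left[OF b[OF st(2)], of "Suc i" "of_nat (Suc i) * s ^ i"]
        by (simp add: diffs_def shift_fst_def mult_ac del: of_nat_Suc)
    qed
    then have "infsum ?T UNIV = ddx f (fst p + s, snd p + t)"
      unfolding ddx[OF st] by (intro sums_unique has_sum_imp_sums)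
    then show "(?T has_sum ddx f (fst p + s, snd p + t)) UNIV"
      using has_sum_infsum[OF summ] by simp
  qed
qed

lemma double_series_swap:
  assumes "double_series a r p f"
  shows "double_series (\<lambda>i j. a j i) r (prod.swap p) (f \<circ> prod.swap)"
  unfolding double_series_def
proof (intro allI impI)
  fix s t assume st: "cmod s < r" "cmod t < r"
  have "((\<lambda>(i, j). a i j * t ^ i * s ^ j) has_sum f (fst p + t, snd p + s)) UNIV"
    using assms st by (simp add: double_series_def)
  then show "((\<lambda>(i, j). a j i * s ^ i * t ^ j) has_sum
      (f \<circ> prod.swap) (fst (prod.swap p) + s, snd (prod.swap p) + t)) UNIV"
    by (rule iffD1[OF has_sum_reindex_bij_witness[of _ prod.swap prod.swap], rotated -1]) auto
qed

lemma ddy_eq_swap: "ddy f = ddx (f \<circ> prod.swap) \<circ> prod.swap"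
  by (auto simp: ddy_def ddx_def fun_eq_iff)

definition shift_snd :: "(nat \<Rightarrow> nat \<Rightarrow> complex) \<Rightarrow> nat \<Rightarrow> nat \<Rightarrow> complex" where
  "shift_snd a = (\<lambda>i j. of_nat (Suc j) * a i (Suc j))"

lemma double_series_ddy:
  assumes ds: "double_series a r p f" and r: "r > 0"
  shows "double_series (shift_snd a) r p (ddy f)"
    and "q \<in> polydisc p r \<Longrightarrow> ((\<lambda>t. f (fst q, t)) has_field_derivative ddy f q) (at (snd q))"
proof -
  note sw = double_series_ddx[OF double_series_swap[OF ds] r]
  show "double_series (shift_snd a) r p (ddy f)"
    using double_series_swap[OF sw(1)] by (simp add: shift_fst_def shift_snd_def ddy_eq_swap comp_def)
  show "((\<lambda>t. f (fst q, t)) has_field_derivative ddy f q) (at (snd q))" if "q \<in> polydisc p r"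
    using sw(2)[of "prod.swap q"] that by (auto simp: polydisc_def ddy_eq_swap)
qed

lemma double_series_unique:
  assumes "double_series a r p f" "double_series a r p h" "q \<in> polydisc p r"
  shows "f q = h q"
proof -
  have "cmod (fst q - fst p) < r" "cmod (snd q - snd p) < r"
    using assms(3) by (auto simp: polydisc_def dist_norm norm_minus_commute)
  with assms(1,2) have "f (fst p + (fst q - fst p), snd p + (snd q - snd p)) =
    h (fst p + (fst q - fst p), snd p + (snd q - snd p))"
    unfolding double_series_def using has_sum_unique by blast
  then show ?thesis by simp
qed

lemma analytic_at2_ddx [intro]: "analytic_at2 f p \<Longrightarrow> analytic_at2 (ddx f) p"
  using double_series_ddx(1) unfolding analytic_at2_iff by blast

lemma analytic_at2_ddy [intro]: "analytic_at2 f p \<Longrightarrow> analytic_at2 (ddy f) p"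
  using double_series_ddy(1) unfolding analytic_at2_iff by blast

lemma analytic_at2_has_ddx:
  assumes "analytic_at2 f p"
  shows "eventually (\<lambda>q. ((\<lambda>s. f (s, snd q)) has_field_derivative ddx f q) (at (fst q))) (nhds p)"
proof -
  obtain r a where r: "r > 0" "double_series a r p f" using assms by (auto simp: analytic_at2_iff)
  show ?thesis by (rule eventually_polydisc[OF r(1) double_series_ddx(2)[OF r(2,1)]])
qed

lemma analytic_at2_has_ddy:
  assumes "analytic_at2 f p"
  shows "eventually (\<lambda>q. ((\<lambda>t. f (fst q, t)) has_field_derivative ddy f q) (at (snd q))) (nhds p)"
proof -
  obtain r a where r: "r > 0" "double_series a r p f" using assms by (auto simp: analytic_at2_iff)
  show ?thesis by (rule eventually_polydisc[OF r(1) double_series_ddy(2)[OF r(2,1)]])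
qed

text \<open>Both sides have the same double series.\<close>

lemma ddx_ddy_commute:
  assumes "analytic_at2 f p"
  shows "eventually (\<lambda>q. ddy (ddx f) q = ddx (ddy f) q) (nhds p)"
proof -
  obtain r a where r: "r > 0" "double_series a r p f" using assms by (auto simp: analytic_at2_iff)
  have "shift_snd (shift_fst a) = shift_fst (shift_snd a)"
    by (auto simp: shift_snd_def shift_fst_def fun_eq_iff)
  then have "ddy (ddx f) q = ddx (ddy f) q" if "q \<in> polydisc p r" for q
    using double_series_unique[OF double_series_ddy(1)[OF double_series_ddx(1)[OF r(2,1)] r(1)] _ that]
      double_series_ddx(1)[OF double_series_ddy(1)[OF r(2,1)] r(1)] by simp
  then show ?thesis by (rule eventually_polydisc[OF r(1)])
qed

section \<open>Germs\<close>

abbreviation near :: "plane \<Rightarrow> (plane \<Rightarrow> complex) \<Rightarrow> (plane \<Rightarrow> complex) \<Rightarrow> bool" where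
  "near p f h \<equiv> eventually (\<lambda>q. f q = h q) (nhds p)"

lemma near_refl [simp]: "near p f f" by simp

lemma near_sym: "near p f h \<Longrightarrow> near p h f"
  by (simp add: eq_commute)

lemma near_trans: "near p f h \<Longrightarrow> near p h k \<Longrightarrow> near p f k"
  by (erule (1) eventually_elim2) simp

lemma near_add: "near p f f' \<Longrightarrow> near p h h' \<Longrightarrow> near p (\<lambda>q. f q + h q) (\<lambda>q. f' q + h' q)"
  by (erule (1) eventually_elim2) simp

lemma near_mult: "near p f f' \<Longrightarrow> near p h h' \<Longrightarrow> near p (\<lambda>q. f q * h q) (\<lambda>q. f' q * h' q)"
  by (erule (1) eventually_elim2) simp

lemma near_sum: "(\<And>i. i \<in> I \<Longrightarrow> near p (f i) (h i)) \<Longrightarrow> near p (\<lambda>q. \<Sum>i\<in>I. f i q) (\<lambda>q. \<Sum>i\<in>I. h i q)"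
  by (induction I rule: infinite_finite_induct) (auto intro: near_add)

lemma germ_eq_iff: "germ p f = germ p h \<longleftrightarrow> near p f h"
proof
  assume "germ p f = germ p h"
  moreover have "f \<in> germ p f" by (simp add: germ_def)
  ultimately show "near p f h" by (simp add: germ_def)
next
  assume "near p f h"
  then show "germ p f = germ p h" by (auto simp: germ_def intro: near_trans near_sym)
qed

text \<open>A germ is a set of functions that are arbitrary away from the base point.  An operation on
functions descends to germs exactly when it does not see this arbitrariness.\<close>

definition local_op :: "plane \<Rightarrow> ((plane \<Rightarrow> complex) \<Rightarrow> plane \<Rightarrow> complex) \<Rightarrow> bool" where
  "local_op p F \<longleftrightarrow> (\<forall>f h. near p f h \<longrightarrow> near p (F f) (F h))"

lemma germ_map_germ:
  assumes "local_op p F"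
  shows "germ_map p F (germ p f) = germ p (F f)"
proof -
  have "germ p (F h) = germ p (F f)" if "h \<in> germ p f" for h
    using that assms unfolding germ_eq_iff local_op_def by (simp add: germ_def)
  moreover have "f \<in> germ p f" by (simp add: germ_def)
  ultimately show ?thesis unfolding germ_map_def by blast
qed

lemma germ_map2_germ:
  assumes "\<And>f f' h h'. near p f f' \<Longrightarrow> near p h h' \<Longrightarrow> near p (F f h) (F f' h')"
  shows "germ_map2 p F (germ p f) (germ p h) = germ p (F f h)"
proof -
  have "germ p (F f' h') = germ p (F f h)" if "f' \<in> germ p f" "h' \<in> germ p h" for f' h'
    using that assms unfolding germ_eq_iff by (simp add: germ_def)
  moreover have "f \<in> germ p f" "h \<in> germ p h" by (auto simp: germ_def)
  ultimately show ?thesis unfolding germ_map2_def by blast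
qed

lemma germ_mult: "germ p f \<otimes>\<^bsub>germ_ring p\<^esub> germ p h = germ p (\<lambda>q. f q * h q)"
  by (simp add: germ_ring_def germ_map2_germ near_mult)

lemma germ_add: "germ p f \<oplus>\<^bsub>germ_ring p\<^esub> germ p h = germ p (\<lambda>q. f q + h q)"
  by (simp add: germ_ring_def germ_map2_germ near_add)

lemma germ_one: "\<one>\<^bsub>germ_ring p\<^esub> = germ p (\<lambda>_. 1)"
  and germ_zero: "\<zero>\<^bsub>germ_ring p\<^esub> = germ p (\<lambda>_. 0)"
  by (simp_all add: germ_ring_def)

lemma germ_carrier_iff: "u \<in> carrier (germ_ring p) \<longleftrightarrow> (\<exists>f. analytic_at2 f p \<and> u = germ p f)"
  by (auto simp: germ_ring_def)

lemma germ_carrierI [intro]: "analytic_at2 f p \<Longrightarrow> germ p f \<in> carrier (germ_ring p)"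
  by (auto simp: germ_carrier_iff)

lemma germ_carrierE:
  assumes "u \<in> carrier (germ_ring p)"
  obtains f where "analytic_at2 f p" "u = germ p f"
  using assms by (auto simp: germ_carrier_iff)

lemma cring_germ_ring: "cring (germ_ring p)"
proof (rule cringI)
  show "abelian_group (germ_ring p)"
  proof (rule abelian_groupI)
    fix u assume "u \<in> carrier (germ_ring p)"
    then obtain f where f: "analytic_at2 f p" "u = germ p f" by (rule germ_carrierE)
    show "\<exists>v\<in>carrier (germ_ring p). v \<oplus>\<^bsub>germ_ring p\<^esub> u = \<zero>\<^bsub>germ_ring p\<^esub>"
      using analytic_at2_cmult[OF f(1), of "-1"] f(2)
      by (intro bexI[of _ "germ p (\<lambda>q. - 1 * f q)"]) (auto simp: germ_add germ_zero)
  qed (auto simp: germ_carrier_iff germ_add germ_zero add_ac)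
  show "Group.comm_monoid (germ_ring p)"
    by (rule comm_monoidI) (auto simp: germ_carrier_iff germ_mult germ_one mult_ac)
qed (auto simp: germ_carrier_iff germ_mult germ_add algebra_simps)

section \<open>Partial derivatives\<close>

text \<open>The derivative at a point near the base point only depends on the function near that
point, and two functions that agree near the base point also agree near all points close to it.\<close>

lemma local_op_ddx: "local_op p ddx"
  unfolding local_op_def
proof (intro allI impI)
  fix f h assume "near p f h"
  then have "eventually (\<lambda>q. near q f h) (nhds p)"
    using eventually_eventually[of "\<lambda>q. f q = h q" p] by simp
  then show "near p (ddx f) (ddx h)"
  proof eventually_elim
    case (elim q)
    obtain x y where q: "q = (x, y)" by (cases q)
    have "filterlim (\<lambda>s. (s, y)) (nhds (x, y)) (nhds x)"
      by (intro tendsto_Pair) (auto simp: filterlim_ident)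
    with elim have "eventually (\<lambda>s. f (s, y) = h (s, y)) (nhds x)"
      unfolding q filterlim_iff by blast
    then show ?case by (simp add: q ddx_def deriv_cong_ev)
  qed
qed

lemma near_swap: "near p f h \<Longrightarrow> near (prod.swap p) (f \<circ> prod.swap) (h \<circ> prod.swap)"
proof -
  assume *: "near p f h"
  obtain x y where p: "p = (x, y)" by (cases p)
  have "filterlim (\<lambda>q. (snd q, fst q)) (nhds (x, y)) (nhds (y, x))"
    using tendsto_snd[OF filterlim_ident, of "(y, x)"] tendsto_fst[OF filterlim_ident, of "(y, x)"]
    by (intro tendsto_Pair) auto
  with * have "eventually (\<lambda>q. f (snd q, fst q) = h (snd q, fst q)) (nhds (y, x))"
    unfolding p filterlim_iff by blast
  then show ?thesis by (simp add: p prod.swap_def)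
qed

lemma local_op_ddy: "local_op p ddy"
  unfolding local_op_def
proof (intro allI impI)
  fix f h assume "near p f h"
  from near_swap[OF this] local_op_ddx[of "prod.swap p"]
  have "near (prod.swap p) (ddx (f \<circ> prod.swap)) (ddx (h \<circ> prod.swap))"
    by (simp add: local_op_def)
  from near_swap[OF this] show "near p (ddy f) (ddy h)"
    by (simp add: ddy_eq_swap)
qed

lemma near_ddx: "near p f h \<Longrightarrow> near p (ddx f) (ddx h)"
  and near_ddy: "near p f h \<Longrightarrow> near p (ddy f) (ddy h)"
  using local_op_ddx local_op_ddy by (auto simp: local_op_def)

lemma ddx_add:
  assumes "analytic_at2 f p" "analytic_at2 h p"
  shows "near p (ddx (\<lambda>q. f q + h q)) (\<lambda>q. ddx f q + ddx h q)"
  using analytic_at2_has_ddx[OF assms(1)] analytic_at2_has_ddx[OF assms(2)]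
proof eventually_elim
  case (elim q)
  from DERIV_imp_deriv[OF DERIV_add[OF elim]] show ?case by (simp add: ddx_def case_prod_unfold)
qed

lemma ddy_add:
  assumes "analytic_at2 f p" "analytic_at2 h p"
  shows "near p (ddy (\<lambda>q. f q + h q)) (\<lambda>q. ddy f q + ddy h q)"
  using analytic_at2_has_ddy[OF assms(1)] analytic_at2_has_ddy[OF assms(2)]
proof eventually_elim
  case (elim q)
  from DERIV_imp_deriv[OF DERIV_add[OF elim]] show ?case by (simp add: ddy_def case_prod_unfold)
qed

lemma ddx_mult:
  assumes "analytic_at2 f p" "analytic_at2 h p"
  shows "near p (ddx (\<lambda>q. f q * h q)) (\<lambda>q. ddx f q * h q + f q * ddx h q)"
  using analytic_at2_has_ddx[OF assms(1)] analytic_at2_has_ddx[OF assms(2)]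
proof eventually_elim
  case (elim q)
  from DERIV_imp_deriv[OF DERIV_mult[OF elim]] show ?case
    by (simp add: ddx_def case_prod_unfold algebra_simps)
qed

lemma ddy_mult:
  assumes "analytic_at2 f p" "analytic_at2 h p"
  shows "near p (ddy (\<lambda>q. f q * h q)) (\<lambda>q. ddy f q * h q + f q * ddy h q)"
  using analytic_at2_has_ddy[OF assms(1)] analytic_at2_has_ddy[OF assms(2)]
proof eventually_elim
  case (elim q)
  from DERIV_imp_deriv[OF DERIV_mult[OF elim]] show ?case
    by (simp add: ddy_def case_prod_unfold algebra_simps)
qed

lemma ddx_const: "ddx (\<lambda>_. c) = (\<lambda>_. 0)" and ddy_const: "ddy (\<lambda>_. c) = (\<lambda>_. 0)"
  by (auto simp: ddx_def ddy_def)

lemma ddx_sum: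
  assumes "\<And>i. i \<in> I \<Longrightarrow> analytic_at2 (f i) p"
  shows "near p (ddx (\<lambda>q. \<Sum>i\<in>I. f i q)) (\<lambda>q. \<Sum>i\<in>I. ddx (f i) q)"
  using assms
proof (induction I rule: infinite_finite_induct)
  case (insert i I)
  then have "near p (ddx (\<lambda>q. f i q + (\<Sum>i\<in>I. f i q))) (\<lambda>q. ddx (f i) q + ddx (\<lambda>q. \<Sum>i\<in>I. f i q) q)"
    by (intro ddx_add) auto
  then show ?case
    using insert by (auto intro: near_trans near_add)
qed (auto simp: ddx_const)

lemma ddy_sum:
  assumes "\<And>i. i \<in> I \<Longrightarrow> analytic_at2 (f i) p"
  shows "near p (ddy (\<lambda>q. \<Sum>i\<in>I. f i q)) (\<lambda>q. \<Sum>i\<in>I. ddy (f i) q)"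
  using assms
proof (induction I rule: infinite_finite_induct)
  case (insert i I)
  then have "near p (ddy (\<lambda>q. f i q + (\<Sum>i\<in>I. f i q))) (\<lambda>q. ddy (f i) q + ddy (\<lambda>q. \<Sum>i\<in>I. f i q) q)"
    by (intro ddy_add) auto
  then show ?case
    using insert by (auto intro: near_trans near_add)
qed (auto simp: ddy_const)

definition dmon :: "nat \<Rightarrow> nat \<Rightarrow> (plane \<Rightarrow> complex) \<Rightarrow> plane \<Rightarrow> complex" where
  "dmon i j f = (ddx ^^ i) ((ddy ^^ j) f)"

lemma dmon_0 [simp]: "dmon 0 0 f = f"
  and dmon_Suc1: "dmon (Suc i) j f = ddx (dmon i j f)"
  and dmon_Suc2: "dmon 0 (Suc j) f = ddy (dmon 0 j f)"
  by (simp_all add: dmon_def)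

lemma dmon_analytic [intro]: "analytic_at2 f p \<Longrightarrow> analytic_at2 (dmon i j f) p"
proof (induction i)
  case 0
  then show ?case by (induction j) (auto simp: dmon_Suc2)
qed (auto simp: dmon_Suc1)

lemma near_dmon: "near p f h \<Longrightarrow> near p (dmon i j f) (dmon i j h)"
proof (induction i)
  case 0
  then show ?case by (induction j) (auto simp: dmon_Suc2 intro: near_ddy)
qed (auto simp: dmon_Suc1 intro: near_ddx)

lemma ddy_dmon:
  assumes "analytic_at2 f p"
  shows "near p (ddy (dmon i j f)) (dmon i (Suc j) f)"
proof (induction i)
  case (Suc i)
  have "near p (ddy (dmon (Suc i) j f)) (ddx (ddy (dmon i j f)))"
    unfolding dmon_Suc1 using assms by (intro ddx_ddy_commute) auto
  then show ?case
    unfolding dmon_Suc1[of i "Suc j"] by (rule near_trans[OF _ near_ddx[OF Suc]])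
qed (simp add: dmon_Suc2)

lemma dmon_add:
  assumes "analytic_at2 f p" "analytic_at2 h p"
  shows "near p (dmon i j (\<lambda>q. f q + h q)) (\<lambda>q. dmon i j f q + dmon i j h q)"
proof (induction i)
  case 0
  show ?case
  proof (induction j)
    case (Suc j)
    show ?case unfolding dmon_Suc2 using assms
      by (intro near_trans[OF near_ddy[OF Suc] ddy_add]) auto
  qed simp
next
  case (Suc i)
  show ?case unfolding dmon_Suc1 using assms
    by (intro near_trans[OF near_ddx[OF Suc] ddx_add]) auto
qed

lemma dmon_cmult:
  assumes "analytic_at2 f p"
  shows "near p (dmon i j (\<lambda>q. c * f q)) (\<lambda>q. c * dmon i j f q)"
proof (induction i)
  case 0
  show ?case
  proof (induction j)
    case (Suc j)
    have "near p (ddy (\<lambda>q. c * dmon 0 j f q)) (\<lambda>q. ddy (\<lambda>_. c) q * dmon 0 j f q + c * ddy (dmon 0 j f) q)"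
      using assms by (intro ddy_mult) auto
    then show ?case unfolding dmon_Suc2
      by (intro near_trans[OF near_ddy[OF Suc]]) (simp add: ddy_const)
  qed simp
next
  case (Suc i)
  have "near p (ddx (\<lambda>q. c * dmon i j f q)) (\<lambda>q. ddx (\<lambda>_. c) q * dmon i j f q + c * ddx (dmon i j f) q)"
    using assms by (intro ddx_mult) auto
  then show ?case unfolding dmon_Suc1
    by (intro near_trans[OF near_ddx[OF Suc]]) (simp add: ddx_const)
qed

section \<open>Differential operators\<close>

definition opf :: "nat \<Rightarrow> (nat \<Rightarrow> nat \<Rightarrow> plane \<Rightarrow> complex) \<Rightarrow> (plane \<Rightarrow> complex) \<Rightarrow> plane \<Rightarrow> complex" where
  "opf n a f = (\<lambda>q. \<Sum>i\<le>n. \<Sum>j\<le>n. a i j q * dmon i j f q)"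

lemma near_opf: "near p f h \<Longrightarrow> near p (opf n a f) (opf n a h)"
  unfolding opf_def by (intro near_sum near_mult near_refl near_dmon)

lemma opf_analytic:
  "(\<And>i j. analytic_at2 (a i j) p) \<Longrightarrow> analytic_at2 f p \<Longrightarrow> analytic_at2 (opf n a f) p"
  unfolding opf_def by (intro analytic_at2_sum analytic_at2_mult) auto

lemma opf_add:
  assumes "analytic_at2 f p" "analytic_at2 h p"
  shows "near p (opf n a (\<lambda>q. f q + h q)) (\<lambda>q. opf n a f q + opf n a h q)"
proof -
  have "near p (opf n a (\<lambda>q. f q + h q)) (\<lambda>q. \<Sum>i\<le>n. \<Sum>j\<le>n. a i j q * (dmon i j f q + dmon i j h q))"
    unfolding opf_def using assms by (intro near_sum near_mult near_refl dmon_add) auto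
  then show ?thesis by (simp add: opf_def distrib_left sum.distrib)
qed

lemma opf_cmult:
  assumes "analytic_at2 f p"
  shows "near p (opf n a (\<lambda>q. c * f q)) (\<lambda>q. c * opf n a f q)"
proof -
  have "near p (opf n a (\<lambda>q. c * f q)) (\<lambda>q. \<Sum>i\<le>n. \<Sum>j\<le>n. a i j q * (c * dmon i j f q))"
    unfolding opf_def using assms by (intro near_sum near_mult near_refl dmon_cmult) auto
  then show ?thesis by (simp add: opf_def sum_distrib_left mult_ac)
qed

lemma diff_op_germ:
  assumes "analytic_at2 f p"
  shows "diff_op p n a (germ p f) = germ p (opf n a f)"
proof -
  have "local_op p (\<lambda>f q. \<Sum>i\<le>n. \<Sum>j\<le>n. a i j q * (ddx ^^ i) ((ddy ^^ j) f) q)"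
    using near_opf unfolding local_op_def opf_def dmon_def by blast
  then show ?thesis
    using assms by (simp add: diff_op_def germ_map_germ germ_carrierI opf_def dmon_def)
qed

text \<open>Operators are compared on analytic functions and only up to germs.  This is what makes the
closure properties below (sums, products, composition) provable without computing
coefficients.\<close>

definition is_diff_op :: "plane \<Rightarrow> ((plane \<Rightarrow> complex) \<Rightarrow> plane \<Rightarrow> complex) \<Rightarrow> bool" where
  "is_diff_op p F \<longleftrightarrow> (\<exists>n a. (\<forall>i j. analytic_at2 (a i j) p) \<and>
     (\<forall>f. analytic_at2 f p \<longrightarrow> near p (F f) (opf n a f)))"

lemma is_diff_opI:
  "(\<And>i j. analytic_at2 (a i j) p) \<Longrightarrow> (\<And>f. analytic_at2 f p \<Longrightarrow> near p (F f) (opf n a f)) \<Longrightarrow> is_diff_op p F"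
  by (auto simp: is_diff_op_def)

lemma is_diff_opE:
  assumes "is_diff_op p F"
  obtains n a where "\<And>i j. analytic_at2 (a i j) p" "\<And>f. analytic_at2 f p \<Longrightarrow> near p (F f) (opf n a f)"
  using assms by (auto simp: is_diff_op_def)

lemma is_diff_op_cong:
  assumes "is_diff_op p F" "\<And>f. analytic_at2 f p \<Longrightarrow> near p (G f) (F f)"
  shows "is_diff_op p G"
proof -
  obtain n a where a: "\<And>i j. analytic_at2 (a i j) p" "\<And>f. analytic_at2 f p \<Longrightarrow> near p (F f) (opf n a f)"
    using assms(1) by (rule is_diff_opE) blast
  show ?thesis
    by (rule is_diff_opI[of a p _ n]) (use a(1) near_trans[OF assms(2) a(2)] in auto)
qed

lemma is_diff_op_analytic:
  assumes "is_diff_op p F" "analytic_at2 f p"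
  shows "analytic_at2 (F f) p"
proof -
  obtain n a where *: "\<And>i j. analytic_at2 (a i j) p" "\<And>f. analytic_at2 f p \<Longrightarrow> near p (F f) (opf n a f)"
    using assms(1) by (rule is_diff_opE) blast
  show ?thesis by (rule analytic_at2_cong[OF opf_analytic[OF *(1) assms(2)] *(2)[OF assms(2)]])
qed

lemma double_sum_pad:
  fixes c :: "nat \<Rightarrow> nat \<Rightarrow> 'a::semiring_1"
  assumes "n \<le> m"
  shows "(\<Sum>i\<le>m. \<Sum>j\<le>m. (if i \<le> n \<and> j \<le> n then c i j else 0) * F i j) = (\<Sum>i\<le>n. \<Sum>j\<le>n. c i j * F i j)"
proof -
  have "(\<Sum>j\<le>m. (if i \<le> n \<and> j \<le> n then c i j else 0) * F i j) =
      (if i \<le> n then \<Sum>j\<le>n. c i j * F i j else 0)" for i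
    using assms by (auto intro!: sum.mono_neutral_cong_right split: if_splits)
  then show ?thesis
    using assms by (auto intro!: sum.mono_neutral_cong_right split: if_splits)
qed

lemma double_sum_indicator:
  fixes F :: "nat \<Rightarrow> nat \<Rightarrow> 'a::semiring_1"
  shows "(\<Sum>i\<le>max k l. \<Sum>j\<le>max k l. (if i = k \<and> j = l then 1 else 0) * F i j) = F k l"
proof -
  have "(\<Sum>i\<le>max k l. \<Sum>j\<le>max k l. (if i = k \<and> j = l then 1 else 0) * F i j) =
      (\<Sum>i\<le>max k l. \<Sum>j\<le>max k l. if j = l then (if i = k then F i j else 0) else 0)"
    by (intro sum.cong) auto
  then show ?thesis by simp
qed

lemma opf_pad:
  "n \<le> m \<Longrightarrow> opf m (\<lambda>i j q. if i \<le> n \<and> j \<le> n then a i j q else 0) f = opf n a f"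
  unfolding opf_def by (intro ext double_sum_pad)

lemma analytic_at2_if: "analytic_at2 f p \<Longrightarrow> analytic_at2 (\<lambda>q. if b then f q else 0) p"
  by (cases b) auto

lemma is_diff_op_add:
  assumes "is_diff_op p F" "is_diff_op p G"
  shows "is_diff_op p (\<lambda>f q. F f q + G f q)"
proof -
  obtain n a where a: "\<And>i j. analytic_at2 (a i j) p" "\<And>f. analytic_at2 f p \<Longrightarrow> near p (F f) (opf n a f)"
    using assms(1) by (rule is_diff_opE) blast
  obtain m b where b: "\<And>i j. analytic_at2 (b i j) p" "\<And>f. analytic_at2 f p \<Longrightarrow> near p (G f) (opf m b f)"
    using assms(2) by (rule is_diff_opE) blast
  let ?a = "\<lambda>i j q. if i \<le> n \<and> j \<le> n then a i j q else 0"
  let ?b = "\<lambda>i j q. if i \<le> m \<and> j \<le> m then b i j q else 0"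
  show ?thesis
  proof (rule is_diff_opI)
    show "analytic_at2 ((\<lambda>i j q. ?a i j q + ?b i j q) i j) p" for i j
      using a(1) b(1) by (intro analytic_at2_add analytic_at2_if)
    fix f assume f: "analytic_at2 f p"
    have "opf (max n m) (\<lambda>i j q. ?a i j q + ?b i j q) f = (\<lambda>q. opf (max n m) ?a f q + opf (max n m) ?b f q)"
      by (simp add: opf_def distrib_right sum.distrib)
    also have "\<dots> = (\<lambda>q. opf n a f q + opf m b f q)"
      by (simp add: opf_pad)
    finally show "near p (\<lambda>q. F f q + G f q) (opf (max n m) (\<lambda>i j q. ?a i j q + ?b i j q) f)"
      using near_add[OF a(2)[OF f] b(2)[OF f]] by simp
  qed
qed

lemma is_diff_op_zero: "is_diff_op p (\<lambda>f q. 0)"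
  by (rule is_diff_opI[of "\<lambda>_ _ _. 0" _ _ 0]) (auto simp: opf_def)

lemma is_diff_op_sum:
  "(\<And>i. i \<in> I \<Longrightarrow> is_diff_op p (F i)) \<Longrightarrow> is_diff_op p (\<lambda>f q. \<Sum>i\<in>I. F i f q)"
  by (induction I rule: infinite_finite_induct) (auto intro: is_diff_op_zero is_diff_op_add)

lemma is_diff_op_mult:
  assumes "analytic_at2 c p" "is_diff_op p F"
  shows "is_diff_op p (\<lambda>f q. c q * F f q)"
proof -
  obtain n a where a: "\<And>i j. analytic_at2 (a i j) p" "\<And>f. analytic_at2 f p \<Longrightarrow> near p (F f) (opf n a f)"
    using assms(2) by (rule is_diff_opE) blast
  have eq: "opf n (\<lambda>i j q. c q * a i j q) f = (\<lambda>q. c q * opf n a f q)" for f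
    by (simp add: opf_def sum_distrib_left mult_ac)
  have "near p (\<lambda>q. c q * F f q) (opf n (\<lambda>i j q. c q * a i j q) f)" if "analytic_at2 f p" for f
    unfolding eq by (rule near_mult[OF near_refl a(2)[OF that]])
  then show ?thesis
    using analytic_at2_mult[OF assms(1) a(1)] by (intro is_diff_opI[of "\<lambda>i j q. c q * a i j q" _ _ n])
qed

lemma is_diff_op_dmon: "is_diff_op p (dmon k l)"
proof (rule is_diff_opI)
  let ?a = "\<lambda>i j q. if i = k \<and> j = l then 1 else 0"
  show "analytic_at2 (?a i j) p" for i j by (cases "i = k \<and> j = l") auto
  fix f
  show "near p (dmon k l f) (opf (max k l) ?a f)"
    unfolding opf_def double_sum_indicator by (rule near_refl)
qed

lemma is_diff_op_opf: "(\<And>i j. analytic_at2 (a i j) p) \<Longrightarrow> is_diff_op p (opf n a)"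
  by (rule is_diff_opI[of a p _ n]) auto

text \<open>The Leibniz rule moves a further derivative past the coefficients.\<close>

lemma is_diff_op_ddx:
  assumes "is_diff_op p F"
  shows "is_diff_op p (\<lambda>f. ddx (F f))"
proof -
  obtain n a where a: "\<And>i j. analytic_at2 (a i j) p" "\<And>f. analytic_at2 f p \<Longrightarrow> near p (F f) (opf n a f)"
    using assms by (rule is_diff_opE) blast
  have "is_diff_op p (\<lambda>f q. \<Sum>i\<le>n. \<Sum>j\<le>n. ddx (a i j) q * dmon i j f q + a i j q * dmon (Suc i) j f q)"
    using a(1) by (intro is_diff_op_sum is_diff_op_add is_diff_op_mult is_diff_op_dmon) auto
  then show ?thesis
  proof (rule is_diff_op_cong)
    fix f assume f: "analytic_at2 f p"
    have an: "analytic_at2 (\<lambda>q. a i j q * dmon i j f q) p" for i j using a(1) f by auto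
    have "near p (ddx (\<lambda>q. \<Sum>i\<le>n. \<Sum>j\<le>n. a i j q * dmon i j f q))
        (\<lambda>q. \<Sum>i\<le>n. \<Sum>j\<le>n. ddx (a i j) q * dmon i j f q + a i j q * ddx (dmon i j f) q)"
      using an a(1) f by (intro near_trans[OF ddx_sum] near_sum ddx_mult) auto
    from near_trans[OF near_ddx[OF a(2)[OF f]], unfolded opf_def, OF this]
    show "near p (ddx (F f)) (\<lambda>q. \<Sum>i\<le>n. \<Sum>j\<le>n. ddx (a i j) q * dmon i j f q + a i j q * dmon (Suc i) j f q)"
      by (simp add: dmon_Suc1)
  qed
qed

text \<open>As for the first variable; in addition the new derivative has to be moved past the powers
of the other one, so that the operator is in normal form again.\<close>

lemma is_diff_op_ddy:
  assumes "is_diff_op p F"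
  shows "is_diff_op p (\<lambda>f. ddy (F f))"
proof -
  obtain n a where a: "\<And>i j. analytic_at2 (a i j) p" "\<And>f. analytic_at2 f p \<Longrightarrow> near p (F f) (opf n a f)"
    using assms by (rule is_diff_opE) blast
  have "is_diff_op p (\<lambda>f q. \<Sum>i\<le>n. \<Sum>j\<le>n. ddy (a i j) q * dmon i j f q + a i j q * dmon i (Suc j) f q)"
    using a(1) by (intro is_diff_op_sum is_diff_op_add is_diff_op_mult is_diff_op_dmon) auto
  then show ?thesis
  proof (rule is_diff_op_cong)
    fix f assume f: "analytic_at2 f p"
    have an: "analytic_at2 (\<lambda>q. a i j q * dmon i j f q) p" for i j using a(1) f by auto
    have "near p (ddy (\<lambda>q. \<Sum>i\<le>n. \<Sum>j\<le>n. a i j q * dmon i j f q))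
        (\<lambda>q. \<Sum>i\<le>n. \<Sum>j\<le>n. ddy (a i j) q * dmon i j f q + a i j q * ddy (dmon i j f) q)"
      using an a(1) f by (intro near_trans[OF ddy_sum] near_sum ddy_mult) auto
    also have "near p (\<lambda>q. \<Sum>i\<le>n. \<Sum>j\<le>n. ddy (a i j) q * dmon i j f q + a i j q * ddy (dmon i j f) q)
        (\<lambda>q. \<Sum>i\<le>n. \<Sum>j\<le>n. ddy (a i j) q * dmon i j f q + a i j q * dmon i (Suc j) f q)"
      using f by (intro near_sum near_add near_mult near_refl ddy_dmon)
    finally (near_trans) show "near p (ddy (F f)) (\<lambda>q. \<Sum>i\<le>n. \<Sum>j\<le>n. ddy (a i j) q * dmon i j f q + a i j q * dmon i (Suc j) f q)"
      by (rule near_trans[OF near_ddy[OF a(2)[OF f]], unfolded opf_def])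
  qed
qed

lemma is_diff_op_compose:
  assumes "is_diff_op p F" "is_diff_op p G"
  shows "is_diff_op p (\<lambda>f. F (G f))"
proof -
  obtain n a where a: "\<And>i j. analytic_at2 (a i j) p" "\<And>f. analytic_at2 f p \<Longrightarrow> near p (F f) (opf n a f)"
    using assms(1) by (rule is_diff_opE) blast
  have "is_diff_op p (\<lambda>f. dmon i j (G f))" for i j
  proof (induction i)
    case 0
    show ?case
      by (induction j) (auto simp: dmon_Suc2 assms(2) intro: is_diff_op_ddy)
  qed (auto simp: dmon_Suc1 intro: is_diff_op_ddx)
  then have "is_diff_op p (\<lambda>f. opf n a (G f))"
    unfolding opf_def using a(1) by (intro is_diff_op_sum is_diff_op_mult)
  then show ?thesis
    by (rule is_diff_op_cong) (rule a(2)[OF is_diff_op_analytic[OF assms(2)]])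
qed

section \<open>The ring of differential operators\<close>

text \<open>The bridge between a map on germs, which is what an element of the ring of differential
operators is, and an operator on functions that induces it.\<close>

definition realizes :: "plane \<Rightarrow> ((plane \<Rightarrow> complex) \<Rightarrow> plane \<Rightarrow> complex) \<Rightarrow> (germ \<Rightarrow> germ) \<Rightarrow> bool" where
  "realizes p F T \<longleftrightarrow> is_diff_op p F \<and> T \<in> extensional (carrier (germ_ring p)) \<and>
     (\<forall>f. analytic_at2 f p \<longrightarrow> T (germ p f) = germ p (F f))"

lemma diff_op_realizes:
  "(\<And>i j. analytic_at2 (a i j) p) \<Longrightarrow> realizes p (opf n a) (diff_op p n a)"
  by (auto simp: realizes_def is_diff_op_opf diff_op_germ) (simp add: diff_op_def)

lemma realizes_unique:
  assumes "realizes p F T" "realizes p G S" "\<And>f. analytic_at2 f p \<Longrightarrow> near p (F f) (G f)"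
  shows "T = S"
proof (rule extensionalityI)
  show "T \<in> extensional (carrier (germ_ring p))" "S \<in> extensional (carrier (germ_ring p))"
    using assms by (auto simp: realizes_def)
  fix u assume "u \<in> carrier (germ_ring p)"
  then obtain f where f: "analytic_at2 f p" "u = germ p f" by (rule germ_carrierE)
  then have "germ p (F f) = germ p (G f)" unfolding germ_eq_iff by (intro assms(3))
  then show "T u = S u"
    using assms(1,2) f by (simp add: realizes_def)
qed

lemma diff_ring_carrier_iff: "T \<in> carrier (diff_ring p) \<longleftrightarrow> (\<exists>F. realizes p F T)"
proof
  assume "T \<in> carrier (diff_ring p)"
  then obtain n a where a: "\<forall>i j. analytic_at2 (a i j) p" "T = diff_op p n a"
    by (auto simp: diff_ring_def)
  have "realizes p (opf n a) T" unfolding a(2) by (rule diff_op_realizes) (use a(1) in simp)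
  then show "\<exists>F. realizes p F T" by (rule exI[of _ "opf n a"])
next
  assume "\<exists>F. realizes p F T"
  then obtain F where F: "realizes p F T" by blast
  then have "is_diff_op p F" by (simp add: realizes_def)
  then obtain n a where a: "\<And>i j. analytic_at2 (a i j) p" "\<And>f. analytic_at2 f p \<Longrightarrow> near p (F f) (opf n a f)"
    by (rule is_diff_opE) blast
  have "T = diff_op p n a"
    by (rule realizes_unique[OF F diff_op_realizes[OF a(1)] a(2)])
  then show "T \<in> carrier (diff_ring p)" using a(1) by (auto simp: diff_ring_def)
qed

lemma diff_ring_carrierE:
  assumes "T \<in> carrier (diff_ring p)"
  obtains n a where "\<And>i j. analytic_at2 (a i j) p" "T = diff_op p n a"
  using assms by (auto simp: diff_ring_def)

lemma realizes_app: "realizes p F T \<Longrightarrow> analytic_at2 f p \<Longrightarrow> T (germ p f) = germ p (F f)"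
  by (auto simp: realizes_def)

lemma realizes_add:
  assumes "realizes p F T" "realizes p G S"
  shows "realizes p (\<lambda>f q. F f q + G f q) (T \<oplus>\<^bsub>diff_ring p\<^esub> S)"
  using assms by (auto simp: realizes_def diff_ring_def is_diff_op_add germ_carrierI germ_add)

lemma realizes_mult:
  assumes "realizes p F T" "realizes p G S"
  shows "realizes p (\<lambda>f. F (G f)) (T \<otimes>\<^bsub>diff_ring p\<^esub> S)"
  using assms
  by (auto simp: realizes_def diff_ring_def is_diff_op_compose germ_carrierI compose_def is_diff_op_analytic)

lemma realizes_one: "realizes p (\<lambda>f. f) (\<one>\<^bsub>diff_ring p\<^esub>)"
proof -
  have "dmon 0 0 = (\<lambda>f. f)" by (simp add: fun_eq_iff)
  then show ?thesis
    using is_diff_op_dmon[of p 0 0] by (auto simp: realizes_def diff_ring_def germ_carrierI)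
qed

lemma realizes_zero: "realizes p (\<lambda>f q. 0) (\<zero>\<^bsub>diff_ring p\<^esub>)"
  by (auto simp: realizes_def diff_ring_def germ_carrierI is_diff_op_zero germ_zero)

text \<open>Differential operators are linear over the constants.  The constants that occur later are
the values at a point P of functions of P: this is why differential operators in (x, y)
commute with multiplication by functions of P.\<close>

lemma is_diff_op_linear:
  assumes "is_diff_op p F" "analytic_at2 f p" "analytic_at2 h p"
  shows "near p (F (\<lambda>q. f q + h q)) (\<lambda>q. F f q + F h q)"
    and "near p (F (\<lambda>q. c * f q)) (\<lambda>q. c * F f q)"
proof -
  obtain n a where a: "\<And>f. analytic_at2 f p \<Longrightarrow> near p (F f) (opf n a f)"
    using assms(1) by (rule is_diff_opE) blast
  have "near p (F (\<lambda>q. f q + h q)) (\<lambda>q. opf n a f q + opf n a h q)"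
    by (rule near_trans[OF a opf_add]) (use assms in auto)
  then show "near p (F (\<lambda>q. f q + h q)) (\<lambda>q. F f q + F h q)"
    by (rule near_trans) (use a assms in \<open>auto intro: near_add near_sym\<close>)
  have "near p (F (\<lambda>q. c * f q)) (\<lambda>q. c * opf n a f q)"
    by (rule near_trans[OF a opf_cmult]) (use assms in auto)
  then show "near p (F (\<lambda>q. c * f q)) (\<lambda>q. c * F f q)"
    by (rule near_trans) (use a assms in \<open>auto intro: near_mult near_sym\<close>)
qed

lemma ring_diff_ring: "ring (diff_ring p)"
proof (rule ringI)
  let ?D = "diff_ring p"
  show "abelian_group ?D"
  proof (rule abelian_groupI)
    fix S T assume "S \<in> carrier ?D" "T \<in> carrier ?D"
    then obtain F G where FG: "realizes p F S" "realizes p G T" by (auto simp: diff_ring_carrier_iff)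
    show "S \<oplus>\<^bsub>?D\<^esub> T \<in> carrier ?D"
      using realizes_add[OF FG] by (auto simp: diff_ring_carrier_iff)
    show "S \<oplus>\<^bsub>?D\<^esub> T = T \<oplus>\<^bsub>?D\<^esub> S"
      by (rule realizes_unique[OF realizes_add[OF FG] realizes_add[OF FG(2,1)]]) (simp add: add.commute)
    fix R assume "R \<in> carrier ?D"
    then obtain H where H: "realizes p H R" by (auto simp: diff_ring_carrier_iff)
    show "S \<oplus>\<^bsub>?D\<^esub> T \<oplus>\<^bsub>?D\<^esub> R = S \<oplus>\<^bsub>?D\<^esub> (T \<oplus>\<^bsub>?D\<^esub> R)"
      by (rule realizes_unique[OF realizes_add[OF realizes_add[OF FG] H] realizes_add[OF FG(1) realizes_add[OF FG(2) H]]])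
        (simp add: add.assoc)
  next
    fix S assume "S \<in> carrier ?D"
    then obtain F where F: "realizes p F S" by (auto simp: diff_ring_carrier_iff)
    show "\<zero>\<^bsub>?D\<^esub> \<oplus>\<^bsub>?D\<^esub> S = S"
      by (rule realizes_unique[OF realizes_add[OF realizes_zero F] F]) simp
    have "is_diff_op p (\<lambda>f q. - 1 * F f q)"
      using F by (intro is_diff_op_mult) (auto simp: realizes_def)
    then have N: "realizes p (\<lambda>f q. - 1 * F f q)
        (restrict (germ_map p (\<lambda>f q. - f q) \<circ> S) (carrier (germ_ring p)))"
      using F germ_map_germ[of p "\<lambda>f q. - f q"]
      by (auto simp: realizes_def germ_carrierI local_op_def)
    show "\<exists>T\<in>carrier ?D. T \<oplus>\<^bsub>?D\<^esub> S = \<zero>\<^bsub>?D\<^esub>"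
    proof (rule bexI)
      show "restrict (germ_map p (\<lambda>f q. - f q) \<circ> S) (carrier (germ_ring p)) \<oplus>\<^bsub>?D\<^esub> S = \<zero>\<^bsub>?D\<^esub>"
        by (rule realizes_unique[OF realizes_add[OF N F] realizes_zero]) simp
    qed (use N in \<open>auto simp: diff_ring_carrier_iff\<close>)
  qed (use realizes_zero[of p] in \<open>auto simp: diff_ring_carrier_iff\<close>)
  show "monoid ?D"
  proof (rule monoidI)
    fix S T assume "S \<in> carrier ?D" "T \<in> carrier ?D"
    then obtain F G where FG: "realizes p F S" "realizes p G T" by (auto simp: diff_ring_carrier_iff)
    show "S \<otimes>\<^bsub>?D\<^esub> T \<in> carrier ?D"
      using realizes_mult[OF FG] by (auto simp: diff_ring_carrier_iff)
    fix R assume "R \<in> carrier ?D"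
    then obtain H where H: "realizes p H R" by (auto simp: diff_ring_carrier_iff)
    show "S \<otimes>\<^bsub>?D\<^esub> T \<otimes>\<^bsub>?D\<^esub> R = S \<otimes>\<^bsub>?D\<^esub> (T \<otimes>\<^bsub>?D\<^esub> R)"
      by (rule realizes_unique[OF realizes_mult[OF realizes_mult[OF FG] H] realizes_mult[OF FG(1) realizes_mult[OF FG(2) H]]]) simp
  next
    fix S assume "S \<in> carrier ?D"
    then obtain F where F: "realizes p F S" by (auto simp: diff_ring_carrier_iff)
    show "\<one>\<^bsub>?D\<^esub> \<otimes>\<^bsub>?D\<^esub> S = S"
      by (rule realizes_unique[OF realizes_mult[OF realizes_one F] F]) simp
    show "S \<otimes>\<^bsub>?D\<^esub> \<one>\<^bsub>?D\<^esub> = S"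
      by (rule realizes_unique[OF realizes_mult[OF F realizes_one] F]) simp
  qed (use realizes_one[of p] in \<open>auto simp: diff_ring_carrier_iff\<close>)
  fix S T R assume "S \<in> carrier ?D" "T \<in> carrier ?D" "R \<in> carrier ?D"
  then obtain F G H where F: "realizes p F S" and G: "realizes p G T" and H: "realizes p H R"
    by (auto simp: diff_ring_carrier_iff)
  show "(S \<oplus>\<^bsub>?D\<^esub> T) \<otimes>\<^bsub>?D\<^esub> R = S \<otimes>\<^bsub>?D\<^esub> R \<oplus>\<^bsub>?D\<^esub> T \<otimes>\<^bsub>?D\<^esub> R"
    by (rule realizes_unique[OF realizes_mult[OF realizes_add[OF F G] H] realizes_add[OF realizes_mult[OF F H] realizes_mult[OF G H]]]) simp
  show "R \<otimes>\<^bsub>?D\<^esub> (S \<oplus>\<^bsub>?D\<^esub> T) = R \<otimes>\<^bsub>?D\<^esub> S \<oplus>\<^bsub>?D\<^esub> R \<otimes>\<^bsub>?D\<^esub> T"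
  proof (rule realizes_unique[OF realizes_mult[OF H realizes_add[OF F G]] realizes_add[OF realizes_mult[OF H F] realizes_mult[OF H G]]])
    fix f assume "analytic_at2 f p"
    then show "near p (H (\<lambda>q. F f q + G f q)) (\<lambda>q. H (F f) q + H (G f) q)"
      using F G H by (intro is_diff_op_linear) (auto simp: realizes_def is_diff_op_analytic)
  qed
qed

lemma ring_mat2_ring:
  assumes "ring R"
  shows "ring (mat2_ring R)"
proof -
  interpret ring R by fact
  have neg: "\<exists>Y\<in>carrier (mat2_ring R). Y \<oplus>\<^bsub>mat2_ring R\<^esub> X = \<zero>\<^bsub>mat2_ring R\<^esub>" if "X \<in> carrier (mat2_ring R)" for X
    using that by (intro bexI[of _ "\<chi> i j. \<ominus>\<^bsub>R\<^esub> X $ i $ j"]) (auto simp: mat2_ring_def vec_eq_iff l_neg)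
  show ?thesis
  proof (rule ringI)
    show "abelian_group (mat2_ring R)"
      by (rule abelian_groupI[OF _ _ _ _ _ neg]) (auto simp: mat2_ring_def vec_eq_iff a_ac)
    show "monoid (mat2_ring R)"
      by (rule monoidI) (auto simp: mat2_ring_def vec_eq_iff forall_2 l_distr r_distr m_assoc a_ac)
  qed (auto simp: mat2_ring_def vec_eq_iff l_distr r_distr a_ac)
qed

section \<open>Independent functions and finite evaluations\<close>

text \<open>Finitely many linearly independent functions on X have a dual basis that consists of finite linear
combinations of evaluations at points of X.  It is used to extract coefficients: an identity that is known at each
point of X separately then only has to be used at finitely many points.  This matters for germs,
because the neighbourhood on which an identity of germs holds depends on the point.

The induction is Gram-Schmidt without an inner product: subtract from the new function its
expansion in the old ones and evaluate at a point where the difference does not vanish.\<close>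

lemma dual_evaluations:
  fixes f :: "'i \<Rightarrow> 'x \<Rightarrow> complex"
  assumes "finite I"
    and "\<And>c. (\<And>P. P \<in> X \<Longrightarrow> (\<Sum>i\<in>I. c i * f i P) = 0) \<Longrightarrow> \<forall>i\<in>I. c i = 0"
  shows "\<exists>S k. finite S \<and> S \<subseteq> X \<and> (\<forall>i\<in>I. \<forall>j\<in>I. (\<Sum>P\<in>S. k i P * f j P) = (if i = j then 1 else 0))"
  using assms
proof (induction I rule: finite_induct)
  case empty
  then show ?case by (intro exI[of _ "{}"]) auto
next
  case (insert m I)
  have "\<forall>i\<in>I. c i = 0" if "\<And>P. P \<in> X \<Longrightarrow> (\<Sum>i\<in>I. c i * f i P) = 0" for c
  proof -
    have "(\<Sum>i\<in>I. (c(m := 0)) i * f i P) = (\<Sum>i\<in>I. c i * f i P)" for P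
      using insert.hyps by (intro sum.cong) auto
    then have "\<forall>i\<in>insert m I. (c(m := 0)) i = 0"
      using insert.hyps that by (intro insert.prems) simp
    then show ?thesis using insert.hyps by (metis fun_upd_apply insertI2)
  qed
  from insert.IH[OF this] obtain S k where S: "finite S" "S \<subseteq> X"
    and k: "\<And>i j. i \<in> I \<Longrightarrow> j \<in> I \<Longrightarrow> (\<Sum>P\<in>S. k i P * f j P) = (if i = j then 1 else 0)"
    by blast
  define t where "t = (\<lambda>i. \<Sum>P\<in>S. k i P * f m P)"
  define f' where "f' = (\<lambda>P. f m P - (\<Sum>i\<in>I. t i * f i P))"
  have "\<exists>P0\<in>X. f' P0 \<noteq> 0"
  proof (rule ccontr)
    assume *: "\<not> ?thesis"
    have "(\<Sum>i\<in>insert m I. (if i = m then 1 else - t i) * f i P) = f' P" for P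
    proof -
      have "(\<Sum>i\<in>I. (if i = m then 1 else - t i) * f i P) = (\<Sum>i\<in>I. - (t i * f i P))"
        using insert.hyps by (intro sum.cong) auto
      then show ?thesis using insert.hyps by (simp add: f'_def sum_negf)
    qed
    then have "\<forall>i\<in>insert m I. (if i = m then 1 else - t i) = 0"
      using * by (intro insert.prems) auto
    then show False by auto
  qed
  then obtain P0 where P0: "P0 \<in> X" "f' P0 \<noteq> 0" by blast
  define S' where "S' = insert P0 S"
  define k0 where "k0 = (\<lambda>i P. if P \<in> S then k i P else 0)"
  \<comment> \<open>the functional dual to the new function, and then the correction of the old functionals\<close>
  define km where "km = (\<lambda>P. ((if P = P0 then 1 else 0) - (\<Sum>i\<in>I. f i P0 * k0 i P)) / f' P0)"
  define k' where "k' = (\<lambda>i P. if i = m then km P else k0 i P - t i * km P)"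
  have S': "finite S'" "S' \<subseteq> X" using S P0 by (auto simp: S'_def)
  have ev0: "(\<Sum>P\<in>S'. k0 i P * h P) = (\<Sum>P\<in>S. k i P * h P)" for i h
    unfolding S'_def k0_def using S(1) by (intro sum.mono_neutral_cong_right) auto
  have evm: "(\<Sum>P\<in>S'. km P * h P) = (h P0 - (\<Sum>i\<in>I. f i P0 * (\<Sum>P\<in>S. k i P * h P))) / f' P0" for h
  proof -
    have "(\<Sum>P\<in>S'. km P * h P) = ((\<Sum>P\<in>S'. (if P = P0 then h P else 0)) - (\<Sum>P\<in>S'. \<Sum>i\<in>I. f i P0 * (k0 i P * h P))) / f' P0"
      unfolding sum_subtractf[symmetric] sum_divide_distrib km_def
      by (intro sum.cong) (auto simp: sum_distrib_right sum_distrib_left field_simps)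
    also have "(\<Sum>P\<in>S'. (if P = P0 then h P else 0)) = h P0"
      using S' by (simp add: S'_def)
    also have "(\<Sum>P\<in>S'. \<Sum>i\<in>I. f i P0 * (k0 i P * h P)) = (\<Sum>i\<in>I. f i P0 * (\<Sum>P\<in>S. k i P * h P))"
      by (subst sum.swap) (simp add: sum_distrib_left[symmetric] ev0)
    finally show ?thesis .
  qed
  have evi: "(\<Sum>P\<in>S'. (k0 i P - t i * km P) * h P) = (\<Sum>P\<in>S. k i P * h P) - t i * (\<Sum>P\<in>S'. km P * h P)" for i h
    by (simp add: left_diff_distrib sum_subtractf ev0 sum_distrib_left mult.assoc)
  have evm_m: "(\<Sum>P\<in>S'. km P * f m P) = 1"
    using P0(2) unfolding evm by (simp add: f'_def t_def mult.commute)
  have evm_j: "(\<Sum>P\<in>S'. km P * f j P) = 0" if "j \<in> I" for j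
  proof -
    have "(\<Sum>i\<in>I. f i P0 * (\<Sum>P\<in>S. k i P * f j P)) = (\<Sum>i\<in>I. if i = j then f i P0 else 0)"
      using k that by (intro sum.cong) auto
    then show ?thesis unfolding evm using that insert.hyps by simp
  qed
  have "(\<Sum>P\<in>S'. k' i P * f j P) = (if i = j then 1 else 0)" if ij: "i \<in> insert m I" "j \<in> insert m I" for i j
  proof (cases "i = m")
    case True
    then show ?thesis using ij evm_m evm_j insert.hyps by (auto simp: k'_def)
  next
    case False
    then have "i \<in> I" using ij by simp
    then show ?thesis
      using False ij k evm_m evm_j insert.hyps by (auto simp: k'_def evi) (simp_all add: t_def)
  qed
  with S' show ?case by blast
qed

text \<open>The coefficients b depend on q and the functions f do not.  Vanishing of the combination
for q close to the base point, with closeness depending on the point P, forces the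
coefficients to vanish for q close to the base point.\<close>

lemma eventually_coefficients_zero:
  fixes f :: "'i \<Rightarrow> 'x \<Rightarrow> complex"
  assumes I: "finite I"
    and indep: "\<And>c. (\<And>P. P \<in> X \<Longrightarrow> (\<Sum>i\<in>I. c i * f i P) = 0) \<Longrightarrow> \<forall>i\<in>I. c i = 0"
    and ev: "\<And>P. P \<in> X \<Longrightarrow> eventually (\<lambda>q. (\<Sum>i\<in>I. b i q * f i P) = 0) F"
  shows "eventually (\<lambda>q. \<forall>i\<in>I. b i q = 0) F"
proof -
  obtain S k where S: "finite S" "S \<subseteq> X"
    and k: "\<And>i j. i \<in> I \<Longrightarrow> j \<in> I \<Longrightarrow> (\<Sum>P\<in>S. k i P * f j P) = (if i = j then 1 else 0)"
  proof -
    have "\<exists>S k. finite S \<and> S \<subseteq> X \<and> (\<forall>i\<in>I. \<forall>j\<in>I. (\<Sum>P\<in>S. k i P * f j P) = (if i = j then 1 else 0))"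
      by (rule dual_evaluations[OF I]) (rule indep)
    then show ?thesis using that by blast
  qed
  have "eventually (\<lambda>q. \<forall>P\<in>S. (\<Sum>i\<in>I. b i q * f i P) = 0) F"
    using S ev by (intro eventually_ball_finite) auto
  then show ?thesis
  proof eventually_elim
    case (elim q)
    show ?case
    proof
      fix i assume i: "i \<in> I"
      have "b i q = (\<Sum>j\<in>I. b j q * (if i = j then 1 else 0))" using i I by (simp add: if_distrib cong: if_cong)
      also have "\<dots> = (\<Sum>j\<in>I. \<Sum>P\<in>S. k i P * (b j q * f j P))"
      proof (intro sum.cong refl)
        fix j assume "j \<in> I"
        have "(\<Sum>P\<in>S. k i P * (b j q * f j P)) = b j q * (\<Sum>P\<in>S. k i P * f j P)"
          by (simp add: sum_distrib_left mult_ac)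
        then show "b j q * (if i = j then 1 else 0) = (\<Sum>P\<in>S. k i P * (b j q * f j P))"
          using k[OF i \<open>j \<in> I\<close>] by simp
      qed
      also have "\<dots> = (\<Sum>P\<in>S. k i P * (\<Sum>j\<in>I. b j q * f j P))"
        by (subst sum.swap) (simp add: sum_distrib_left)
      also have "\<dots> = 0" using elim by simp
      finally show "b i q = 0" .
    qed
  qed
qed

section \<open>Vanishing of polynomials\<close>

lemma zero_off_finite:
  fixes f :: "complex \<Rightarrow> complex"
  assumes "continuous_on UNIV f" "finite S" "\<And>z. z \<notin> S \<Longrightarrow> f z = 0"
  shows "f z = 0"
proof -
  have "(f \<longlongrightarrow> f z) (at z)" using assms(1) by (simp add: continuous_on_def)
  moreover have "eventually (\<lambda>w. w \<in> - (S - {z})) (at z)"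
    using assms(2) by (intro eventually_at_in_open' open_Compl finite_imp_closed finite_Diff) auto
  then have "eventually (\<lambda>w. f w = 0) (at z)"
    using assms(3) by (auto simp: eventually_at_filter elim!: eventually_mono)
  then have "(f \<longlongrightarrow> 0) (at z)" by (rule tendsto_eventually)
  ultimately show ?thesis using tendsto_unique[OF _ \<open>(f \<longlongrightarrow> f z) (at z)\<close>] by simp
qed

lemma bivariate_coeffs_zero:
  fixes c :: "nat \<Rightarrow> nat \<Rightarrow> complex"
  assumes "\<And>X Y. (\<Sum>i\<le>n. \<Sum>j\<le>m. c i j * X ^ i * Y ^ j) = 0" "i \<le> n" "j \<le> m"
  shows "c i j = 0"
proof -
  have "(\<Sum>i\<le>n. (\<Sum>j\<le>m. c i j * Y ^ j) * X ^ i) = 0" for X Y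
    using assms(1)[of X Y] by (simp add: sum_distrib_left sum_distrib_right mult_ac)
  then have "(\<Sum>j\<le>m. c i j * Y ^ j) = 0" for Y
    using assms(2) polyfun_eq_0[of "\<lambda>i. \<Sum>j\<le>m. c i j * Y ^ j" n] by auto
  then show ?thesis
    using assms(3) polyfun_eq_0[of "c i" m] by auto
qed

section \<open>Bihomogeneous forms\<close>

lemma sum_shift:
  fixes F :: "nat \<Rightarrow> 'a::comm_monoid_add"
  assumes "k \<le> m"
  shows "(\<Sum>i\<le>m + m'. if k \<le> i \<and> i - k \<le> m' then F i else 0) = (\<Sum>i\<le>m'. F (k + i))"
proof -
  have "(\<Sum>i\<le>m + m'. if k \<le> i \<and> i - k \<le> m' then F i else 0) = (\<Sum>i\<in>{i. i \<le> m + m' \<and> k \<le> i \<and> i - k \<le> m'}. F i)"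
    by (auto simp: sum.If_cases intro!: sum.cong)
  also have "\<dots> = (\<Sum>i\<le>m'. F (k + i))"
    using assms by (intro sum.reindex_bij_witness[of _ "\<lambda>i. k + i" "\<lambda>i. i - k"]) auto
  finally show ?thesis .
qed

text \<open>The coefficients of the product of two bihomogeneous forms, as polynomial expressions in
the coefficients of the factors; in particular they are analytic when those are.\<close>

definition conv :: "nat \<Rightarrow> nat \<Rightarrow> nat \<Rightarrow> nat \<Rightarrow> (nat \<Rightarrow> nat \<Rightarrow> complex) \<Rightarrow> (nat \<Rightarrow> nat \<Rightarrow> complex) \<Rightarrow> nat \<Rightarrow> nat \<Rightarrow> complex" where
  "conv m n m' n' a b = (\<lambda>i j. \<Sum>k\<le>m. \<Sum>l\<le>n.
     if k \<le> i \<and> i - k \<le> m' then if l \<le> j \<and> j - l \<le> n' then a k l * b (i - k) (j - l) else 0 else 0)"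

lemma bihom_mult:
  "bihom m n a P * bihom m' n' b P = bihom (m + m') (n + n') (conv m n m' n' a b) P"
proof -
  obtain z1 z2 w1 w2 where P: "P = (z1, z2, w1, w2)" by (cases P)
  let ?M = "\<lambda>i j. z1 ^ i * z2 ^ (m + m' - i) * w1 ^ j * w2 ^ (n + n' - j)"
  have "bihom (m + m') (n + n') (conv m n m' n' a b) P =
    (\<Sum>i\<le>m + m'. \<Sum>j\<le>n + n'. \<Sum>k\<le>m. \<Sum>l\<le>n.
      if k \<le> i \<and> i - k \<le> m' then if l \<le> j \<and> j - l \<le> n' then a k l * b (i - k) (j - l) * ?M i j else 0 else 0)"
    unfolding bihom_def conv_def P prod.case sum_distrib_right mult.assoc
    by (intro sum.cong) auto
  also have "\<dots> = (\<Sum>i\<le>m + m'. \<Sum>k\<le>m. \<Sum>j\<le>n + n'. \<Sum>l\<le>n.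
      if k \<le> i \<and> i - k \<le> m' then if l \<le> j \<and> j - l \<le> n' then a k l * b (i - k) (j - l) * ?M i j else 0 else 0)"
    by (rule sum.cong[OF refl], rule sum.swap)
  also have "\<dots> = (\<Sum>k\<le>m. \<Sum>i\<le>m + m'. \<Sum>l\<le>n. \<Sum>j\<le>n + n'.
      if k \<le> i \<and> i - k \<le> m' then if l \<le> j \<and> j - l \<le> n' then a k l * b (i - k) (j - l) * ?M i j else 0 else 0)"
    by (subst sum.swap, rule sum.cong[OF refl], rule sum.cong[OF refl], rule sum.swap)
  also have "\<dots> = (\<Sum>k\<le>m. \<Sum>i\<le>m'. \<Sum>l\<le>n. \<Sum>j\<le>n'. a k l * b i j * ?M (k + i) (l + j))"
  proof (rule sum.cong[OF refl])
    fix k assume "k \<in> {..m}"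
    have "(\<Sum>i\<le>m + m'. \<Sum>l\<le>n. \<Sum>j\<le>n + n'.
        if k \<le> i \<and> i - k \<le> m' then if l \<le> j \<and> j - l \<le> n' then a k l * b (i - k) (j - l) * ?M i j else 0 else 0) =
      (\<Sum>i\<le>m + m'. if k \<le> i \<and> i - k \<le> m' then (\<Sum>l\<le>n. \<Sum>j\<le>n + n'.
        if l \<le> j \<and> j - l \<le> n' then a k l * b (i - k) (j - l) * ?M i j else 0) else 0)"
      by (intro sum.cong) auto
    also have "\<dots> = (\<Sum>i\<le>m'. \<Sum>l\<le>n. \<Sum>j\<le>n + n'.
        if l \<le> j \<and> j - l \<le> n' then a k l * b i (j - l) * ?M (k + i) j else 0)"
      using \<open>k \<in> {..m}\<close> sum_shift[of k m m' "\<lambda>i. \<Sum>l\<le>n. \<Sum>j\<le>n + n'.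
        if l \<le> j \<and> j - l \<le> n' then a k l * b (i - k) (j - l) * ?M i j else 0"] by (simp cong: if_cong)
    also have "\<dots> = (\<Sum>i\<le>m'. \<Sum>l\<le>n. \<Sum>j\<le>n'. a k l * b i j * ?M (k + i) (l + j))"
    proof (rule sum.cong[OF refl], rule sum.cong[OF refl])
      fix i l assume "l \<in> {..n}"
      then show "(\<Sum>j\<le>n + n'. if l \<le> j \<and> j - l \<le> n' then a k l * b i (j - l) * ?M (k + i) j else 0) =
          (\<Sum>j\<le>n'. a k l * b i j * ?M (k + i) (l + j))"
        using sum_shift[of l n n' "\<lambda>j. a k l * b i (j - l) * ?M (k + i) j"] by (simp cong: if_cong)
    qed
    finally show "(\<Sum>i\<le>m + m'. \<Sum>l\<le>n. \<Sum>j\<le>n + n'.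
        if k \<le> i \<and> i - k \<le> m' then if l \<le> j \<and> j - l \<le> n' then a k l * b (i - k) (j - l) * ?M i j else 0 else 0) =
      (\<Sum>i\<le>m'. \<Sum>l\<le>n. \<Sum>j\<le>n'. a k l * b i j * ?M (k + i) (l + j))" .
  qed
  also have "\<dots> = (\<Sum>k\<le>m. \<Sum>l\<le>n. \<Sum>i\<le>m'. \<Sum>j\<le>n'. a k l * b i j * ?M (k + i) (l + j))"
    by (rule sum.cong[OF refl], rule sum.swap)
  also have "\<dots> = (\<Sum>k\<le>m. \<Sum>l\<le>n. \<Sum>i\<le>m'. \<Sum>j\<le>n'.
      (a k l * z1 ^ k * z2 ^ (m - k) * w1 ^ l * w2 ^ (n - l)) * (b i j * z1 ^ i * z2 ^ (m' - i) * w1 ^ j * w2 ^ (n' - j)))"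
  proof (intro sum.cong refl)
    fix k l i j assume "k \<in> {..m}" "l \<in> {..n}" "i \<in> {..m'}" "j \<in> {..n'}"
    then have "m + m' - (k + i) = (m - k) + (m' - i)" "n + n' - (l + j) = (n - l) + (n' - j)" by auto
    then show "a k l * b i j * ?M (k + i) (l + j) =
        (a k l * z1 ^ k * z2 ^ (m - k) * w1 ^ l * w2 ^ (n - l)) * (b i j * z1 ^ i * z2 ^ (m' - i) * w1 ^ j * w2 ^ (n' - j))"
      by (simp add: power_add mult_ac)
  qed
  also have "\<dots> = bihom m n a P * bihom m' n' b P"
    unfolding bihom_def P prod.case by (simp only: sum_distrib_right, simp only: sum_distrib_left)
  finally show ?thesis ..
qed

lemma bihom_add: "bihom m n a P + bihom m n b P = bihom m n (\<lambda>i j. a i j + b i j) P"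
  by (cases P) (simp add: bihom_def distrib_right sum.distrib)

lemma bihom_cmult: "c * bihom m n a P = bihom m n (\<lambda>i j. c * a i j) P"
  by (cases P) (simp add: bihom_def sum_distrib_left mult.assoc)

lemma bihom_zero: "bihom m n (\<lambda>_ _. 0) P = 0"
  by (cases P) (simp add: bihom_def)

lemma bihom_sum: "(\<Sum>k\<in>K. bihom m n (a k) P) = bihom m n (\<lambda>i j. \<Sum>k\<in>K. a k i j) P"
  by (induction K rule: infinite_finite_induct) (auto simp: bihom_zero bihom_add)

lemma bilin_eq_bihom: "bilin a b c d = bihom 1 1 (\<lambda>i j. if i = 1 then if j = 1 then a else b else if j = 1 then c else d)"
  by (auto simp: bilin_def bihom_def fun_eq_iff)

lemma bihom_power: "\<exists>a. \<forall>P. bihom m n b P ^ k = bihom (k * m) (k * n) a P"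
proof (induction k)
  case 0
  then show ?case by (intro exI[of _ "\<lambda>_ _. 1"]) (auto simp: bihom_def)
next
  case (Suc k)
  then obtain a where "\<forall>P. bihom m n b P ^ k = bihom (k * m) (k * n) a P" by blast
  then show ?case by (intro exI[of _ "conv m n (k * m) (k * n) b a"]) (simp add: bihom_mult)
qed

lemma bihom_conv_analytic:
  assumes "\<And>i j. analytic_at2 (a i j) p" "\<And>i j. analytic_at2 (b i j) p"
  shows "analytic_at2 (\<lambda>q. conv m n m' n' (\<lambda>i j. a i j q) (\<lambda>i j. b i j q) i j) p"
  unfolding conv_def using assms by (intro analytic_at2_sum analytic_at2_if analytic_at2_mult)

text \<open>Binary forms, obtained from bihomogeneous ones by fixing one of the two points.\<close>

definition bform :: "nat \<Rightarrow> (nat \<Rightarrow> complex) \<Rightarrow> complex \<Rightarrow> complex \<Rightarrow> complex" where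
  "bform n c x y = (\<Sum>j\<le>n. c j * x ^ j * y ^ (n - j))"

lemma bform_scale: "bform n c (k * x) (k * y) = k ^ n * bform n c x y"
  unfolding bform_def sum_distrib_left
proof (intro sum.cong refl)
  fix j assume "j \<in> {..n}"
  then have "k ^ n = k ^ j * k ^ (n - j)" by (simp flip: power_add)
  then show "c j * (k * x) ^ j * (k * y) ^ (n - j) = k ^ n * (c j * x ^ j * y ^ (n - j))"
    by (simp add: power_mult_distrib)
qed

lemma bihom_fix_left:
  "bihom m n a (z1, z2, w1, w2) = bform n (\<lambda>j. \<Sum>i\<le>m. a i j * z1 ^ i * z2 ^ (m - i)) w1 w2"
  unfolding bihom_def bform_def prod.case
  by (subst sum.swap) (simp add: sum_distrib_left sum_distrib_right mult_ac)

lemma bihom_fix_right: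
  "bihom m n a (z1, z2, w1, w2) = bform m (\<lambda>i. \<Sum>j\<le>n. a i j * w1 ^ j * w2 ^ (n - j)) z1 z2"
  unfolding bihom_def bform_def prod.case
  by (simp add: sum_distrib_left sum_distrib_right mult_ac)

lemma bform_linear_change:
  "\<exists>c'. \<forall>x y. (\<Sum>j\<le>n. c j * (s1 * x + s2 * y) ^ j * (t1 * x + t2 * y) ^ (n - j)) = bform n c' x y"
proof -
  have lin: "s1 * x + s2 * y = bihom 1 0 (\<lambda>i j. if i = 0 then s2 else s1) (x, y, 1, 1)" for s1 s2 x y
    by (simp add: bihom_def)
  have "\<exists>a. \<forall>x y. (s1 * x + s2 * y) ^ j * (t1 * x + t2 * y) ^ (n - j) = bihom n 0 a (x, y, 1, 1)" if "j \<le> n" for j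
  proof -
    obtain a b where "\<And>P. bihom 1 0 (\<lambda>i j. if i = 0 then s2 else s1) P ^ j = bihom (j * 1) (j * 0) a P"
       "\<And>P. bihom 1 0 (\<lambda>i j. if i = 0 then t2 else t1) P ^ (n - j) = bihom ((n - j) * 1) ((n - j) * 0) b P"
      using bihom_power by metis
    then have "(s1 * x + s2 * y) ^ j * (t1 * x + t2 * y) ^ (n - j) = bihom (j + (n - j)) (0 + 0) (conv j 0 (n - j) 0 a b) (x, y, 1, 1)" for x y
      unfolding lin by (simp add: bihom_mult)
    with that show ?thesis by auto
  qed
  then obtain a where a: "\<And>j x y. j \<le> n \<Longrightarrow> (s1 * x + s2 * y) ^ j * (t1 * x + t2 * y) ^ (n - j) = bihom n 0 (a j) (x, y, 1, 1)"
    by metis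
  have "(\<Sum>j\<le>n. c j * (s1 * x + s2 * y) ^ j * (t1 * x + t2 * y) ^ (n - j)) = bform n (\<lambda>i. \<Sum>j\<le>n. c j * a j i 0) x y" for x y
  proof -
    have "(\<Sum>j\<le>n. c j * (s1 * x + s2 * y) ^ j * (t1 * x + t2 * y) ^ (n - j)) = (\<Sum>j\<le>n. c j * bihom n 0 (a j) (x, y, 1, 1))"
      using a by (intro sum.cong) (auto simp: mult.assoc)
    also have "\<dots> = bihom n 0 (\<lambda>i k. \<Sum>j\<le>n. c j * a j i k) (x, y, 1, 1)"
      by (simp add: bihom_cmult bihom_sum)
    also have "\<dots> = bform n (\<lambda>i. \<Sum>j\<le>n. c j * a j i 0) x y"
      by (simp add: bform_def bihom_def)
    finally show ?thesis .
  qed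
  then show ?thesis by blast
qed

section \<open>Regular rational functions\<close>

text \<open>A rational function of one variable without poles is a polynomial.  If the denominator b of a representation has a root
s, compare with a representation whose denominator does not vanish at s: then s is a root of the
numerator as well, and the linear factor cancels.  Once b has no root it is constant.\<close>

lemma regular_rational_is_poly:
  fixes r :: "complex \<Rightarrow> complex" and a b :: "complex poly"
  assumes loc: "\<And>s. \<exists>a b. poly b s \<noteq> 0 \<and> (\<forall>t. poly b t \<noteq> 0 \<longrightarrow> r t = poly a t / poly b t)"
    and b: "b \<noteq> 0" and ab: "\<And>t. poly b t \<noteq> 0 \<Longrightarrow> r t = poly a t / poly b t"
  shows "\<exists>c. degree c \<le> degree a \<and> (\<forall>t. r t = poly c t)"
  using b ab
proof (induction "degree b" arbitrary: a b rule: less_induct)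
  case less
  show ?case
  proof (cases "\<exists>s. poly b s = 0")
    case False
    then have "constant (poly b)" using Fundamental_Theorem_Algebra.fundamental_theorem_of_algebra[of b] by blast
    then have k: "poly b t = poly b 0" for t unfolding constant_def by (rule allE[of _ t]) (rule spec)
    define k where "k = poly b 0"
    have "r t = poly (smult (1 / k) a) t" for t
      using less.prems(2)[of t] False k[of t] by (auto simp: k_def)
    moreover have "degree (smult (1 / k) a) \<le> degree a" by (rule degree_smult_le)
    ultimately show ?thesis by blast
  next
    case True
    then obtain s where s: "poly b s = 0" by blast
    obtain a0 b0 where ab0: "poly b0 s \<noteq> 0" "\<And>t. poly b0 t \<noteq> 0 \<Longrightarrow> r t = poly a0 t / poly b0 t"
      using loc by blast
    have "poly ((b * a0 - a * b0) * (b * b0)) t = 0" for t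
    proof (cases "poly b t = 0 \<or> poly b0 t = 0")
      case False
      then have "poly a t / poly b t = poly a0 t / poly b0 t"
        using less.prems(2)[of t] ab0(2)[of t] by simp
      then show ?thesis using False by (simp add: field_simps)
    qed auto
    then have "(b * a0 - a * b0) * (b * b0) = 0" by (simp only: poly_all_0_iff_0[symmetric] simp_thms)
    moreover have "b0 \<noteq> 0" using ab0(1) by auto
    ultimately have eq: "b * a0 = a * b0" using less.prems(1) by simp
    then have "poly (b * a0) s = poly (a * b0) s" by simp
    then have "poly a s * poly b0 s = 0" using s by simp
    then have "poly a s = 0" using ab0(1) by simp
    then obtain a1 where a1: "a = [:- s, 1:] * a1" by (auto simp: poly_eq_0_iff_dvd elim: dvdE)
    obtain b1 where b1: "b = [:- s, 1:] * b1" using s by (auto simp: poly_eq_0_iff_dvd elim: dvdE)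
    have b10: "b1 \<noteq> 0" using less.prems(1) b1 by auto
    have deg: "degree b = Suc (degree b1)" unfolding b1 using b10 by (subst degree_mult_eq) auto
    have eq1: "b1 * a0 = a1 * b0"
      using eq unfolding a1 b1 mult.assoc by (subst (asm) mult_left_cancel) auto
    have "r t = poly a1 t / poly b1 t" if "poly b1 t \<noteq> 0" for t
    proof (cases "t = s")
      case True
      have "poly (b1 * a0) t = poly (a1 * b0) t" using eq1 by simp
      then have "poly b1 t * poly a0 t = poly a1 t * poly b0 t" by simp
      moreover have "r t = poly a0 t / poly b0 t" "poly b0 t \<noteq> 0" using ab0 True by auto
      ultimately show ?thesis using that by (simp add: frac_eq_eq mult_ac)
    next
      case False
      have "poly a t = (t - s) * poly a1 t" "poly b t = (t - s) * poly b1 t"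
        by (simp_all add: a1 b1 algebra_simps)
      then show ?thesis using less.prems(2)[of t] that False by simp
    qed
    then have "\<exists>c. degree c \<le> degree a1 \<and> (\<forall>t. r t = poly c t)"
      using deg b10 by (intro less.hyps) auto
    then obtain c where c: "degree c \<le> degree a1" "\<And>t. r t = poly c t" by blast
    have "degree a1 \<le> degree a"
    proof (cases "a1 = 0")
      case False
      then have "degree a = Suc (degree a1)" unfolding a1 by (subst degree_mult_eq) auto
      then show ?thesis by simp
    qed simp
    with c show ?thesis by (intro exI[of _ c]) auto
  qed
qed

text \<open>On the projective line, the complement of the zero of the linear form A x + D y is an
affine line.  On it the function is a polynomial of degree at most n in an affine
coordinate, which after multiplication by the N-th power of the linear form is a form of degree N.\<close>

lemma regular_quotient_is_bform:
  fixes r :: "complex \<Rightarrow> complex \<Rightarrow> complex"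
  assumes AD: "A \<noteq> 0 \<or> D \<noteq> 0"
    and loc: "\<And>x y. A * x + D * y \<noteq> 0 \<Longrightarrow> \<exists>n a b. bform n b x y \<noteq> 0 \<and>
      (\<forall>x y. A * x + D * y \<noteq> 0 \<longrightarrow> bform n b x y \<noteq> 0 \<longrightarrow> r x y = bform n a x y / bform n b x y)"
    and n: "n \<le> N" and uv: "A * u + D * v \<noteq> 0" "bform n b u v \<noteq> 0"
    and rep: "\<And>x y. A * x + D * y \<noteq> 0 \<Longrightarrow> bform n b x y \<noteq> 0 \<Longrightarrow> r x y = bform n a x y / bform n b x y"
  shows "\<exists>c. \<forall>x y. A * x + D * y \<noteq> 0 \<longrightarrow> r x y * (A * x + D * y) ^ N = bform N c x y"
proof -
  obtain p1 p2 where p: "A * p1 + D * p2 = 1"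
  proof (cases "A = 0")
    case True
    then show ?thesis using AD that[of 0 "1 / D"] by simp
  next
    case False
    then show ?thesis using that[of "1 / A" 0] by simp
  qed
  \<comment> \<open>an affine parametrization of the line where the linear form equals 1\<close>
  define X Y where "X = (\<lambda>s. p1 + s * D)" and "Y = (\<lambda>s. p2 - s * A)"
  define R where "R = (\<lambda>s. r (X s) (Y s))"
  have one: "A * X s + D * Y s = 1" for s
    using p by (simp add: X_def Y_def algebra_simps)
  define toP where "toP = (\<lambda>n c. \<Sum>j\<le>n. smult (c j) ([:p1, D:] ^ j * [:p2, - A:] ^ (n - j)))"
  have toP: "poly (toP n c) s = bform n c (X s) (Y s)" for n c s
    by (simp add: toP_def poly_sum bform_def X_def Y_def algebra_simps)
  have degP: "degree (toP n c) \<le> n" for n c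
    unfolding toP_def
  proof (intro degree_sum_le)
    fix j assume "j \<in> {..n}"
    have "degree ([:p1, D:] ^ j * [:p2, - A:] ^ (n - j)) \<le> degree ([:p1, D:] ^ j) + degree ([:p2, - A:] ^ (n - j))"
      by (rule degree_mult_le)
    also have "\<dots> \<le> degree [:p1, D:] * j + degree [:p2, - A:] * (n - j)"
      by (intro add_mono degree_power_le)
    also have "\<dots> \<le> 1 * j + 1 * (n - j)"
      by (intro add_mono mult_right_mono) auto
    also have "\<dots> = n" using \<open>j \<in> {..n}\<close> by simp
    finally show "degree (smult (c j) ([:p1, D:] ^ j * [:p2, - A:] ^ (n - j))) \<le> n"
      using degree_smult_le le_trans by blast
  qed simp
  have coords: "x = (A * x + D * y) * X ((p2 * x - p1 * y) / (A * x + D * y))"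
    "y = (A * x + D * y) * Y ((p2 * x - p1 * y) / (A * x + D * y))" if "A * x + D * y \<noteq> 0" for x y
  proof -
    have "x = (A * p1 + D * p2) * x" "y = (A * p1 + D * p2) * y" using p by simp_all
    moreover have "(A * x + D * y) * X ((p2 * x - p1 * y) / (A * x + D * y)) = (A * x + D * y) * p1 + (p2 * x - p1 * y) * D"
      "(A * x + D * y) * Y ((p2 * x - p1 * y) / (A * x + D * y)) = (A * x + D * y) * p2 - (p2 * x - p1 * y) * A"
      using that by (simp_all add: X_def Y_def distrib_left right_diff_distrib)
    ultimately show "x = (A * x + D * y) * X ((p2 * x - p1 * y) / (A * x + D * y))"
      "y = (A * x + D * y) * Y ((p2 * x - p1 * y) / (A * x + D * y))"
      by (simp_all add: algebra_simps)
  qed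
  have homog: "r (k * X s) (k * Y s) = R s" if "k \<noteq> 0" for k s
  proof -
    have "A * (k * X s) + D * (k * Y s) = k * (A * X s + D * Y s)" by (simp add: algebra_simps)
    then have "A * (k * X s) + D * (k * Y s) = k" by (simp add: one)
    moreover obtain n' a' b' where *: "bform n' b' (X s) (Y s) \<noteq> 0"
      "\<And>x y. A * x + D * y \<noteq> 0 \<Longrightarrow> bform n' b' x y \<noteq> 0 \<Longrightarrow> r x y = bform n' a' x y / bform n' b' x y"
      using loc[of "X s" "Y s"] one[of s] by auto
    ultimately have "r (k * X s) (k * Y s) = (k ^ n' * bform n' a' (X s) (Y s)) / (k ^ n' * bform n' b' (X s) (Y s))"
      using that by (subst *(2)) (simp_all add: bform_scale)
    also have "\<dots> = R s" using that * one[of s] by (simp add: R_def)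
    finally show ?thesis .
  qed
  have "\<exists>c. degree c \<le> degree (toP n a) \<and> (\<forall>t. R t = poly c t)"
  proof (rule regular_rational_is_poly)
    show "\<exists>a b. poly b s \<noteq> 0 \<and> (\<forall>t. poly b t \<noteq> 0 \<longrightarrow> R t = poly a t / poly b t)" for s
    proof -
      obtain n' a' b' where *: "bform n' b' (X s) (Y s) \<noteq> 0"
        "\<And>x y. A * x + D * y \<noteq> 0 \<Longrightarrow> bform n' b' x y \<noteq> 0 \<Longrightarrow> r x y = bform n' a' x y / bform n' b' x y"
        using loc[of "X s" "Y s"] one[of s] by auto
      then show ?thesis
        by (intro exI[of _ "toP n' a'"] exI[of _ "toP n' b'"]) (auto simp: toP R_def one)
    qed
    show "R t = poly (toP n a) t / poly (toP n b) t" if "poly (toP n b) t \<noteq> 0" for t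
      using that by (auto simp: toP R_def one intro!: rep)
    have "bform n b u v = (A * u + D * v) ^ n * poly (toP n b) ((p2 * u - p1 * v) / (A * u + D * v))"
      unfolding toP by (subst bform_scale[symmetric]) (simp only: coords[OF uv(1), symmetric])
    then show "toP n b \<noteq> 0" using uv(2) by auto
  qed
  then obtain c where c: "degree c \<le> n" "\<And>t. R t = poly c t" using degP le_trans by blast
  obtain c' where c': "\<And>x y. (\<Sum>j\<le>N. coeff c j * (p2 * x + (- p1) * y) ^ j * (A * x + D * y) ^ (N - j)) = bform N c' x y"
    using bform_linear_change[of "coeff c" p2 "- p1" A D N] by blast
  have "r x y * (A * x + D * y) ^ N = bform N c' x y" if nz: "A * x + D * y \<noteq> 0" for x y
  proof -
    define l s where "l = A * x + D * y" and "s = p2 * x + (- p1) * y"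
    have l0: "l \<noteq> 0" using nz by (simp add: l_def)
    have "r x y = R (s / l)"
      using coords[OF nz] homog[OF nz, of "(p2 * x - p1 * y) / (A * x + D * y)"] by (simp add: l_def s_def)
    also have "\<dots> = (\<Sum>j\<le>N. coeff c j * (s / l) ^ j)"
      unfolding c(2) poly_altdef using c(1) n by (intro sum.mono_neutral_left) (auto simp: coeff_eq_0)
    also have "\<dots> * l ^ N = (\<Sum>j\<le>N. coeff c j * s ^ j * l ^ (N - j))"
      unfolding sum_distrib_right
    proof (intro sum.cong refl)
      fix j assume "j \<in> {..N}"
      then have "l ^ N = l ^ j * l ^ (N - j)" by (simp flip: power_add)
      then show "coeff c j * (s / l) ^ j * l ^ N = coeff c j * s ^ j * l ^ (N - j)"
        using l0 by (simp add: power_divide)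
    qed
    finally show ?thesis using c'[of x y] by (simp add: l_def s_def)
  qed
  then show ?thesis by blast
qed

section \<open>Functions that are polynomial on lines\<close>

text \<open>Polynomials in four variables only enter through the fact that a product of two of them
vanishes identically only if one of the factors does.  Restriction to the line through two
points reduces this to one variable.\<close>

fun hline :: "hcoord \<Rightarrow> hcoord \<Rightarrow> complex \<Rightarrow> hcoord" where
  "hline (a1, a2, a3, a4) (b1, b2, b3, b4) t =
     (a1 + t * (b1 - a1), a2 + t * (b2 - a2), a3 + t * (b3 - a3), a4 + t * (b4 - a4))"

lemma hline_0 [simp]: "hline P Q 0 = P" and hline_1 [simp]: "hline P Q 1 = Q"
  by (cases P; cases Q; simp)+

definition linepoly :: "(hcoord \<Rightarrow> complex) \<Rightarrow> bool" where
  "linepoly f \<longleftrightarrow> (\<forall>P Q. \<exists>p. \<forall>t. f (hline P Q t) = poly p t)"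

lemma linepoly_const [intro, simp]: "linepoly (\<lambda>_. c)"
  unfolding linepoly_def by (intro allI exI[of _ "[:c:]"]) simp

lemma linepoly_add [intro]: "linepoly f \<Longrightarrow> linepoly h \<Longrightarrow> linepoly (\<lambda>P. f P + h P)"
  unfolding linepoly_def by (metis poly_add)

lemma linepoly_mult [intro]: "linepoly f \<Longrightarrow> linepoly h \<Longrightarrow> linepoly (\<lambda>P. f P * h P)"
  unfolding linepoly_def by (metis poly_mult)

lemma linepoly_diff [intro]: "linepoly f \<Longrightarrow> linepoly h \<Longrightarrow> linepoly (\<lambda>P. f P - h P)"
  unfolding linepoly_def by (metis poly_diff)

lemma linepoly_power [intro]: "linepoly f \<Longrightarrow> linepoly (\<lambda>P. f P ^ n)"
  by (induction n) auto

lemma linepoly_sum [intro]: "(\<And>i. i \<in> I \<Longrightarrow> linepoly (f i)) \<Longrightarrow> linepoly (\<lambda>P. \<Sum>i\<in>I. f i P)"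
  by (induction I rule: infinite_finite_induct) auto

lemma linepoly_prod [intro]: "(\<And>i. i \<in> I \<Longrightarrow> linepoly (f i)) \<Longrightarrow> linepoly (\<lambda>P. \<Prod>i\<in>I. f i P)"
  by (induction I rule: infinite_finite_induct) auto

lemma linepoly_coords [intro, simp]:
  "linepoly (\<lambda>P. fst P)" "linepoly (\<lambda>P. fst (snd P))" "linepoly (\<lambda>P. fst (snd (snd P)))" "linepoly (\<lambda>P. snd (snd (snd P)))"
proof -
  have "\<exists>p. \<forall>t. a + t * b = poly p t" for a b :: complex
    by (intro exI[of _ "[:a, b:]"]) simp
  then show "linepoly (\<lambda>P. fst P)" "linepoly (\<lambda>P. fst (snd P))" "linepoly (\<lambda>P. fst (snd (snd P)))" "linepoly (\<lambda>P. snd (snd (snd P)))"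
    unfolding linepoly_def by auto
qed

lemma linepoly_bihom_subst [intro]:
  assumes "linepoly f1" "linepoly f2" "linepoly f3" "linepoly f4"
  shows "linepoly (\<lambda>P. bihom m n a (f1 P, f2 P, f3 P, f4 P))"
  unfolding bihom_def prod.case using assms by (intro linepoly_sum linepoly_mult linepoly_power linepoly_const)

lemma linepoly_bihom [intro, simp]: "linepoly (bihom m n a)"
  using linepoly_bihom_subst[OF linepoly_coords] by simp

lemma linepoly_bilin [intro, simp]: "linepoly (bilin a b c d)"
  by (simp add: bilin_eq_bihom)

lemma linepoly_cancel:
  assumes "linepoly f" "linepoly h" "\<And>P. f P * h P = 0" "h Q \<noteq> 0"
  shows "f P = 0"
proof -
  obtain p r where p: "\<And>t. f (hline P Q t) = poly p t" and r: "\<And>t. h (hline P Q t) = poly r t"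
    using assms(1,2) unfolding linepoly_def by metis
  have "poly (p * r) t = 0" for t using assms(3)[of "hline P Q t"] p r by simp
  then have "p * r = 0" using poly_all_0_iff_0 by blast
  moreover have "r \<noteq> 0" using r[of 1] assms(4) by auto
  ultimately have "p = 0" by simp
  then show ?thesis using p[of 0] by simp
qed

section \<open>Global form of the elements of the ring of functions\<close>

text \<open>A function that is regular outside the curve g = 0 is globally a form divided by a power of
g.  For all but finitely many t, the restriction to w = (t, 1) is a binary form in z divided by a power of g,
and for almost all fixed z likewise in w; a function that is polynomial of bounded degree in each of the two variables
is polynomial, as the dual evaluations for the powers of t express the coefficients of
the forms in w through finitely many of the forms in z.  The exceptional z are removed in the end, because
two rational functions that agree on a dense set agree.\<close>

lemma A_ring_global:
  assumes g: "g = bilin \<alpha> \<beta> \<gamma> \<delta>" and g_nz: "g (0, 1, 0, 1) \<noteq> 0" and l: "l \<in> carrier (A_ring g)"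
  shows "\<exists>N a. \<forall>P\<in>nonvanishing g. l P = bihom N N a P / g P ^ N"
proof -
  have loc: "\<exists>m n a b. bihom m n b P\<^sub>0 \<noteq> 0 \<and>
      (\<forall>P. g P \<noteq> 0 \<longrightarrow> bihom m n b P \<noteq> 0 \<longrightarrow> l P = bihom m n a P / bihom m n b P)"
    if "g P\<^sub>0 \<noteq> 0" for P\<^sub>0
    using l that by (simp add: A_ring_def nonvanishing_def del: split_paired_All split_paired_Ex)
  obtain m n a b where b0: "bihom m n b (0, 1, 0, 1) \<noteq> 0"
    and ab: "\<And>P. g P \<noteq> 0 \<Longrightarrow> bihom m n b P \<noteq> 0 \<Longrightarrow> l P = bihom m n a P / bihom m n b P"
    using loc[OF g_nz] by blast
  define N where "N = m + n"
  have gz: "g (z1, z2, w1, w2) = (\<alpha> * w1 + \<beta> * w2) * z1 + (\<gamma> * w1 + \<delta> * w2) * z2"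
    and gw: "g (z1, z2, w1, w2) = (\<alpha> * z1 + \<gamma> * z2) * w1 + (\<beta> * z1 + \<delta> * z2) * w2" for z1 z2 w1 w2
    by (simp_all add: g bilin_def algebra_simps)
  \<comment> \<open>the w = (t, 1) for which the restriction to fixed w makes sense; almost all t qualify\<close>
  define X where "X = {t. bihom m n b (0, 1, t, 1) \<noteq> 0 \<and> g (0, 1, t, 1) \<noteq> 0}"
  have "infinite X"
  proof -
    obtain p where p: "\<And>t. bihom m n b (hline (0, 1, 0, 1) (0, 1, 1, 1) t) * g (hline (0, 1, 0, 1) (0, 1, 1, 1) t) = poly p t"
      using linepoly_mult[OF linepoly_bihom[of m n b] linepoly_bilin[of \<alpha> \<beta> \<gamma> \<delta>]] unfolding linepoly_def g by metis
    have X: "X = - {t. poly p t = 0}" by (auto simp: X_def p[symmetric])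
    have "p \<noteq> 0" using p[of 0] b0 g_nz by auto
    then have "finite {t. poly p t = 0}" by (rule poly_roots_finite)
    then show ?thesis unfolding X by (simp add: finite_compl infinite_UNIV_char_0)
  qed
  have column: "\<exists>c. \<forall>z1 z2. g (z1, z2, t, 1) \<noteq> 0 \<longrightarrow> l (z1, z2, t, 1) * g (z1, z2, t, 1) ^ N = bform N c z1 z2"
    if "t \<in> X" for t
    unfolding gz
  proof (rule regular_quotient_is_bform[where u = 0 and v = 1 and n = m])
    show "\<alpha> * t + \<beta> * 1 \<noteq> 0 \<or> \<gamma> * t + \<delta> * 1 \<noteq> 0" using that by (auto simp: X_def gz)
    show "(\<alpha> * t + \<beta> * 1) * 0 + (\<gamma> * t + \<delta> * 1) * 1 \<noteq> 0" using that by (auto simp: X_def gz)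
    show "m \<le> N" by (simp add: N_def)
    show "bform m (\<lambda>i. \<Sum>j\<le>n. b i j * t ^ j * 1 ^ (n - j)) 0 1 \<noteq> 0"
      using that unfolding bihom_fix_right[symmetric] by (simp add: X_def)
    fix z1 z2
    assume nz: "(\<alpha> * t + \<beta> * 1) * z1 + (\<gamma> * t + \<delta> * 1) * z2 \<noteq> 0"
    show "l (z1, z2, t, 1) = bform m (\<lambda>i. \<Sum>j\<le>n. a i j * t ^ j * 1 ^ (n - j)) z1 z2 /
        bform m (\<lambda>i. \<Sum>j\<le>n. b i j * t ^ j * 1 ^ (n - j)) z1 z2"
      if "bform m (\<lambda>i. \<Sum>j\<le>n. b i j * t ^ j * 1 ^ (n - j)) z1 z2 \<noteq> 0"
      using that nz unfolding bihom_fix_right[symmetric] gz[symmetric] by (rule ab[rotated])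
    obtain m' n' a' b' where *: "bihom m' n' b' (z1, z2, t, 1) \<noteq> 0"
      "\<And>P. g P \<noteq> 0 \<Longrightarrow> bihom m' n' b' P \<noteq> 0 \<Longrightarrow> l P = bihom m' n' a' P / bihom m' n' b' P"
      using loc nz unfolding gz[symmetric] by meson
    show "\<exists>n a b. bform n b z1 z2 \<noteq> 0 \<and> (\<forall>x y. (\<alpha> * t + \<beta> * 1) * x + (\<gamma> * t + \<delta> * 1) * y \<noteq> 0 \<longrightarrow>
        bform n b x y \<noteq> 0 \<longrightarrow> l (x, y, t, 1) = bform n a x y / bform n b x y)"
      by (intro exI[of _ m'] exI[of _ "\<lambda>i. \<Sum>j\<le>n'. a' i j * t ^ j * 1 ^ (n' - j)"]
          exI[of _ "\<lambda>i. \<Sum>j\<le>n'. b' i j * t ^ j * 1 ^ (n' - j)"],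
          unfold bihom_fix_right[symmetric] gz[symmetric]) (use * in blast)
  qed
  then obtain C where C: "\<And>t z1 z2. t \<in> X \<Longrightarrow> g (z1, z2, t, 1) \<noteq> 0 \<Longrightarrow>
      l (z1, z2, t, 1) * g (z1, z2, t, 1) ^ N = bform N (C t) z1 z2"
    by metis
  have "\<exists>S k. finite S \<and> S \<subseteq> X \<and> (\<forall>i\<in>{..N}. \<forall>j\<in>{..N}. (\<Sum>t\<in>S. k i t * t ^ j) = (if i = j then 1 else 0))"
  proof (rule dual_evaluations[where f = "\<lambda>j t. t ^ j"])
    fix c assume *: "\<And>t. t \<in> X \<Longrightarrow> (\<Sum>i\<le>N. c i * t ^ i) = 0"
    then have "X \<subseteq> {t. (\<Sum>i\<le>N. c i * t ^ i) = 0}" by auto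
    then have "infinite {t. (\<Sum>i\<le>N. c i * t ^ i) = 0}"
      using \<open>infinite X\<close> by (rule infinite_super)
    then show "\<forall>i\<in>{..N}. c i = 0"
      using polyfun_finite_roots[of c N] by auto
  qed simp
  then obtain S k where S: "finite S" "S \<subseteq> X"
    and "\<forall>i\<in>{..N}. \<forall>j\<in>{..N}. (\<Sum>t\<in>S. k i t * t ^ j) = (if i = j then 1 else 0)"
    by blast
  then have k: "\<And>i j. i \<le> N \<Longrightarrow> j \<le> N \<Longrightarrow> (\<Sum>t\<in>S. k i t * t ^ j) = (if i = j then 1 else 0)"
    by simp
  define h where "h = (\<lambda>i j. \<Sum>t\<in>S. k j t * C t i)"
  \<comment> \<open>the z with \<theta> nonzero are those for which the restriction to fixed z makes sense
    and for which all interpolation points (t, 1) lie in the domain\<close>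
  define \<theta> :: "hcoord \<Rightarrow> complex" where "\<theta> = (\<lambda>P. bihom m n b (fst P, fst (snd P), 0, 1) * bilin \<alpha> \<beta> \<gamma> \<delta> (fst P, fst (snd P), 0, 1) *
      (\<Prod>t\<in>S. bilin \<alpha> \<beta> \<gamma> \<delta> (fst P, fst (snd P), t, 1)))"
  have row: "l P * g P ^ N = bihom N N h P" if "\<theta> P \<noteq> 0" "g P \<noteq> 0" for P
  proof -
    obtain z1 z2 w1 w2 where P: "P = (z1, z2, w1, w2)" by (cases P)
    have nz: "bihom m n b (z1, z2, 0, 1) \<noteq> 0" "g (z1, z2, 0, 1) \<noteq> 0" "\<And>t. t \<in> S \<Longrightarrow> g (z1, z2, t, 1) \<noteq> 0"
      using that(1) S(1) by (auto simp: \<theta>_def P g)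
    have "\<exists>c. \<forall>x y. g (z1, z2, x, y) \<noteq> 0 \<longrightarrow> l (z1, z2, x, y) * g (z1, z2, x, y) ^ N = bform N c x y"
      unfolding gw
    proof (rule regular_quotient_is_bform[where u = 0 and v = 1 and n = n])
      show "(\<alpha> * z1 + \<gamma> * z2) * 0 + (\<beta> * z1 + \<delta> * z2) * 1 \<noteq> 0" using nz(2) unfolding gw .
      then show "\<alpha> * z1 + \<gamma> * z2 \<noteq> 0 \<or> \<beta> * z1 + \<delta> * z2 \<noteq> 0" by auto
      show "n \<le> N" by (simp add: N_def)
      show "bform n (\<lambda>j. \<Sum>i\<le>m. b i j * z1 ^ i * z2 ^ (m - i)) 0 1 \<noteq> 0"
        using nz(1) unfolding bihom_fix_left .
      fix x y
      assume nz: "(\<alpha> * z1 + \<gamma> * z2) * x + (\<beta> * z1 + \<delta> * z2) * y \<noteq> 0"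
      show "l (z1, z2, x, y) = bform n (\<lambda>j. \<Sum>i\<le>m. a i j * z1 ^ i * z2 ^ (m - i)) x y /
          bform n (\<lambda>j. \<Sum>i\<le>m. b i j * z1 ^ i * z2 ^ (m - i)) x y"
        if "bform n (\<lambda>j. \<Sum>i\<le>m. b i j * z1 ^ i * z2 ^ (m - i)) x y \<noteq> 0"
        using that nz unfolding bihom_fix_left[symmetric] gw[symmetric] by (rule ab[rotated])
      obtain m' n' a' b' where *: "bihom m' n' b' (z1, z2, x, y) \<noteq> 0"
        "\<And>P. g P \<noteq> 0 \<Longrightarrow> bihom m' n' b' P \<noteq> 0 \<Longrightarrow> l P = bihom m' n' a' P / bihom m' n' b' P"
        using loc nz unfolding gw[symmetric] by meson
      show "\<exists>n a b. bform n b x y \<noteq> 0 \<and> (\<forall>x y. (\<alpha> * z1 + \<gamma> * z2) * x + (\<beta> * z1 + \<delta> * z2) * y \<noteq> 0 \<longrightarrow>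
          bform n b x y \<noteq> 0 \<longrightarrow> l (z1, z2, x, y) = bform n a x y / bform n b x y)"
        by (intro exI[of _ n'] exI[of _ "\<lambda>j. \<Sum>i\<le>m'. a' i j * z1 ^ i * z2 ^ (m' - i)"]
            exI[of _ "\<lambda>j. \<Sum>i\<le>m'. b' i j * z1 ^ i * z2 ^ (m' - i)"],
            unfold bihom_fix_left[symmetric] gw[symmetric]) (use * in blast)
    qed
    then obtain c where c: "\<And>x y. g (z1, z2, x, y) \<noteq> 0 \<Longrightarrow> l (z1, z2, x, y) * g (z1, z2, x, y) ^ N = bform N c x y"
      by blast
    have ct: "(\<Sum>i\<le>N. c i * t ^ i) = bform N (C t) z1 z2" if "t \<in> S" for t
      using c[OF nz(3)[OF that]] C[of t z1 z2] nz(3)[OF that] that S(2) by (auto simp: bform_def)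
    have "c j = (\<Sum>i\<le>N. h i j * z1 ^ i * z2 ^ (N - i))" if "j \<le> N" for j
    proof -
      have "c j = (\<Sum>i\<le>N. c i * (if j = i then 1 else 0))" using that by (simp add: if_distrib cong: if_cong)
      also have "\<dots> = (\<Sum>i\<le>N. \<Sum>t\<in>S. k j t * (c i * t ^ i))"
      proof (intro sum.cong refl)
        fix i assume "i \<in> {..N}"
        then show "c i * (if j = i then 1 else 0) = (\<Sum>t\<in>S. k j t * (c i * t ^ i))"
        proof -
          have "(\<Sum>t\<in>S. k j t * (c i * t ^ i)) = c i * (\<Sum>t\<in>S. k j t * t ^ i)"
            by (simp add: sum_distrib_left mult_ac)
          then show ?thesis using k[OF that, of i] \<open>i \<in> {..N}\<close> by simp
        qed
      qed
      also have "\<dots> = (\<Sum>t\<in>S. k j t * bform N (C t) z1 z2)"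
        by (subst sum.swap) (simp add: sum_distrib_left[symmetric] ct)
      also have "\<dots> = (\<Sum>i\<le>N. h i j * z1 ^ i * z2 ^ (N - i))"
        unfolding bform_def h_def sum_distrib_left sum_distrib_right by (subst sum.swap) (simp add: mult.assoc)
      finally show ?thesis .
    qed
    then have "bform N c w1 w2 = bihom N N h P"
      unfolding P bihom_fix_left bform_def by (intro sum.cong) auto
    then show ?thesis using c[of w1 w2] that(2) by (simp add: P)
  qed
  have "l P1 = bihom N N h P1 / g P1 ^ N" if P1: "P1 \<in> nonvanishing g" for P1
  proof -
    have gP1: "g P1 \<noteq> 0" using P1 by (simp add: nonvanishing_def)
    obtain m1 n1 a1 b1 where b1: "bihom m1 n1 b1 P1 \<noteq> 0"
      and ab1: "\<And>P. g P \<noteq> 0 \<Longrightarrow> bihom m1 n1 b1 P \<noteq> 0 \<Longrightarrow> l P = bihom m1 n1 a1 P / bihom m1 n1 b1 P"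
      using loc[OF gP1] by blast
    \<comment> \<open>the identity to be proved, multiplied by the denominators\<close>
    define f where "f = (\<lambda>P. bihom m1 n1 a1 P * bilin \<alpha> \<beta> \<gamma> \<delta> P ^ N - bihom N N h P * bihom m1 n1 b1 P)"
    have lf: "linepoly f" unfolding f_def by (intro linepoly_diff linepoly_mult linepoly_power linepoly_bihom linepoly_bilin)
    have l\<theta>: "linepoly \<theta>"
      unfolding \<theta>_def bilin_eq_bihom
      by (intro linepoly_mult linepoly_prod linepoly_bihom_subst linepoly_coords linepoly_const)
    have zero: "(f P * bihom m1 n1 b1 P) * (\<theta> P * g P) = 0" for P
    proof (cases "bihom m1 n1 b1 P = 0 \<or> \<theta> P = 0 \<or> g P = 0")
      case False
      then have "l P = bihom m1 n1 a1 P / bihom m1 n1 b1 P" "l P * g P ^ N = bihom N N h P"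
        using ab1[of P] row[of P] by simp_all
      then have "f P = 0" using False by (simp add: f_def g field_simps)
      then show ?thesis by simp
    qed auto
    have "f P * bihom m1 n1 b1 P = 0" for P
    proof (rule linepoly_cancel[OF _ _ zero])
      show "linepoly (\<lambda>P. f P * bihom m1 n1 b1 P)" "linepoly (\<lambda>P. \<theta> P * g P)"
        using lf l\<theta> by (auto simp: g)
      have "g (0, 1, t, 1) \<noteq> 0" if "t \<in> S" for t using that S(2) by (auto simp: X_def)
      then show "\<theta> (0, 1, 0, 1) * g (0, 1, 0, 1) \<noteq> 0"
        using b0 g_nz S(1) by (simp add: \<theta>_def g)
    qed
    from linepoly_cancel[OF lf linepoly_bihom this b1] have "f P1 = 0" .
    then have "bihom m1 n1 a1 P1 * g P1 ^ N = bihom N N h P1 * bihom m1 n1 b1 P1"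
      by (simp add: f_def g)
    then show ?thesis using ab1[OF gP1 b1] b1 gP1 by (simp add: frac_eq_eq)
  qed
  then show ?thesis by blast
qed

section \<open>Polynomials with analytic coefficients\<close>

text \<open>Polynomials in the two functions a, b on X whose coefficients are analytic functions of q.\<close>

definition poly_in :: "plane \<Rightarrow> 'x set \<Rightarrow> ('x \<Rightarrow> complex) \<Rightarrow> ('x \<Rightarrow> complex) \<Rightarrow> (plane \<Rightarrow> 'x \<Rightarrow> complex) \<Rightarrow> bool" where
  "poly_in p X a b \<phi> \<longleftrightarrow> (\<exists>n c. (\<forall>i j. analytic_at2 (c i j) p) \<and>
     (\<forall>q. \<forall>P\<in>X. \<phi> q P = (\<Sum>i\<le>n. \<Sum>j\<le>n. c i j q * (a P ^ i * b P ^ j))))"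

lemma poly_inE:
  assumes "poly_in p X a b \<phi>"
  obtains n c where "\<And>i j. analytic_at2 (c i j) p"
    "\<And>q P. P \<in> X \<Longrightarrow> \<phi> q P = (\<Sum>i\<le>n. \<Sum>j\<le>n. c i j q * (a P ^ i * b P ^ j))"
  using assms unfolding poly_in_def by blast

lemma poly_inI:
  "(\<And>i j. analytic_at2 (c i j) p) \<Longrightarrow>
   (\<And>q P. P \<in> X \<Longrightarrow> \<phi> q P = (\<Sum>i\<le>n. \<Sum>j\<le>n. c i j q * (a P ^ i * b P ^ j))) \<Longrightarrow> poly_in p X a b \<phi>"
  unfolding poly_in_def by blast

lemma poly_in_cong:
  assumes "poly_in p X a b \<phi>" "\<And>q P. P \<in> X \<Longrightarrow> \<psi> q P = \<phi> q P"
  shows "poly_in p X a b \<psi>"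
proof -
  obtain n c where c: "\<And>i j. analytic_at2 (c i j) p"
    "\<And>q P. P \<in> X \<Longrightarrow> \<phi> q P = (\<Sum>i\<le>n. \<Sum>j\<le>n. c i j q * (a P ^ i * b P ^ j))"
    using assms(1) by (rule poly_inE) blast
  show ?thesis
    by (rule poly_inI[where c = c and n = n]) (simp_all only: c assms(2))
qed

lemma poly_in_monomial: "poly_in p X a b (\<lambda>q P. a P ^ k * b P ^ l)"
proof (rule poly_inI)
  let ?c = "\<lambda>i j q. if i = k \<and> j = l then 1 else 0"
  show "analytic_at2 (?c i j) p" for i j by (cases "i = k \<and> j = l") auto
  fix q :: plane and P
  show "a P ^ k * b P ^ l = (\<Sum>i\<le>max k l. \<Sum>j\<le>max k l. ?c i j q * (a P ^ i * b P ^ j))"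
    by (rule double_sum_indicator[symmetric])
qed

lemma poly_in_add:
  assumes "poly_in p X a b \<phi>" "poly_in p X a b \<psi>"
  shows "poly_in p X a b (\<lambda>q P. \<phi> q P + \<psi> q P)"
proof -
  obtain n c where c: "\<And>i j. analytic_at2 (c i j) p"
    "\<And>q P. P \<in> X \<Longrightarrow> \<phi> q P = (\<Sum>i\<le>n. \<Sum>j\<le>n. c i j q * (a P ^ i * b P ^ j))"
    using assms(1) by (rule poly_inE) blast
  obtain m d where d: "\<And>i j. analytic_at2 (d i j) p"
    "\<And>q P. P \<in> X \<Longrightarrow> \<psi> q P = (\<Sum>i\<le>m. \<Sum>j\<le>m. d i j q * (a P ^ i * b P ^ j))"
    using assms(2) by (rule poly_inE) blast
  show ?thesis
  proof (rule poly_inI)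
    show "analytic_at2 ((\<lambda>i j q. (if i \<le> n \<and> j \<le> n then c i j q else 0) + (if i \<le> m \<and> j \<le> m then d i j q else 0)) i j) p" for i j
      using c(1) d(1) by (intro analytic_at2_add analytic_at2_if)
    fix q P assume P: "P \<in> X"
    show "\<phi> q P + \<psi> q P = (\<Sum>i\<le>max n m. \<Sum>j\<le>max n m.
        ((if i \<le> n \<and> j \<le> n then c i j q else 0) + (if i \<le> m \<and> j \<le> m then d i j q else 0)) * (a P ^ i * b P ^ j))"
      unfolding distrib_right sum.distrib c(2)[OF P] d(2)[OF P]
      by (subst (1 2) double_sum_pad) auto
  qed
qed

lemma poly_in_scale:
  assumes "poly_in p X a b \<phi>" "analytic_at2 d p"
  shows "poly_in p X a b (\<lambda>q P. d q * \<phi> q P)"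
proof -
  obtain n c where c: "\<And>i j. analytic_at2 (c i j) p"
    "\<And>q P. P \<in> X \<Longrightarrow> \<phi> q P = (\<Sum>i\<le>n. \<Sum>j\<le>n. c i j q * (a P ^ i * b P ^ j))"
    using assms(1) by (rule poly_inE) blast
  show ?thesis
    by (rule poly_inI[where c = "\<lambda>i j q. d q * c i j q" and n = n])
      (use c assms(2) in \<open>auto simp: sum_distrib_left mult.assoc\<close>)
qed

lemma poly_in_const: "analytic_at2 d p \<Longrightarrow> poly_in p X a b (\<lambda>q P. d q)"
  using poly_in_scale[OF poly_in_monomial[of p X a b 0 0]] by simp

lemma poly_in_sum:
  "(\<And>i. i \<in> I \<Longrightarrow> poly_in p X a b (\<phi> i)) \<Longrightarrow> poly_in p X a b (\<lambda>q P. \<Sum>i\<in>I. \<phi> i q P)"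
  by (induction I rule: infinite_finite_induct) (auto intro: poly_in_add poly_in_const)

lemma poly_in_mult_gen:
  assumes "poly_in p X a b \<phi>"
  shows "poly_in p X a b (\<lambda>q P. a P * \<phi> q P)" "poly_in p X a b (\<lambda>q P. b P * \<phi> q P)"
proof -
  obtain n c where c: "\<And>i j. analytic_at2 (c i j) p"
    "\<And>q P. P \<in> X \<Longrightarrow> \<phi> q P = (\<Sum>i\<le>n. \<Sum>j\<le>n. c i j q * (a P ^ i * b P ^ j))"
    using assms(1) by (rule poly_inE) blast
  have "poly_in p X a b (\<lambda>q P. \<Sum>i\<le>n. \<Sum>j\<le>n. c i j q * (a P ^ Suc i * b P ^ j))"
    by (intro poly_in_sum poly_in_scale poly_in_monomial c(1))
  then show "poly_in p X a b (\<lambda>q P. a P * \<phi> q P)"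
    by (rule poly_in_cong) (simp add: c(2) sum_distrib_left mult_ac)
  have "poly_in p X a b (\<lambda>q P. \<Sum>i\<le>n. \<Sum>j\<le>n. c i j q * (a P ^ i * b P ^ Suc j))"
    by (intro poly_in_sum poly_in_scale poly_in_monomial c(1))
  then show "poly_in p X a b (\<lambda>q P. b P * \<phi> q P)"
    by (rule poly_in_cong) (simp add: c(2) sum_distrib_left mult_ac)
qed

lemma poly_in_mult_affine:
  assumes "poly_in p X a b \<phi>" "\<And>P. P \<in> X \<Longrightarrow> f P = k0 + k1 * a P + k2 * b P"
  shows "poly_in p X a b (\<lambda>q P. f P * \<phi> q P)"
proof -
  have "poly_in p X a b (\<lambda>q P. k0 * \<phi> q P + k1 * (a P * \<phi> q P) + k2 * (b P * \<phi> q P))"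
    by (intro poly_in_add poly_in_scale poly_in_mult_gen assms(1) analytic_at2_const)
  then show ?thesis by (rule poly_in_cong) (simp add: assms(2) algebra_simps)
qed

text \<open>An affine change of the two variables preserves the class of polynomials.\<close>

lemma poly_in_subst:
  assumes "poly_in p X a' b' \<phi>"
    and a': "\<And>P. P \<in> X \<Longrightarrow> a' P = k0 + k1 * a P + k2 * b P"
    and b': "\<And>P. P \<in> X \<Longrightarrow> b' P = l0 + l1 * a P + l2 * b P"
  shows "poly_in p X a b \<phi>"
proof -
  obtain n c where c: "\<And>i j. analytic_at2 (c i j) p"
    "\<And>q P. P \<in> X \<Longrightarrow> \<phi> q P = (\<Sum>i\<le>n. \<Sum>j\<le>n. c i j q * (a' P ^ i * b' P ^ j))"
    using assms(1) by (rule poly_inE) blast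
  have mono: "poly_in p X a b (\<lambda>q P. a' P ^ i * b' P ^ j)" for i j
  proof (induction i)
    case 0
    show ?case
    proof (induction j)
      case 0
      show ?case using poly_in_const[OF analytic_at2_const, of p X a b 1] by simp
    next
      case (Suc j)
      from poly_in_mult_affine[OF this b'] show ?case by simp
    qed
  next
    case (Suc i)
    from poly_in_mult_affine[OF this a'] show ?case by (simp add: mult.assoc)
  qed
  have "poly_in p X a b (\<lambda>q P. \<Sum>i\<le>n. \<Sum>j\<le>n. c i j q * (a' P ^ i * b' P ^ j))"
    by (intro poly_in_sum poly_in_scale mono c(1))
  then show ?thesis by (rule poly_in_cong) (simp add: c(2))
qed

section \<open>The quadric\<close>

locale gluing_data =
  fixes B \<alpha> \<beta> \<gamma> \<delta> \<alpha>\<^sub>1 \<beta>\<^sub>1 \<gamma>\<^sub>1 \<delta>\<^sub>1 \<alpha>\<^sub>2 \<beta>\<^sub>2 \<gamma>\<^sub>2 \<delta>\<^sub>2 c\<^sub>1 c\<^sub>2 :: complex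
    and g g\<^sub>1 g\<^sub>2 :: "hcoord \<Rightarrow> complex"
  assumes g: "g = bilin \<alpha> \<beta> \<gamma> \<delta>"
    and g1: "g\<^sub>1 = bilin \<alpha>\<^sub>1 \<beta>\<^sub>1 \<gamma>\<^sub>1 \<delta>\<^sub>1"
    and g2: "g\<^sub>2 = bilin \<alpha>\<^sub>2 \<beta>\<^sub>2 \<gamma>\<^sub>2 \<delta>\<^sub>2"
    and B: "B \<noteq> 0"
    and glue: "\<forall>t1 t2. g (1, 0, t1, t2) - B * g (t1, t2, 0, 1) = 0"
    and g_nz: "g (0, 1, 0, 1) \<noteq> 0"
    and glue1: "\<forall>t1 t2. g\<^sub>1 (1, 0, t1, t2) - B * g\<^sub>1 (t1, t2, 0, 1) - c\<^sub>1 * g (1, 0, t1, t2) = 0"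
    and glue2: "\<forall>t1 t2. g\<^sub>2 (1, 0, t1, t2) - B * g\<^sub>2 (t1, t2, 0, 1) - c\<^sub>2 * g (1, 0, t1, t2) = 0"
    and indep: "\<forall>a b c :: complex. (\<forall>P. a * g P + b * g\<^sub>1 P + c * g\<^sub>2 P = 0) \<longrightarrow> a = 0 \<and> b = 0 \<and> c = 0"
begin

lemma \<delta>0: "\<delta> \<noteq> 0" using g_nz by (simp add: g bilin_def)

text \<open>The gluing condition fixes g up to two parameters:
g = \<delta> (B^2 z1 w1 + B z1 w2 + z2 w2) + \<gamma> z2 w1.\<close>

lemma \<beta>: "\<beta> = B * \<delta>" and \<alpha>: "\<alpha> = B ^ 2 * \<delta>"
proof -
  show "\<beta> = B * \<delta>" using glue[rule_format, of 0 1] by (simp add: g bilin_def)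
  then show "\<alpha> = B ^ 2 * \<delta>" using glue[rule_format, of 1 0] by (simp add: g bilin_def power2_eq_square)
qed

text \<open>With Z = B z1 / z2 + 1 and W = w2 / (B w1) + 1 one has g = \<delta> B z2 w1 (Z W - \<kappa>), where \<kappa> is defined below.  The three
functions below are u = 1 / (Z W - \<kappa>), v = u (Z - W) and s = u (Z + W).  The involution (Z, W) to
(- W, - Z) fixes u and v and changes the sign of s.  This is the symmetry behind the whole
construction: G_1 and G_2 turn out to be affine functions of u and v, so they are invariant under it.\<close>

definition uform :: "hcoord \<Rightarrow> complex" where "uform = bilin 0 0 (\<delta> * B) 0"
definition vform :: "hcoord \<Rightarrow> complex" where "vform = bilin (\<delta> * B ^ 2) 0 0 (- \<delta>)"
definition sform :: "hcoord \<Rightarrow> complex" where "sform = bilin (\<delta> * B ^ 2) 0 (2 * \<delta> * B) \<delta>"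

definition u :: "hcoord \<Rightarrow> complex" where "u P = uform P / g P"
definition v :: "hcoord \<Rightarrow> complex" where "v P = vform P / g P"
definition s :: "hcoord \<Rightarrow> complex" where "s P = sform P / g P"

abbreviation U :: "hcoord set" where "U \<equiv> nonvanishing g"

definition \<kappa> :: complex where "\<kappa> = 1 - \<gamma> / (\<delta> * B)"

lemma U_iff: "P \<in> U \<longleftrightarrow> g P \<noteq> 0" by (simp add: nonvanishing_def)

text \<open>The equation of the complement of the curve as an affine quadric, a double cover of the
(u, v)-plane.\<close>

lemma s_square: "P \<in> U \<Longrightarrow> s P ^ 2 = v P ^ 2 + 4 * u P + 4 * \<kappa> * u P ^ 2"
proof -
  assume "P \<in> U"
  then have "g P \<noteq> 0" by (simp add: U_iff)
  moreover have "sform P ^ 2 = vform P ^ 2 + 4 * uform P * g P + 4 * \<kappa> * uform P ^ 2"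
    using \<delta>0 B by (cases P) (simp add: sform_def vform_def uform_def g bilin_def \<kappa>_def \<alpha> \<beta> field_simps power2_eq_square)
  ultimately show ?thesis
    by (simp add: u_def v_def s_def field_simps power2_eq_square)
qed

text \<open>Together with 1, the functions u, v, s span the four-dimensional space of forms of bidegree (1, 1) divided by g.\<close>

lemma monomials_span:
  assumes "(z1, z2, w1, w2) \<in> U"
  shows "z1 * w1 / g (z1, z2, w1, w2) = (v (z1, z2, w1, w2) + s (z1, z2, w1, w2) - 2 * u (z1, z2, w1, w2)) / (2 * \<delta> * B ^ 2)"
    "z1 * w2 / g (z1, z2, w1, w2) = (1 - s (z1, z2, w1, w2) + (1 + \<kappa>) * u (z1, z2, w1, w2)) / (\<delta> * B)"
    "z2 * w1 / g (z1, z2, w1, w2) = u (z1, z2, w1, w2) / (\<delta> * B)"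
    "z2 * w2 / g (z1, z2, w1, w2) = (s (z1, z2, w1, w2) - v (z1, z2, w1, w2) - 2 * u (z1, z2, w1, w2)) / (2 * \<delta>)"
proof -
  define G where "G = g (z1, z2, w1, w2)"
  have G: "G \<noteq> 0" using assms by (simp add: U_iff G_def)
  have Geq: "G = B ^ 2 * \<delta> * z1 * w1 + B * \<delta> * z1 * w2 + \<gamma> * z2 * w1 + \<delta> * z2 * w2"
    by (simp add: G_def g bilin_def \<alpha> \<beta>)
  have uvs: "u (z1, z2, w1, w2) = \<delta> * B * z2 * w1 / G"
    "v (z1, z2, w1, w2) = (\<delta> * B ^ 2 * z1 * w1 - \<delta> * z2 * w2) / G"
    "s (z1, z2, w1, w2) = (\<delta> * B ^ 2 * z1 * w1 + 2 * \<delta> * B * z2 * w1 + \<delta> * z2 * w2) / G"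
    by (simp_all add: u_def v_def s_def uform_def vform_def sform_def bilin_def G_def)
  have "1 - s (z1, z2, w1, w2) + (1 + \<kappa>) * u (z1, z2, w1, w2) = (G - (\<delta> * B ^ 2 * z1 * w1 + 2 * \<delta> * B * z2 * w1 + \<delta> * z2 * w2)
      + (1 + \<kappa>) * (\<delta> * B * z2 * w1)) / G"
    using G unfolding uvs by (simp add: field_simps)
  also have "\<dots> = (\<delta> * B) * (z1 * w2) / G"
    unfolding Geq \<kappa>_def using \<delta>0 B by (simp add: field_simps)
  finally have 2: "1 - s (z1, z2, w1, w2) + (1 + \<kappa>) * u (z1, z2, w1, w2) = (\<delta> * B) * (z1 * w2) / G" .
  show "z1 * w1 / g (z1, z2, w1, w2) = (v (z1, z2, w1, w2) + s (z1, z2, w1, w2) - 2 * u (z1, z2, w1, w2)) / (2 * \<delta> * B ^ 2)"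
    "z2 * w1 / g (z1, z2, w1, w2) = u (z1, z2, w1, w2) / (\<delta> * B)"
    "z2 * w2 / g (z1, z2, w1, w2) = (s (z1, z2, w1, w2) - v (z1, z2, w1, w2) - 2 * u (z1, z2, w1, w2)) / (2 * \<delta>)"
    using G \<delta>0 B unfolding uvs G_def[symmetric] by (simp_all add: field_simps)
  show "z1 * w2 / g (z1, z2, w1, w2) = (1 - s (z1, z2, w1, w2) + (1 + \<kappa>) * u (z1, z2, w1, w2)) / (\<delta> * B)"
    unfolding 2 using \<delta>0 B by (simp add: G_def)
qed

text \<open>Outside u = 0, a point is recovered from Z = (v + s) / (2 u) and W = (s - v) / (2 u); the equation of the
quadric says that Z W = 1 / u + \<kappa>.\<close>

lemma point_exists:
  assumes "x \<noteq> 0" "r ^ 2 = y ^ 2 + 4 * x + 4 * \<kappa> * x ^ 2"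
  shows "\<exists>P\<in>U. u P = x \<and> v P = y \<and> s P = r"
proof -
  define Z W where "Z = (y + r) / (2 * x)" and "W = (r - y) / (2 * x)"
  define P where "P = ((Z - 1) / B, 1 :: complex, 1 :: complex, B * (W - 1))"
  have "Z * W = (r ^ 2 - y ^ 2) / (4 * x ^ 2)"
    using assms(1) by (simp add: Z_def W_def field_simps power2_eq_square)
  also have "\<dots> = 1 / x + \<kappa>"
    unfolding assms(2) using assms(1) by (simp add: field_simps power2_eq_square)
  finally have ZW: "Z * W = 1 / x + \<kappa>" .
  have "g P = \<delta> * B * (Z * W - \<kappa>)"
    using B \<delta>0 by (simp add: P_def g bilin_def \<alpha> \<beta> \<kappa>_def field_simps power2_eq_square)
  then have gP: "g P = \<delta> * B / x" by (simp add: ZW)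
  have Zx: "x * (Z - W) = y" "x * (Z + W) = r"
    using assms(1) by (simp_all add: Z_def W_def field_simps)
  have "u P = x" using B \<delta>0 assms(1) unfolding u_def gP by (simp add: uform_def bilin_def P_def)
  moreover have "v P = x * (Z - W)"
    using B \<delta>0 assms(1) unfolding v_def gP by (simp add: vform_def bilin_def P_def field_simps power2_eq_square)
  moreover have "s P = x * (Z + W)"
    using B \<delta>0 assms(1) unfolding s_def gP by (simp add: sform_def bilin_def P_def field_simps power2_eq_square)
  moreover have "P \<in> U" using gP B \<delta>0 assms(1) by (simp add: U_iff)
  ultimately show ?thesis using Zx by auto
qed

text \<open>The inhomogeneous gluing condition for a form f of bidegree (1, 1) leaves no component along s.  The coefficient of v is
the constant k of the gluing condition.\<close>

lemma pencil:
  assumes f: "f = bilin a b c d"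
    and gl: "\<forall>t1 t2. f (1, 0, t1, t2) - B * f (t1, t2, 0, 1) - k * g (1, 0, t1, t2) = 0"
  shows "f P = (d + k * \<delta>) / \<delta> * g P + (c * \<delta> - \<gamma> * (d + k * \<delta>)) / (\<delta> ^ 2 * B) * uform P + k * vform P"
proof -
  have b: "b = B * d + k * (B * \<delta>)" using gl[rule_format, of 0 1] by (simp add: f g bilin_def \<beta> algebra_simps)
  then have a: "a = B ^ 2 * d + 2 * k * (B ^ 2 * \<delta>)"
    using gl[rule_format, of 1 0] by (simp add: f g bilin_def \<alpha> algebra_simps power2_eq_square)
  show ?thesis
    using \<delta>0 B by (cases P) (simp add: f g bilin_def uform_def vform_def \<alpha> \<beta> a b field_simps power2_eq_square)
qed

definition e\<^sub>1 :: complex where "e\<^sub>1 = (\<delta>\<^sub>1 + c\<^sub>1 * \<delta>) / \<delta>"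
definition e\<^sub>2 :: complex where "e\<^sub>2 = (\<delta>\<^sub>2 + c\<^sub>2 * \<delta>) / \<delta>"
definition m\<^sub>1 :: complex where "m\<^sub>1 = (\<gamma>\<^sub>1 * \<delta> - \<gamma> * (\<delta>\<^sub>1 + c\<^sub>1 * \<delta>)) / (\<delta> ^ 2 * B)"
definition m\<^sub>2 :: complex where "m\<^sub>2 = (\<gamma>\<^sub>2 * \<delta> - \<gamma> * (\<delta>\<^sub>2 + c\<^sub>2 * \<delta>)) / (\<delta> ^ 2 * B)"
definition G\<^sub>1 :: "hcoord \<Rightarrow> complex" where "G\<^sub>1 P = g\<^sub>1 P / g P"
definition G\<^sub>2 :: "hcoord \<Rightarrow> complex" where "G\<^sub>2 P = g\<^sub>2 P / g P"
definition \<Delta> :: complex where "\<Delta> = m\<^sub>1 * c\<^sub>2 - m\<^sub>2 * c\<^sub>1"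

lemma g1_eq: "g\<^sub>1 P = e\<^sub>1 * g P + m\<^sub>1 * uform P + c\<^sub>1 * vform P"
  and g2_eq: "g\<^sub>2 P = e\<^sub>2 * g P + m\<^sub>2 * uform P + c\<^sub>2 * vform P"
  using pencil[OF g1 glue1] pencil[OF g2 glue2] by (simp_all add: e\<^sub>1_def e\<^sub>2_def m\<^sub>1_def m\<^sub>2_def)

lemma G_eq:
  assumes "P \<in> U"
  shows "G\<^sub>1 P = e\<^sub>1 + m\<^sub>1 * u P + c\<^sub>1 * v P" "G\<^sub>2 P = e\<^sub>2 + m\<^sub>2 * u P + c\<^sub>2 * v P"
  using assms by (simp_all add: U_iff G\<^sub>1_def G\<^sub>2_def g1_eq g2_eq u_def v_def field_simps)

text \<open>If the linear parts of G_1 and G_2 in (u, v) were dependent, then g, g_1, g_2 would be.\<close>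

lemma \<Delta>0: "\<Delta> \<noteq> 0"
proof
  assume "\<Delta> = 0"
  have key: "b = 0 \<and> c = 0" if "b * m\<^sub>1 + c * m\<^sub>2 = 0" "b * c\<^sub>1 + c * c\<^sub>2 = 0" for b c
  proof -
    have "- (b * e\<^sub>1 + c * e\<^sub>2) * g P + b * g\<^sub>1 P + c * g\<^sub>2 P
        = (b * m\<^sub>1 + c * m\<^sub>2) * uform P + (b * c\<^sub>1 + c * c\<^sub>2) * vform P" for P
      by (simp add: g1_eq g2_eq algebra_simps)
    then have "\<forall>P. - (b * e\<^sub>1 + c * e\<^sub>2) * g P + b * g\<^sub>1 P + c * g\<^sub>2 P = 0" using that by simp
    then show ?thesis using indep by blast
  qed
  from \<open>\<Delta> = 0\<close> have "c\<^sub>2 * m\<^sub>1 + (- c\<^sub>1) * m\<^sub>2 = 0" by (simp add: \<Delta>_def algebra_simps)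
  from key[OF this] have c: "c\<^sub>1 = 0" "c\<^sub>2 = 0" by simp_all
  from key[of m\<^sub>2 "- m\<^sub>1"] c have "m\<^sub>1 = 0" by simp
  with key[of 1 0] c show False by simp
qed

text \<open>Cramer's rule.\<close>

lemma uv_eq:
  assumes "P \<in> U"
  shows "u P = (c\<^sub>1 * e\<^sub>2 - c\<^sub>2 * e\<^sub>1) / \<Delta> + c\<^sub>2 / \<Delta> * G\<^sub>1 P + (- c\<^sub>1 / \<Delta>) * G\<^sub>2 P"
    "v P = (m\<^sub>2 * e\<^sub>1 - m\<^sub>1 * e\<^sub>2) / \<Delta> + (- m\<^sub>2 / \<Delta>) * G\<^sub>1 P + m\<^sub>1 / \<Delta> * G\<^sub>2 P"
  using \<Delta>0 unfolding G_eq[OF assms] by (simp_all add: field_simps) (simp_all add: \<Delta>_def algebra_simps)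

lemma poly_in_change: "poly_in p U G\<^sub>1 G\<^sub>2 \<phi> \<longleftrightarrow> poly_in p U u v \<phi>"
proof
  assume "poly_in p U G\<^sub>1 G\<^sub>2 \<phi>"
  then show "poly_in p U u v \<phi>" by (rule poly_in_subst) (erule G_eq)+
next
  assume "poly_in p U u v \<phi>"
  then show "poly_in p U G\<^sub>1 G\<^sub>2 \<phi>" by (rule poly_in_subst) (erule uv_eq)+
qed

text \<open>The excluded points (x, y) form a curve; each line parallel to one of the axes either meets it in
finitely many points or is contained in it, the latter only for x = 0.  By continuity the polynomial vanishes everywhere.\<close>

lemma polynomial_vanishing:
  assumes "\<And>x y. x \<noteq> 0 \<Longrightarrow> y ^ 2 + 4 * x + 4 * \<kappa> * x ^ 2 \<noteq> 0 \<Longrightarrow>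
      (\<Sum>i\<le>n. \<Sum>j\<le>n. c i j * (e\<^sub>1 + m\<^sub>1 * x + c\<^sub>1 * y) ^ i * (e\<^sub>2 + m\<^sub>2 * x + c\<^sub>2 * y) ^ j) = 0"
    and ij: "i \<le> n" "j \<le> n"
  shows "c i j = 0"
proof -
  define F where "F = (\<lambda>x y. \<Sum>i\<le>n. \<Sum>j\<le>n. c i j * (e\<^sub>1 + m\<^sub>1 * x + c\<^sub>1 * y) ^ i * (e\<^sub>2 + m\<^sub>2 * x + c\<^sub>2 * y) ^ j)"
  have F1: "F x y = 0" if "x \<noteq> 0" for x y
  proof (rule zero_off_finite[where f = "F x"])
    define k where "k = - (4 * x + 4 * \<kappa> * x ^ 2)"
    show "continuous_on UNIV (F x)" unfolding F_def by (intro continuous_intros)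
    show "finite {csqrt k, - csqrt k}" by simp
    fix y assume "y \<notin> {csqrt k, - csqrt k}"
    then have "y ^ 2 \<noteq> k" using power2_eq_iff[of y "csqrt k"] by auto
    then show "F x y = 0" using that assms(1)[of x y] by (simp add: F_def k_def add_eq_0_iff2 algebra_simps)
  qed
  have F0: "F x y = 0" for x y
  proof (rule zero_off_finite[where f = "\<lambda>x. F x y"])
    show "continuous_on UNIV (\<lambda>x. F x y)" unfolding F_def by (intro continuous_intros)
    show "finite {0 :: complex}" by simp
  qed (use F1 in auto)
  have "(\<Sum>i\<le>n. \<Sum>j\<le>n. c i j * X ^ i * Y ^ j) = 0" for X Y
  proof -
    define x y where "x = (c\<^sub>2 * (X - e\<^sub>1) - c\<^sub>1 * (Y - e\<^sub>2)) / \<Delta>" and "y = (m\<^sub>1 * (Y - e\<^sub>2) - m\<^sub>2 * (X - e\<^sub>1)) / \<Delta>"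
    have "e\<^sub>1 + m\<^sub>1 * x + c\<^sub>1 * y = X" "e\<^sub>2 + m\<^sub>2 * x + c\<^sub>2 * y = Y"
      using \<Delta>0 by (simp_all add: x_def y_def field_simps) (simp_all add: \<Delta>_def algebra_simps)
    then show ?thesis using F0[of x y] by (simp add: F_def)
  qed
  from bivariate_coeffs_zero[OF this ij] show ?thesis .
qed

text \<open>The points of X only have to cover the (u, v)-plane outside a curve, with a nonzero weight f.
The weights that occur are s on the points away from the branch curve, and u.\<close>

lemma eventually_polynomial_coeffs_zero:
  assumes X: "X \<subseteq> U"
    and rich: "\<And>x y. x \<noteq> 0 \<Longrightarrow> y ^ 2 + 4 * x + 4 * \<kappa> * x ^ 2 \<noteq> 0 \<Longrightarrow> \<exists>P\<in>X. u P = x \<and> v P = y \<and> f P \<noteq> 0"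
    and ev: "\<And>P. P \<in> X \<Longrightarrow> eventually (\<lambda>q. f P * (\<Sum>i\<le>n. \<Sum>j\<le>n. b i j q * (G\<^sub>1 P ^ i * G\<^sub>2 P ^ j)) = 0) F"
  shows "eventually (\<lambda>q. \<forall>i\<le>n. \<forall>j\<le>n. b i j q = 0) F"
proof -
  let ?f = "\<lambda>ij P. f P * (G\<^sub>1 P ^ fst ij * G\<^sub>2 P ^ snd ij)"
  have flat: "(\<Sum>ij\<in>{..n}\<times>{..n}. c (fst ij) (snd ij) * ?f ij P) = f P * (\<Sum>i\<le>n. \<Sum>j\<le>n. c i j * (G\<^sub>1 P ^ i * G\<^sub>2 P ^ j))" for c P
    by (simp add: sum.cartesian_product case_prod_unfold sum_distrib_left mult_ac)
  have "eventually (\<lambda>q. \<forall>ij\<in>{..n}\<times>{..n}. b (fst ij) (snd ij) q = 0) F"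
  proof (rule eventually_coefficients_zero[where f = ?f and X = X])
    show "eventually (\<lambda>q. (\<Sum>ij\<in>{..n}\<times>{..n}. b (fst ij) (snd ij) q * ?f ij P) = 0) F" if "P \<in> X" for P
      using ev[OF that] unfolding flat[of "\<lambda>i j. b i j _"] .
    fix c assume c: "\<And>P. P \<in> X \<Longrightarrow> (\<Sum>ij\<in>{..n}\<times>{..n}. c ij * ?f ij P) = 0"
    have "c (i, j) = 0" if ij: "i \<le> n" "j \<le> n" for i j
    proof (rule polynomial_vanishing[where c = "\<lambda>i j. c (i, j)", OF _ ij])
      fix x y :: complex
      assume "x \<noteq> 0" "y ^ 2 + 4 * x + 4 * \<kappa> * x ^ 2 \<noteq> 0"
      from rich[OF this] obtain P where P: "P \<in> X" "u P = x" "v P = y" "f P \<noteq> 0" by blast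
      then have "P \<in> U" using X by blast
      note G = G_eq[OF this, unfolded P(2,3)]
      from c[OF P(1)] flat[of "\<lambda>i j. c (i, j)" P]
      have "(\<Sum>i\<le>n. \<Sum>j\<le>n. c (i, j) * (G\<^sub>1 P ^ i * G\<^sub>2 P ^ j)) = 0" using P(4) by simp
      then show "(\<Sum>i\<le>n. \<Sum>j\<le>n. c (i, j) * (e\<^sub>1 + m\<^sub>1 * x + c\<^sub>1 * y) ^ i * (e\<^sub>2 + m\<^sub>2 * x + c\<^sub>2 * y) ^ j) = 0"
        unfolding G by (simp only: mult.assoc)
    qed
    then show "\<forall>ij\<in>{..n}\<times>{..n}. c ij = 0" by auto
  qed simp
  then show ?thesis by (rule eventually_mono) auto
qed

text \<open>Points at which both values of s over a given (u, v) are available.\<close>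

definition paired :: "hcoord set" where
  "paired = {P \<in> U. \<exists>P'\<in>U. u P' = u P \<and> v P' = v P \<and> s P' = - s P}"

lemma paired_exists:
  assumes "x \<noteq> 0" "y ^ 2 + 4 * x + 4 * \<kappa> * x ^ 2 \<noteq> 0"
  shows "\<exists>P\<in>paired. u P = x \<and> v P = y \<and> s P \<noteq> 0"
proof -
  define r where "r = csqrt (y ^ 2 + 4 * x + 4 * \<kappa> * x ^ 2)"
  have r: "r ^ 2 = y ^ 2 + 4 * x + 4 * \<kappa> * x ^ 2" "(- r) ^ 2 = y ^ 2 + 4 * x + 4 * \<kappa> * x ^ 2" "r \<noteq> 0"
    using assms(2) by (simp_all add: r_def)
  obtain P where P: "P \<in> U" "u P = x" "v P = y" "s P = r" using point_exists[OF assms(1) r(1)] by blast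
  obtain P' where P': "P' \<in> U" "u P' = x" "v P' = y" "s P' = - r" using point_exists[OF assms(1) r(2)] by blast
  have "P \<in> paired" unfolding paired_def using P P' by auto
  then show ?thesis using P r(3) by auto
qed

section \<open>Rational functions with poles along the curve\<close>

text \<open>Since s is quadratic over the polynomials in u and v, the regular functions on the quadric are A + s C.\<close>

definition quadric_poly :: "plane \<Rightarrow> (plane \<Rightarrow> hcoord \<Rightarrow> complex) \<Rightarrow> bool" where
  "quadric_poly p \<phi> \<longleftrightarrow> (\<exists>A C. poly_in p U u v A \<and> poly_in p U u v C \<and>
     (\<forall>q. \<forall>P\<in>U. \<phi> q P = A q P + s P * C q P))"

lemma quadric_polyI:
  "poly_in p U u v A \<Longrightarrow> poly_in p U u v C \<Longrightarrow> (\<And>q P. P \<in> U \<Longrightarrow> \<phi> q P = A q P + s P * C q P) \<Longrightarrow> quadric_poly p \<phi>"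
  unfolding quadric_poly_def by blast

lemma quadric_polyE:
  assumes "quadric_poly p \<phi>"
  obtains A C where "poly_in p U u v A" "poly_in p U u v C" "\<And>q P. P \<in> U \<Longrightarrow> \<phi> q P = A q P + s P * C q P"
  using assms unfolding quadric_poly_def by blast

lemma quadric_poly_cong:
  assumes "quadric_poly p \<phi>" "\<And>q P. P \<in> U \<Longrightarrow> \<psi> q P = \<phi> q P"
  shows "quadric_poly p \<psi>"
proof -
  obtain A C where 1: "poly_in p U u v A" "poly_in p U u v C" "\<And>q P. P \<in> U \<Longrightarrow> \<phi> q P = A q P + s P * C q P"
    using assms(1) by (rule quadric_polyE) blast
  show ?thesis
    by (rule quadric_polyI[OF 1(1,2)]) (simp only: 1(3) assms(2))
qed

lemma quadric_poly_poly: "poly_in p U u v A \<Longrightarrow> quadric_poly p A"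
  by (rule quadric_polyI[of p A "\<lambda>_ _. 0"]) (auto intro: poly_in_const)

lemma quadric_poly_add:
  assumes "quadric_poly p \<phi>" "quadric_poly p \<psi>"
  shows "quadric_poly p (\<lambda>q P. \<phi> q P + \<psi> q P)"
proof -
  obtain A C where 1: "poly_in p U u v A" "poly_in p U u v C" "\<And>q P. P \<in> U \<Longrightarrow> \<phi> q P = A q P + s P * C q P"
    using assms(1) by (rule quadric_polyE) blast
  obtain A' C' where 2: "poly_in p U u v A'" "poly_in p U u v C'" "\<And>q P. P \<in> U \<Longrightarrow> \<psi> q P = A' q P + s P * C' q P"
    using assms(2) by (rule quadric_polyE) blast
  show ?thesis
    by (rule quadric_polyI[OF poly_in_add[OF 1(1) 2(1)] poly_in_add[OF 1(2) 2(2)]]) (simp add: 1 2 algebra_simps)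
qed

lemma quadric_poly_scale:
  assumes "quadric_poly p \<phi>" "analytic_at2 c p"
  shows "quadric_poly p (\<lambda>q P. c q * \<phi> q P)"
proof -
  obtain A C where 1: "poly_in p U u v A" "poly_in p U u v C" "\<And>q P. P \<in> U \<Longrightarrow> \<phi> q P = A q P + s P * C q P"
    using assms(1) by (rule quadric_polyE) blast
  show ?thesis
    by (rule quadric_polyI[OF poly_in_scale[OF 1(1) assms(2)] poly_in_scale[OF 1(2) assms(2)]]) (simp add: 1 algebra_simps)
qed

lemma quadric_poly_sum:
  "(\<And>i. i \<in> I \<Longrightarrow> quadric_poly p (\<phi> i)) \<Longrightarrow> quadric_poly p (\<lambda>q P. \<Sum>i\<in>I. \<phi> i q P)"
proof (induction I rule: infinite_finite_induct)
  case (insert i I)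
  then show ?case by (simp add: quadric_poly_add)
qed (simp_all add: quadric_poly_poly poly_in_const)

lemma quadric_poly_mult_span:
  assumes "quadric_poly p \<phi>" and f: "\<And>P. P \<in> U \<Longrightarrow> f P = k0 + k1 * u P + k2 * v P + k3 * s P"
  shows "quadric_poly p (\<lambda>q P. f P * \<phi> q P)"
proof -
  obtain A C where 1: "poly_in p U u v A" "poly_in p U u v C" "\<And>q P. P \<in> U \<Longrightarrow> \<phi> q P = A q P + s P * C q P"
    using assms(1) by (rule quadric_polyE) blast
  let ?f = "\<lambda>P. k0 + k1 * u P + k2 * v P"
  have aff: "poly_in p U u v (\<lambda>q P. ?f P * \<psi> q P)" if "poly_in p U u v \<psi>" for \<psi>
    by (rule poly_in_mult_affine[OF that]) simp
  have "poly_in p U u v (\<lambda>q P. v P * (v P * C q P) + 4 * (u P * C q P) + (4 * \<kappa>) * (u P * (u P * C q P)))"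
    by (intro poly_in_add poly_in_scale poly_in_mult_gen 1 analytic_at2_const)
  then have sq: "poly_in p U u v (\<lambda>q P. s P ^ 2 * C q P)"
    by (rule poly_in_cong) (simp only: s_square, simp add: algebra_simps power2_eq_square)
  show ?thesis
  proof (rule quadric_polyI)
    show "poly_in p U u v (\<lambda>q P. ?f P * A q P + k3 * (s P ^ 2 * C q P))"
      by (intro poly_in_add aff 1 poly_in_scale sq analytic_at2_const)
    show "poly_in p U u v (\<lambda>q P. ?f P * C q P + k3 * A q P)"
      by (intro poly_in_add aff 1 poly_in_scale analytic_at2_const)
    show "f P * \<phi> q P = ?f P * A q P + k3 * (s P ^ 2 * C q P) + s P * (?f P * C q P + k3 * A q P)" if "P \<in> U" for q P
      using that by (simp add: 1 f algebra_simps power2_eq_square)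
  qed
qed

text \<open>The monomials of bidegree (k, k) divided by the k-th power of g.\<close>

definition monq :: "nat \<Rightarrow> nat \<Rightarrow> nat \<Rightarrow> hcoord \<Rightarrow> complex" where
  "monq k i j = (\<lambda>(z1, z2, w1, w2). z1 ^ i * z2 ^ (k - i) * w1 ^ j * w2 ^ (k - j) / g (z1, z2, w1, w2) ^ k)"

text \<open>Such a quotient is a product of k quotients of bidegree (1, 1), each of which
is a linear combination of 1, u, v, s.\<close>

lemma quadric_poly_monq: "i \<le> k \<Longrightarrow> j \<le> k \<Longrightarrow> quadric_poly p (\<lambda>q. monq k i j)"
proof (induction k arbitrary: i j)
  case 0
  have "quadric_poly p (\<lambda>_ _. 1)" by (intro quadric_poly_poly poly_in_const analytic_at2_const)
  then show ?case by (rule quadric_poly_cong) (use 0 in \<open>auto simp: monq_def\<close>)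
next
  case (Suc k)
  let ?f = "\<lambda>(z1, z2, w1, w2). (if i = 0 then z2 else z1) * (if j = 0 then w2 else w1) / g (z1, z2, w1, w2)"
  have split: "monq (Suc k) i j P = ?f P * monq k (i - 1) (j - 1) P" for P
  proof -
    obtain z1 z2 w1 w2 where P: "P = (z1, z2, w1, w2)" by (cases P)
    have "z1 ^ i * z2 ^ (Suc k - i) = (if i = 0 then z2 else z1) * (z1 ^ (i - 1) * z2 ^ (k - (i - 1)))"
      using Suc.prems by (cases i) auto
    moreover have "w1 ^ j * w2 ^ (Suc k - j) = (if j = 0 then w2 else w1) * (w1 ^ (j - 1) * w2 ^ (k - (j - 1)))"
      using Suc.prems by (cases j) auto
    moreover have "monq (Suc k) i j P = (z1 ^ i * z2 ^ (Suc k - i)) * (w1 ^ j * w2 ^ (Suc k - j)) / g P ^ Suc k"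
      by (simp add: monq_def P)
    ultimately show ?thesis
      by (simp add: monq_def P mult_ac)
  qed
  have IH: "quadric_poly p (\<lambda>q. monq k (i - 1) (j - 1))" using Suc.prems by (intro Suc.IH) auto
  have "quadric_poly p (\<lambda>q P. ?f P * monq k (i - 1) (j - 1) P)"
  proof (cases "i = 0"; cases "j = 0")
    assume "i = 0" "j = 0"
    then show ?thesis
      by (intro quadric_poly_mult_span[OF IH, of _ 0 "- 1 / \<delta>" "- 1 / (2 * \<delta>)" "1 / (2 * \<delta>)"])
        (use \<delta>0 in \<open>auto simp: monomials_span field_simps\<close>)
  next
    assume "i = 0" "j \<noteq> 0"
    then show ?thesis
      by (intro quadric_poly_mult_span[OF IH, of _ 0 "1 / (\<delta> * B)" 0 0])
        (use \<delta>0 B in \<open>auto simp: monomials_span field_simps\<close>)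
  next
    assume "i \<noteq> 0" "j = 0"
    then show ?thesis
      by (intro quadric_poly_mult_span[OF IH, of _ "1 / (\<delta> * B)" "(1 + \<kappa>) / (\<delta> * B)" 0 "- 1 / (\<delta> * B)"])
        (use \<delta>0 B in \<open>auto simp: monomials_span field_simps\<close>)
  next
    assume "i \<noteq> 0" "j \<noteq> 0"
    then show ?thesis
      by (intro quadric_poly_mult_span[OF IH, of _ 0 "- 1 / (\<delta> * B ^ 2)" "1 / (2 * \<delta> * B ^ 2)" "1 / (2 * \<delta> * B ^ 2)"])
        (use \<delta>0 B in \<open>auto simp: monomials_span field_simps\<close>)
  qed
  then show ?case unfolding split .
qed

lemma quadric_poly_bihom:
  assumes "\<And>i j. analytic_at2 (h i j) p"
  shows "quadric_poly p (\<lambda>q P. bihom k k (\<lambda>i j. h i j q) P / g P ^ k)"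
proof -
  have "quadric_poly p (\<lambda>q P. \<Sum>i\<le>k. \<Sum>j\<le>k. h i j q * monq k i j P)"
    by (intro quadric_poly_sum quadric_poly_scale quadric_poly_monq assms) auto
  then show ?thesis
    by (rule quadric_poly_cong) (auto simp: bihom_def monq_def sum_divide_distrib mult.assoc)
qed

end

section \<open>The exponential factor\<close>

definition expo :: "complex \<Rightarrow> complex \<Rightarrow> plane \<Rightarrow> complex" where
  "expo a b q = exp (fst q * a + snd q * b)"

lemma expo_nonzero [simp]: "expo a b q \<noteq> 0" by (simp add: expo_def)

lemma expo_analytic [intro, simp]: "analytic_at2 (expo a b) p"
proof -
  have "analytic_at2 (\<lambda>q. exp (a * fst q + b * snd q)) p"
    by (rule analytic_at2_compose_linear[of exp a p b 1]) (auto intro: holomorphic_intros)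
  then show ?thesis by (simp add: expo_def[abs_def] mult.commute)
qed

lemma dmon_expo: "dmon i j (\<lambda>q. k * expo a b q) = (\<lambda>q. k * (a ^ i * b ^ j) * expo a b q)"
proof (induction i)
  case 0
  show ?case
  proof (induction j)
    case (Suc j)
    have "deriv (\<lambda>t. k * b ^ j * exp (x * a + t * b)) y = k * (b ^ Suc j) * exp (x * a + y * b)" for x y
      by (rule DERIV_imp_deriv) (auto intro!: derivative_eq_intros)
    then show ?case by (simp add: dmon_Suc2 Suc) (simp add: ddy_def expo_def fun_eq_iff mult_ac)
  qed simp
next
  case (Suc i)
  have "deriv (\<lambda>t. k * (a ^ i * b ^ j) * exp (t * a + y * b)) x = k * (a ^ Suc i * b ^ j) * exp (x * a + y * b)" for x y
    by (rule DERIV_imp_deriv) (auto intro!: derivative_eq_intros)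
  then show ?case by (simp add: dmon_Suc1 Suc) (simp add: ddx_def expo_def fun_eq_iff mult_ac)
qed

text \<open>On an exponential of a linear form, a differential operator acts as its symbol.\<close>

lemma opf_expo:
  "opf n c (\<lambda>q. k * expo a b q) q = k * (\<Sum>i\<le>n. \<Sum>j\<le>n. c i j q * (a ^ i * b ^ j)) * expo a b q"
  unfolding opf_def dmon_expo by (simp add: sum_distrib_left sum_distrib_right mult_ac)

lemma continuous_eventually_noteq:
  fixes f :: "plane \<Rightarrow> complex"
  assumes "continuous_on UNIV f" "f p \<noteq> z"
  shows "eventually (\<lambda>q. f q \<noteq> z) (nhds p)"
proof -
  have "open (f -` (- {z}))" by (rule open_vimage[OF _ assms(1)]) auto
  then show ?thesis using assms(2) by (auto simp: eventually_nhds)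
qed

section \<open>Gluing conditions\<close>

context gluing_data
begin

definition E :: "hcoord \<Rightarrow> plane \<Rightarrow> complex" where
  "E P = expo (G\<^sub>1 P) (G\<^sub>2 P)"

lemma E_nonzero [simp]: "E P q \<noteq> 0" and E_analytic [intro, simp]: "analytic_at2 (E P) p"
  by (simp_all add: E_def)

definition section_of :: "plane \<Rightarrow> (plane \<Rightarrow> hcoord \<Rightarrow> complex) \<Rightarrow> hcoord \<Rightarrow> germ" where
  "section_of p \<phi> = (\<lambda>P\<in>U. germ p (\<lambda>q. \<phi> q P * E P q))"

text \<open>The exponential factors at two points that are glued differ by exp (c_1 x + c_2 y).  After dividing by them the gluing
condition with the constant \<Lambda> becomes one with this multiplier.\<close>

definition multiplier :: "complex \<Rightarrow> plane \<Rightarrow> complex" where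
  "multiplier \<Lambda> q = \<Lambda> * exp (- (c\<^sub>1 * fst q + c\<^sub>2 * snd q))"

definition glues :: "plane \<Rightarrow> complex \<Rightarrow> (hcoord \<Rightarrow> germ) \<Rightarrow> bool" where
  "glues p \<Lambda> \<phi> \<longleftrightarrow> (\<forall>t1 t2. (1, 0, t1, t2) \<in> U \<longrightarrow>
     \<phi> (1, 0, t1, t2) = germ p (\<lambda>_. \<Lambda>) \<otimes>\<^bsub>germ_ring p\<^esub> \<phi> (t1, t2, 0, 1))"

lemma M_level_iff:
  "\<phi> \<in> M_Omega_level p \<Lambda> g g\<^sub>1 g\<^sub>2 k \<longleftrightarrow>
   (\<exists>h. (\<forall>i j. analytic_at2 (h i j) p) \<and> \<phi> = section_of p (\<lambda>q P. bihom k k (\<lambda>i j. h i j q) P / g P ^ k)) \<and>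
   glues p \<Lambda> \<phi>"
  unfolding M_Omega_level_def section_of_def glues_def mem_Collect_eq
  by (simp add: E_def expo_def G\<^sub>1_def G\<^sub>2_def case_prod_unfold)

lemma glue_U: "(1, 0, t1, t2) \<in> U \<longleftrightarrow> (t1, t2, 0, 1) \<in> U"
  using glue[rule_format, of t1 t2] B by (auto simp: U_iff)

lemma E_glue:
  assumes "(1, 0, t1, t2) \<in> U"
  shows "E (1, 0, t1, t2) q = exp (c\<^sub>1 * fst q + c\<^sub>2 * snd q) * E (t1, t2, 0, 1) q"
proof -
  have nz: "g (t1, t2, 0, 1) \<noteq> 0" "g (1, 0, t1, t2) = B * g (t1, t2, 0, 1)"
    using assms glue_U glue[rule_format, of t1 t2] by (auto simp: U_iff)
  have "g\<^sub>1 (1, 0, t1, t2) = B * g\<^sub>1 (t1, t2, 0, 1) + c\<^sub>1 * (B * g (t1, t2, 0, 1))"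
    "g\<^sub>2 (1, 0, t1, t2) = B * g\<^sub>2 (t1, t2, 0, 1) + c\<^sub>2 * (B * g (t1, t2, 0, 1))"
    using glue1[rule_format, of t1 t2] glue2[rule_format, of t1 t2] nz(2) by (simp_all add: algebra_simps)
  then have "G\<^sub>1 (1, 0, t1, t2) = G\<^sub>1 (t1, t2, 0, 1) + c\<^sub>1" "G\<^sub>2 (1, 0, t1, t2) = G\<^sub>2 (t1, t2, 0, 1) + c\<^sub>2"
    using nz B by (simp_all add: G\<^sub>1_def G\<^sub>2_def field_simps)
  then show ?thesis by (simp add: E_def expo_def algebra_simps exp_add[symmetric])
qed

lemma glues_section:
  assumes "\<phi> = section_of p f"
  shows "glues p \<Lambda> \<phi> \<longleftrightarrow> (\<forall>t1 t2. (1, 0, t1, t2) \<in> U \<longrightarrow>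
    near p (\<lambda>q. f q (1, 0, t1, t2)) (\<lambda>q. multiplier \<Lambda> q * f q (t1, t2, 0, 1)))"
proof -
  have "\<phi> (1, 0, t1, t2) = germ p (\<lambda>_. \<Lambda>) \<otimes>\<^bsub>germ_ring p\<^esub> \<phi> (t1, t2, 0, 1) \<longleftrightarrow>
      near p (\<lambda>q. f q (1, 0, t1, t2)) (\<lambda>q. multiplier \<Lambda> q * f q (t1, t2, 0, 1))"
    if t: "(1, 0, t1, t2) \<in> U" for t1 t2
  proof -
    have "(f q (1, 0, t1, t2) * E (1, 0, t1, t2) q = \<Lambda> * (f q (t1, t2, 0, 1) * E (t1, t2, 0, 1) q)) \<longleftrightarrow>
        f q (1, 0, t1, t2) = multiplier \<Lambda> q * f q (t1, t2, 0, 1)" for q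
    proof -
      define w where "w = exp (c\<^sub>1 * fst q + c\<^sub>2 * snd q)"
      have w: "w \<noteq> 0" by (simp add: w_def)
      have "multiplier \<Lambda> q = \<Lambda> / w"
        by (simp only: multiplier_def exp_minus divide_inverse w_def)
      then have eq: "\<Lambda> * (f q (t1, t2, 0, 1) * E (t1, t2, 0, 1) q) = (multiplier \<Lambda> q * f q (t1, t2, 0, 1)) * (w * E (t1, t2, 0, 1) q)"
        using w by simp
      have "w * E (t1, t2, 0, 1) q \<noteq> 0" using w by simp
      then show ?thesis unfolding E_glue[OF t] w_def[symmetric] eq by (rule mult_right_cancel)
    qed
    then show ?thesis
      using t glue_U by (simp add: assms section_of_def germ_mult germ_eq_iff)
  qed
  then show ?thesis by (simp add: glues_def)
qed

text \<open>The two curves that are glued lie over the line u = 0, on the two branches s = v and s = - v.  Gluing shifts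
the coordinate v by 1.\<close>

lemma gluing_point:
  "(1, 0, r / B, 1 - r) \<in> U" "(r / B, 1 - r, 0, 1) \<in> U"
  "u (1, 0, r / B, 1 - r) = 0" "v (1, 0, r / B, 1 - r) = r" "s (1, 0, r / B, 1 - r) = r"
  "u (r / B, 1 - r, 0, 1) = 0" "v (r / B, 1 - r, 0, 1) = r - 1" "s (r / B, 1 - r, 0, 1) = 1 - r"
proof -
  have g: "g (1, 0, r / B, 1 - r) = \<delta> * B" "g (r / B, 1 - r, 0, 1) = \<delta>"
    using B by (simp_all add: g bilin_def \<alpha> \<beta> field_simps power2_eq_square)
  show "(1, 0, r / B, 1 - r) \<in> U" "(r / B, 1 - r, 0, 1) \<in> U"
    using g B \<delta>0 by (simp_all add: U_iff)
  show "u (1, 0, r / B, 1 - r) = 0" "v (1, 0, r / B, 1 - r) = r" "s (1, 0, r / B, 1 - r) = r"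
    "u (r / B, 1 - r, 0, 1) = 0" "v (r / B, 1 - r, 0, 1) = r - 1" "s (r / B, 1 - r, 0, 1) = 1 - r"
    unfolding u_def v_def s_def g using B \<delta>0
    by (simp_all add: uform_def vform_def sform_def bilin_def field_simps power2_eq_square)
qed

lemma multiplier_continuous: "continuous_on UNIV (multiplier \<Lambda>)"
  unfolding multiplier_def[abs_def] by (intro continuous_intros)

lemma multiplier_analytic: "analytic_at2 (multiplier \<Lambda>) p"
proof -
  have "analytic_at2 (\<lambda>q. (\<lambda>z. \<Lambda> * exp (- z)) (c\<^sub>1 * fst q + c\<^sub>2 * snd q)) p"
    by (rule analytic_at2_compose_linear[of _ _ _ _ 1]) (auto intro!: holomorphic_intros)
  then show ?thesis by (simp add: multiplier_def[abs_def])
qed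

lemma inverse_multiplier_analytic:
  assumes "multiplier \<Lambda> p \<noteq> 1"
  shows "analytic_at2 (\<lambda>q. 1 / (multiplier \<Lambda> q - 1)) p"
proof -
  define f where "f = (\<lambda>z. \<Lambda> * exp (- z))"
  let ?z = "c\<^sub>1 * fst p + c\<^sub>2 * snd p"
  have "open (f -` (- {1}))" by (rule open_vimage) (auto simp: f_def intro!: continuous_intros)
  moreover have "?z \<in> f -` (- {1})" using assms by (simp add: f_def multiplier_def)
  ultimately obtain R where R: "R > 0" "ball ?z R \<subseteq> f -` (- {1})"
    using open_contains_ball by blast
  have "(\<lambda>z. 1 / (f z - 1)) holomorphic_on ball ?z R"
    using R(2) unfolding f_def by (intro holomorphic_intros) auto
  from analytic_at2_compose_linear[OF this R(1)] show ?thesis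
    by (simp add: f_def multiplier_def)
qed

text \<open>The translation r to r - 1 preserves the leading coefficient of a polynomial, so it has no eigenvector for an eigenvalue
different from 1.  A polynomial of degree at most n is determined by its values at 0, ..., n.\<close>

lemma no_invariant_polynomial:
  fixes c :: "nat \<Rightarrow> complex"
  assumes "L \<noteq> 1" and "\<And>r. r \<in> of_nat ` {..n} \<Longrightarrow> (\<Sum>j\<le>n. c j * r ^ j) = L * (\<Sum>j\<le>n. c j * (r - 1) ^ j)" and j: "j \<le> n"
  shows "c j = 0"
proof -
  define P where "P = (\<Sum>j\<le>n. monom (c j) j)"
  have P: "poly P r = (\<Sum>j\<le>n. c j * r ^ j)" for r by (simp add: P_def poly_sum poly_monom)
  have dP: "degree P \<le> n" unfolding P_def by (intro degree_sum_le) (auto intro: degree_monom_le[THEN le_trans])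
  define Q where "Q = P - smult L (pcompose P [:- 1, 1:])"
  have dpc: "degree (pcompose P [:- 1, 1:]) = degree P" by (simp add: degree_pcompose)
  have "Q = 0"
  proof (rule poly_eqI_degree[of "of_nat ` {..n}"])
    show "poly Q x = poly 0 x" if "x \<in> of_nat ` {..n}" for x
      using assms(2)[OF that] by (simp add: Q_def P poly_pcompose)
    have card: "card (of_nat ` {..n} :: complex set) = Suc n" by (simp add: card_image inj_on_def)
    have "degree Q \<le> n" unfolding Q_def
      by (intro degree_diff_le dP le_trans[OF degree_smult_le]) (simp add: dpc dP)
    then show "card (of_nat ` {..n} :: complex set) > degree Q" "card (of_nat ` {..n} :: complex set) > degree (0 :: complex poly)"
      unfolding card by simp_all
  qed
  then have "P = smult L (pcompose P [:- 1, 1:])" by (simp add: Q_def)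
  then have "lead_coeff P = L * lead_coeff (pcompose P [:- 1, 1:])" by (metis lead_coeff_smult)
  then have "lead_coeff P = L * lead_coeff P" by (simp add: lead_coeff_comp)
  then have "P = 0" using assms(1) by simp
  then have "coeff P j = 0" by simp
  then show ?thesis using j by (simp add: P_def coeff_sum if_distrib cong: if_cong)
qed

section \<open>The standard generators\<close>

text \<open>The first generator vanishes on both glued curves.  For the second one, s + m v + n with m, n depending
on the multiplier L only, gluing compares (1 + m) r + n with L (1 - r + m (r - 1) + n) as polynomials in
r.  The solution is m = (L + 1) / (L - 1) and n = 2 L / (L - 1)^2.  Both are written through 1 / (L - 1),
whose analyticity is where the condition that L is not 1 at the base point enters.\<close>

definition gen1 :: "plane \<Rightarrow> hcoord \<Rightarrow> complex" where
  "gen1 q P = u P"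

definition slope :: "complex \<Rightarrow> plane \<Rightarrow> complex" where
  "slope \<Lambda> q = 1 + 2 * (1 / (multiplier \<Lambda> q - 1))"

definition offset :: "complex \<Rightarrow> plane \<Rightarrow> complex" where
  "offset \<Lambda> q = 2 * multiplier \<Lambda> q * (1 / (multiplier \<Lambda> q - 1)) ^ 2"

definition gen2 :: "complex \<Rightarrow> plane \<Rightarrow> hcoord \<Rightarrow> complex" where
  "gen2 \<Lambda> q P = s P + slope \<Lambda> q * v P + offset \<Lambda> q"

lemma slope_analytic: "multiplier \<Lambda> p \<noteq> 1 \<Longrightarrow> analytic_at2 (slope \<Lambda>) p"
  unfolding slope_def[abs_def]
  by (intro analytic_at2_add analytic_at2_mult analytic_at2_const inverse_multiplier_analytic)

lemma offset_analytic: "multiplier \<Lambda> p \<noteq> 1 \<Longrightarrow> analytic_at2 (offset \<Lambda>) p"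
  unfolding offset_def[abs_def] power2_eq_square
  by (intro analytic_at2_add analytic_at2_mult analytic_at2_const inverse_multiplier_analytic multiplier_analytic)

lemma gen2_germ:
  assumes "multiplier \<Lambda> p \<noteq> 1" "P \<in> U"
  shows "section_of p (gen2 \<Lambda>) P \<in> carrier (germ_ring p)"
proof -
  have "analytic_at2 (\<lambda>q. gen2 \<Lambda> q P * E P q) p"
    unfolding gen2_def using assms(1)
    by (intro analytic_at2_mult analytic_at2_add analytic_at2_const E_analytic slope_analytic offset_analytic)
  then show ?thesis using assms(2) by (auto simp: section_of_def)
qed

lemma offset_slope:
  assumes "multiplier \<Lambda> q \<noteq> 1"
  shows "1 + slope \<Lambda> q + offset \<Lambda> q = multiplier \<Lambda> q * offset \<Lambda> q"
    "offset \<Lambda> q = multiplier \<Lambda> q * (1 - slope \<Lambda> q + offset \<Lambda> q)"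
proof -
  define d where "d = multiplier \<Lambda> q - 1"
  have m: "multiplier \<Lambda> q = 1 + d" and d: "d \<noteq> 0" using assms by (simp_all add: d_def)
  show "1 + slope \<Lambda> q + offset \<Lambda> q = multiplier \<Lambda> q * offset \<Lambda> q"
    "offset \<Lambda> q = multiplier \<Lambda> q * (1 - slope \<Lambda> q + offset \<Lambda> q)"
    using d by (simp_all add: slope_def offset_def m field_simps power2_eq_square)
qed

lemma gen1_in_level: "section_of p gen1 \<in> M_Omega_level p \<Lambda> g g\<^sub>1 g\<^sub>2 1"
proof -
  let ?h = "\<lambda>(i :: nat) (j :: nat) q. if i = 1 then if j = 1 then 0 else 0 else if j = 1 then \<delta> * B else 0 :: complex"
  have "section_of p gen1 = section_of p (\<lambda>q P. bihom 1 1 (\<lambda>i j. ?h i j q) P / g P ^ 1)"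
    by (simp only: gen1_def[abs_def] u_def uform_def bilin_eq_bihom power_one_right)
  moreover have "glues p \<Lambda> (section_of p gen1)"
    by (subst glues_section[OF refl]) (simp add: gen1_def u_def uform_def bilin_def)
  ultimately show ?thesis
    unfolding M_level_iff by (intro conjI exI[of _ ?h]) auto
qed

text \<open>For points (1:0, t1:t2) and (t1:t2, 0:1), the gluing condition is an identity between linear forms in
(t1, t2); the two coefficients are the two identities for slope and offset.\<close>

lemma gen2_in_level:
  assumes "multiplier \<Lambda> p \<noteq> 1"
  shows "section_of p (gen2 \<Lambda>) \<in> M_Omega_level p \<Lambda> g g\<^sub>1 g\<^sub>2 1"
proof -
  let ?h = "\<lambda>(i :: nat) (j :: nat) q. if i = 1 then if j = 1 then \<delta> * B ^ 2 + slope \<Lambda> q * (\<delta> * B ^ 2) + offset \<Lambda> q * \<alpha> else offset \<Lambda> q * \<beta>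
     else if j = 1 then 2 * \<delta> * B + offset \<Lambda> q * \<gamma> else \<delta> + slope \<Lambda> q * (- \<delta>) + offset \<Lambda> q * \<delta>"
  have gen: "gen2 \<Lambda> q P = bihom 1 1 (\<lambda>i j. ?h i j q) P / g P ^ 1" if "P \<in> U" for q P
  proof -
    have "gen2 \<Lambda> q P = (sform P + slope \<Lambda> q * vform P + offset \<Lambda> q * g P) / g P"
      using that by (simp add: gen2_def s_def v_def U_iff add_divide_distrib)
    also have "sform P + slope \<Lambda> q * vform P + offset \<Lambda> q * g P =
        bilin (\<delta> * B ^ 2 + slope \<Lambda> q * (\<delta> * B ^ 2) + offset \<Lambda> q * \<alpha>) (offset \<Lambda> q * \<beta>)
          (2 * \<delta> * B + offset \<Lambda> q * \<gamma>) (\<delta> + slope \<Lambda> q * (- \<delta>) + offset \<Lambda> q * \<delta>) P"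
      by (cases P) (simp add: sform_def vform_def g bilin_def algebra_simps)
    finally show ?thesis by (simp only: bilin_eq_bihom power_one_right)
  qed
  then have "section_of p (gen2 \<Lambda>) = section_of p (\<lambda>q P. bihom 1 1 (\<lambda>i j. ?h i j q) P / g P ^ 1)"
    unfolding section_of_def by (intro restrict_ext arg_cong[of _ _ "germ p"] ext) simp
  moreover have "glues p \<Lambda> (section_of p (gen2 \<Lambda>))"
    unfolding glues_section[OF refl]
  proof (intro allI impI)
    fix t1 t2 assume t: "(1, 0, t1, t2) \<in> U"
    then have t': "(t1, t2, 0, 1) \<in> U" by (simp add: glue_U)
    have gt: "g (1, 0, t1, t2) = B * \<delta> * (B * t1 + t2)" "g (t1, t2, 0, 1) = \<delta> * (B * t1 + t2)"
      by (simp_all add: g bilin_def \<alpha> \<beta> algebra_simps power2_eq_square)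
    then have nz: "B * t1 + t2 \<noteq> 0" using t by (auto simp: U_iff)
    have sv: "s (1, 0, t1, t2) = B * t1 / (B * t1 + t2)" "v (1, 0, t1, t2) = B * t1 / (B * t1 + t2)"
      "s (t1, t2, 0, 1) = t2 / (B * t1 + t2)" "v (t1, t2, 0, 1) = - t2 / (B * t1 + t2)"
    proof -
      have "sform (1, 0, t1, t2) = (B * \<delta>) * (B * t1)" "vform (1, 0, t1, t2) = (B * \<delta>) * (B * t1)"
        "sform (t1, t2, 0, 1) = \<delta> * t2" "vform (t1, t2, 0, 1) = \<delta> * (- t2)"
        by (simp_all add: sform_def vform_def bilin_def power2_eq_square)
      then show "s (1, 0, t1, t2) = B * t1 / (B * t1 + t2)" "v (1, 0, t1, t2) = B * t1 / (B * t1 + t2)"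
        "s (t1, t2, 0, 1) = t2 / (B * t1 + t2)" "v (t1, t2, 0, 1) = - t2 / (B * t1 + t2)"
        unfolding s_def v_def gt using nz B \<delta>0 by (simp_all del: mult_minus_right)
    qed
    show "near p (\<lambda>q. gen2 \<Lambda> q (1, 0, t1, t2)) (\<lambda>q. multiplier \<Lambda> q * gen2 \<Lambda> q (t1, t2, 0, 1))"
      using continuous_eventually_noteq[OF multiplier_continuous assms]
    proof eventually_elim
      case (elim q)
      have "gen2 \<Lambda> q (1, 0, t1, t2) = ((1 + slope \<Lambda> q + offset \<Lambda> q) * (B * t1) + offset \<Lambda> q * t2) / (B * t1 + t2)"
      proof -
        have "gen2 \<Lambda> q (1, 0, t1, t2) = (B * t1 + slope \<Lambda> q * (B * t1) + offset \<Lambda> q * (B * t1 + t2)) / (B * t1 + t2)"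
          using nz by (simp add: gen2_def sv add_divide_distrib diff_divide_distrib)
        then show ?thesis by (simp add: algebra_simps)
      qed
      also have "\<dots> = (multiplier \<Lambda> q * offset \<Lambda> q * (B * t1) + multiplier \<Lambda> q * (1 - slope \<Lambda> q + offset \<Lambda> q) * t2) / (B * t1 + t2)"
        by (simp only: offset_slope(1)[OF elim] flip: offset_slope(2)[OF elim])
      also have "\<dots> = multiplier \<Lambda> q * gen2 \<Lambda> q (t1, t2, 0, 1)"
      proof -
        have "gen2 \<Lambda> q (t1, t2, 0, 1) = (t2 + slope \<Lambda> q * (- t2) + offset \<Lambda> q * (B * t1 + t2)) / (B * t1 + t2)"
          using nz by (simp add: gen2_def sv add_divide_distrib diff_divide_distrib)
        then show ?thesis by (simp add: algebra_simps)
      qed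
      finally show ?case .
    qed
  qed
  moreover have "\<forall>i j. analytic_at2 (?h i j) p"
  proof (intro allI)
    fix i j :: nat
    have "analytic_at2 (\<lambda>q. \<delta> * B ^ 2 + slope \<Lambda> q * (\<delta> * B ^ 2) + offset \<Lambda> q * \<alpha>) p" "analytic_at2 (\<lambda>q. offset \<Lambda> q * \<beta>) p"
      "analytic_at2 (\<lambda>q. 2 * \<delta> * B + offset \<Lambda> q * \<gamma>) p" "analytic_at2 (\<lambda>q. \<delta> + slope \<Lambda> q * (- \<delta>) + offset \<Lambda> q * \<delta>) p"
      by (intro analytic_at2_add analytic_at2_mult analytic_at2_const slope_analytic offset_analytic assms)+
    then show "analytic_at2 (?h i j) p" by (cases "i = 1"; cases "j = 1") simp_all
  qed
  ultimately show ?thesis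
    unfolding M_level_iff by (intro conjI exI[of _ ?h])
qed

definition Gen :: "plane \<Rightarrow> complex \<Rightarrow> (hcoord \<Rightarrow> germ) ^ 2" where
  "Gen p \<Lambda> = (\<chi> i. if i = 1 then section_of p gen1 else section_of p (gen2 \<Lambda>))"

lemma Gen_simps [simp]: "Gen p \<Lambda> $ 1 = section_of p gen1" "Gen p \<Lambda> $ 2 = section_of p (gen2 \<Lambda>)"
  by (simp_all add: Gen_def)

abbreviation Gpoly :: "nat \<Rightarrow> (nat \<Rightarrow> nat \<Rightarrow> plane \<Rightarrow> complex) \<Rightarrow> plane \<Rightarrow> hcoord \<Rightarrow> complex" where
  "Gpoly n c q P \<equiv> \<Sum>i\<le>n. \<Sum>j\<le>n. c i j q * (G\<^sub>1 P ^ i * G\<^sub>2 P ^ j)"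

lemma diff_op_section:
  assumes P: "P \<in> U"
  shows "diff_op p n c (germ p (\<lambda>q. k * E P q)) =
    germ p (\<lambda>q. k * Gpoly n c q P * E P q)"
  by (subst diff_op_germ) (auto simp: E_def opf_expo[abs_def] intro: analytic_at2_cmult)

text \<open>An operator applied to an analytic multiple of the exponential: moving the multiplier past
the derivatives gives another operator, and its symbol is A.\<close>

lemma diff_op_mult_section:
  assumes c: "\<forall>i j. analytic_at2 (c i j) p" and m: "analytic_at2 m p"
  shows "\<exists>A. poly_in p U G\<^sub>1 G\<^sub>2 A \<and> (\<forall>P k. near p (opf n c (\<lambda>q. m q * (k * E P q))) (\<lambda>q. k * A q P * E P q))"
proof -
  have "is_diff_op p (\<lambda>f q. m q * dmon 0 0 f q)" by (intro is_diff_op_mult m is_diff_op_dmon)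
  moreover have "is_diff_op p (opf n c)" by (rule is_diff_op_opf) (simp add: c)
  ultimately have "is_diff_op p (\<lambda>f. opf n c (\<lambda>q. m q * dmon 0 0 f q))"
    by (rule is_diff_op_compose[of p "opf n c" "\<lambda>f q. m q * dmon 0 0 f q", rotated])
  then obtain n' c' where c': "\<And>i j. analytic_at2 (c' i j) p"
    "\<And>f. analytic_at2 f p \<Longrightarrow> near p (opf n c (\<lambda>q. m q * dmon 0 0 f q)) (opf n' c' f)"
    by (rule is_diff_opE) blast
  define A where "A = (\<lambda>q P. \<Sum>i\<le>n'. \<Sum>j\<le>n'. c' i j q * (G\<^sub>1 P ^ i * G\<^sub>2 P ^ j))"
  have "poly_in p U G\<^sub>1 G\<^sub>2 A" by (rule poly_inI[OF c'(1)]) (simp add: A_def)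
  moreover have "near p (opf n c (\<lambda>q. m q * (k * E P q))) (\<lambda>q. k * A q P * E P q)" for P k
    using c'(2)[OF analytic_at2_cmult[OF E_analytic], of k P]
    by (simp add: E_def opf_expo[abs_def] A_def)
  ultimately show ?thesis by blast
qed

text \<open>The coefficient of s in the second generator is 1, hence constant in (x, y), and so
the s-component of the result is exactly the symbol of the operator.\<close>

lemma diff_op_gen2:
  assumes c: "\<forall>i j. analytic_at2 (c i j) p" and L: "multiplier \<Lambda> p \<noteq> 1"
  shows "\<exists>A. poly_in p U G\<^sub>1 G\<^sub>2 A \<and> (\<forall>P\<in>U. diff_op p n c (section_of p (gen2 \<Lambda>) P) =
    germ p (\<lambda>q. (A q P + s P * Gpoly n c q P) * E P q))"
proof -
  obtain A1 where A1: "poly_in p U G\<^sub>1 G\<^sub>2 A1"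
    "\<And>P k. near p (opf n c (\<lambda>q. slope \<Lambda> q * (k * E P q))) (\<lambda>q. k * A1 q P * E P q)"
    using diff_op_mult_section[OF c slope_analytic[OF L], of n] by blast
  obtain A2 where A2: "poly_in p U G\<^sub>1 G\<^sub>2 A2"
    "\<And>P k. near p (opf n c (\<lambda>q. offset \<Lambda> q * (k * E P q))) (\<lambda>q. k * A2 q P * E P q)"
    using diff_op_mult_section[OF c offset_analytic[OF L], of n] by blast
  have "poly_in p U G\<^sub>1 G\<^sub>2 (\<lambda>q P. v P * A1 q P + A2 q P)"
    by (intro poly_in_add poly_in_mult_affine[OF A1(1)] A2(1)) (erule uv_eq(2))
  moreover have "diff_op p n c (section_of p (gen2 \<Lambda>) P) =
      germ p (\<lambda>q. (v P * A1 q P + A2 q P + s P * Gpoly n c q P) * E P q)"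
    if P: "P \<in> U" for P
  proof -
    have an: "analytic_at2 (\<lambda>q. s P * E P q) p" "analytic_at2 (\<lambda>q. slope \<Lambda> q * (v P * E P q)) p"
      "analytic_at2 (\<lambda>q. offset \<Lambda> q * (1 * E P q)) p"
      by (intro analytic_at2_mult analytic_at2_const E_analytic slope_analytic offset_analytic L)+
    have eq: "(\<lambda>q. gen2 \<Lambda> q P * E P q) = (\<lambda>q. s P * E P q + (slope \<Lambda> q * (v P * E P q) + offset \<Lambda> q * (1 * E P q)))"
      by (simp add: gen2_def algebra_simps)
    have 1: "near p (opf n c (\<lambda>q. gen2 \<Lambda> q P * E P q))
       (\<lambda>q. opf n c (\<lambda>q. s P * E P q) q + opf n c (\<lambda>q. slope \<Lambda> q * (v P * E P q) + offset \<Lambda> q * (1 * E P q)) q)"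
      unfolding eq by (rule opf_add[OF an(1) analytic_at2_add[OF an(2,3)]])
    have 2: "near p (\<lambda>q. opf n c (\<lambda>q. s P * E P q) q + opf n c (\<lambda>q. slope \<Lambda> q * (v P * E P q) + offset \<Lambda> q * (1 * E P q)) q)
       (\<lambda>q. opf n c (\<lambda>q. s P * E P q) q + (opf n c (\<lambda>q. slope \<Lambda> q * (v P * E P q)) q + opf n c (\<lambda>q. offset \<Lambda> q * (1 * E P q)) q))"
      by (intro near_add near_refl opf_add an)
    have 3: "near p (\<lambda>q. opf n c (\<lambda>q. s P * E P q) q + (opf n c (\<lambda>q. slope \<Lambda> q * (v P * E P q)) q + opf n c (\<lambda>q. offset \<Lambda> q * (1 * E P q)) q))
       (\<lambda>q. s P * Gpoly n c q P * E P q + (v P * A1 q P * E P q + 1 * A2 q P * E P q))"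
      by (intro near_add A1(2) A2(2)) (simp add: E_def opf_expo[abs_def])
    have "near p (opf n c (\<lambda>q. gen2 \<Lambda> q P * E P q))
      (\<lambda>q. (v P * A1 q P + A2 q P + s P * Gpoly n c q P) * E P q)"
      using near_trans[OF 1 near_trans[OF 2 3]] by (simp add: algebra_simps)
    moreover have "analytic_at2 (\<lambda>q. gen2 \<Lambda> q P * E P q) p"
      unfolding eq by (intro analytic_at2_add an)
    ultimately show ?thesis
      using P by (simp add: section_of_def diff_op_germ germ_eq_iff)
  qed
  ultimately show ?thesis by blast
qed

section \<open>The generators form a basis\<close>

text \<open>Freeness.  The first generator and the coefficients other than that of s in the second one are invariant under the
sign change of s.  Taking the difference of the relation at two paired points isolates the symbol of the second operator, which is therefore zero;
what remains is u times the symbol of the first one.\<close>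

lemma op_comb_Gen_zero:
  assumes L: "multiplier \<Lambda> p \<noteq> 1"
    and T: "\<And>i. T $ i \<in> carrier (diff_ring p)"
    and zero: "op_comb p g T (Gen p \<Lambda>) = (\<lambda>P\<in>U. \<zero>\<^bsub>germ_ring p\<^esub>)"
  shows "T $ i = \<zero>\<^bsub>diff_ring p\<^esub>"
proof -
  obtain n1 a where a: "\<And>i j. analytic_at2 (a i j) p" "T $ 1 = diff_op p n1 a"
    using T[of 1] by (rule diff_ring_carrierE) blast
  obtain n2 b where b: "\<And>i j. analytic_at2 (b i j) p" "T $ 2 = diff_op p n2 b"
    using T[of 2] by (rule diff_ring_carrierE) blast
  have b': "\<forall>i j. analytic_at2 (b i j) p" using b(1) by blast
  have zeroI: "diff_op p n c = \<zero>\<^bsub>diff_ring p\<^esub>"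
    if c: "\<And>i j. analytic_at2 (c i j) p" and ev: "eventually (\<lambda>q. \<forall>i\<le>n. \<forall>j\<le>n. c i j q = 0) (nhds p)" for n c
  proof (rule realizes_unique[OF diff_op_realizes[OF c] realizes_zero])
    fix f
    show "near p (opf n c f) (\<lambda>q. 0)"
      using ev by eventually_elim (simp add: opf_def)
  qed
  obtain A where A: "\<And>P. P \<in> U \<Longrightarrow> diff_op p n2 b (section_of p (gen2 \<Lambda>) P) =
    germ p (\<lambda>q. (A q P + s P * Gpoly n2 b q P) * E P q)"
    and Apoly: "poly_in p U G\<^sub>1 G\<^sub>2 A"
    using diff_op_gen2[OF b' L, of n2] by blast
  have id: "near p (\<lambda>q. u P * Gpoly n1 a q P +
      (A q P + s P * Gpoly n2 b q P)) (\<lambda>q. 0)" if P: "P \<in> U" for P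
  proof -
    have "op_comb p g T (Gen p \<Lambda>) P = \<zero>\<^bsub>germ_ring p\<^esub>" using zero P by simp
    then have "germ p (\<lambda>q. u P * Gpoly n1 a q P * E P q +
      (A q P + s P * Gpoly n2 b q P) * E P q) = germ p (\<lambda>_. 0)"
      using P A[OF P] diff_op_section[OF P, of p n1 a "u P"]
      by (simp add: op_comb_def a(2) b(2) germ_add germ_zero) (simp add: section_of_def gen1_def germ_add)
    then have "near p (\<lambda>q. u P * Gpoly n1 a q P * E P q +
      (A q P + s P * Gpoly n2 b q P) * E P q) (\<lambda>_. 0)"
      by (simp only: germ_eq_iff)
    then show ?thesis
    proof eventually_elim
      case (elim q)
      then show ?case by (simp only: distrib_right[symmetric] mult_eq_0_iff E_nonzero simp_thms)
    qed
  qed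
  obtain na ca where ca: "\<And>q P. P \<in> U \<Longrightarrow> A q P = Gpoly na ca q P"
    using Apoly by (rule poly_inE) blast
  have "eventually (\<lambda>q. \<forall>i\<le>n2. \<forall>j\<le>n2. b i j q = 0) (nhds p)"
  proof (rule eventually_polynomial_coeffs_zero[where f = s and X = paired, OF _ paired_exists])
    show "paired \<subseteq> U" by (auto simp: paired_def)
    fix P assume "P \<in> paired"
    then obtain P' where P: "P \<in> U" and P': "P' \<in> U" "u P' = u P" "v P' = v P" "s P' = - s P"
      by (auto simp: paired_def)
    have G: "G\<^sub>1 P' = G\<^sub>1 P" "G\<^sub>2 P' = G\<^sub>2 P" using G_eq[OF P] G_eq[OF P'(1)] P' by simp_all
    then have AP: "A q P' = A q P" for q using ca[OF P] ca[OF P'(1)] by simp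
    from id[OF P] id[OF P'(1)]
    show "eventually (\<lambda>q. s P * Gpoly n2 b q P = 0) (nhds p)"
    proof eventually_elim
      case (elim q)
      have aux: "y = 0" if "x + (a + y) = 0" "x + (a + - y) = 0" for x a y :: complex
      proof -
        have "2 * y = (x + (a + y)) - (x + (a + - y))" by simp
        also have "\<dots> = 0" unfolding that by simp
        finally show ?thesis by simp
      qed
      show ?case
        by (rule aux[OF elim(1)]) (use elim(2)[unfolded AP G P'] in simp)
    qed
  qed
  then have T2: "T $ 2 = \<zero>\<^bsub>diff_ring p\<^esub>" unfolding b(2) by (rule zeroI[OF b(1)])
  have "eventually (\<lambda>q. \<forall>i\<le>n1. \<forall>j\<le>n1. a i j q = 0) (nhds p)"
  proof (rule eventually_polynomial_coeffs_zero[where f = u and X = U])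
    show "\<exists>P\<in>U. u P = x \<and> v P = y \<and> u P \<noteq> 0" if "x \<noteq> 0" for x y
      using point_exists[OF that power2_csqrt[of "y ^ 2 + 4 * x + 4 * \<kappa> * x ^ 2"]] that by blast
    fix P assume P: "P \<in> U"
    have "(\<zero>\<^bsub>diff_ring p\<^esub>) (section_of p (gen2 \<Lambda>) P) = germ p (\<lambda>_. 0)"
    proof -
      have "section_of p (gen2 \<Lambda>) P \<in> carrier (germ_ring p)" by (rule gen2_germ[OF L P])
      then show ?thesis by (simp add: diff_ring_def germ_zero)
    qed
    then have "germ p (\<lambda>q. (A q P + s P * Gpoly n2 b q P) * E P q) = germ p (\<lambda>_. 0)"
      using A[OF P] T2 b(2) by simp
    then have "near p (\<lambda>q. (A q P + s P * Gpoly n2 b q P) * E P q) (\<lambda>_. 0)"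
      by (simp only: germ_eq_iff)
    with id[OF P]
    show "eventually (\<lambda>q. u P * Gpoly n1 a q P = 0) (nhds p)"
    proof eventually_elim
      case (elim q)
      have "A q P + s P * Gpoly n2 b q P = 0"
        using elim(2) by (simp only: mult_eq_0_iff E_nonzero simp_thms)
      then show ?case using elim(1) by simp
    qed
  qed auto
  then have T1: "T $ 1 = \<zero>\<^bsub>diff_ring p\<^esub>" unfolding a(2) by (rule zeroI[OF a(1)])
  show ?thesis using T1 T2 exhaust_2[of i] by auto
qed

lemma diff_op_glues:
  assumes "T \<in> carrier (diff_ring p)" "glues p \<Lambda> \<phi>" "\<And>P. P \<in> U \<Longrightarrow> \<phi> P \<in> carrier (germ_ring p)"
  shows "glues p \<Lambda> (\<lambda>P\<in>U. T (\<phi> P))"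
  unfolding glues_def
proof (intro allI impI)
  fix t1 t2 assume t: "(1, 0, t1, t2) \<in> U"
  then have t': "(t1, t2, 0, 1) \<in> U" by (simp add: glue_U)
  obtain F where F: "realizes p F T" using assms(1) by (auto simp: diff_ring_carrier_iff)
  obtain f where f: "analytic_at2 f p" "\<phi> (t1, t2, 0, 1) = germ p f" using assms(3)[OF t'] by (rule germ_carrierE)
  have "\<phi> (1, 0, t1, t2) = germ p (\<lambda>q. \<Lambda> * f q)"
    using assms(2) t f(2) by (simp add: glues_def germ_mult)
  then have "T (\<phi> (1, 0, t1, t2)) = germ p (F (\<lambda>q. \<Lambda> * f q))"
    using realizes_app[OF F analytic_at2_cmult[OF f(1)]] by simp
  also have "\<dots> = germ p (\<lambda>q. \<Lambda> * F f q)"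
    using F f(1) is_diff_op_linear(2)[OF _ f(1) f(1)] by (simp add: germ_eq_iff realizes_def)
  also have "\<dots> = germ p (\<lambda>_. \<Lambda>) \<otimes>\<^bsub>germ_ring p\<^esub> T (\<phi> (t1, t2, 0, 1))"
    using realizes_app[OF F f(1)] f(2) by (simp add: germ_mult)
  finally show "(\<lambda>P\<in>U. T (\<phi> P)) (1, 0, t1, t2) = germ p (\<lambda>_. \<Lambda>) \<otimes>\<^bsub>germ_ring p\<^esub> (\<lambda>P\<in>U. T (\<phi> P)) (t1, t2, 0, 1)"
    using t t' by simp
qed

text \<open>Restricted to the line u = 0, a polynomial in u and v that satisfies the gluing condition
is invariant under translation up to the multiplier.  So it vanishes there and is divisible by u.\<close>

lemma polynomial_gluing:
  assumes L: "multiplier \<Lambda> p \<noteq> 1" and A: "poly_in p U u v A"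
    and gl: "\<And>r. near p (\<lambda>q. A q (1, 0, r / B, 1 - r)) (\<lambda>q. multiplier \<Lambda> q * A q (r / B, 1 - r, 0, 1))"
  shows "\<exists>A'. poly_in p U u v A' \<and> (\<forall>P\<in>U. near p (\<lambda>q. A q P) (\<lambda>q. u P * A' q P))"
proof -
  obtain n c where c: "\<And>i j. analytic_at2 (c i j) p"
    "\<And>q P. P \<in> U \<Longrightarrow> A q P = (\<Sum>i\<le>n. \<Sum>j\<le>n. c i j q * (u P ^ i * v P ^ j))"
    using A by (rule poly_inE) blast
  have split: "(\<Sum>i\<le>n. \<Sum>j\<le>n. c i j q * (x ^ i * y ^ j)) =
      (\<Sum>j\<le>n. c 0 j q * y ^ j) + x * (\<Sum>i<n. \<Sum>j\<le>n. c (Suc i) j q * (x ^ i * y ^ j))" for q x y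
    by (subst sum.atMost_shift) (simp add: sum_distrib_left mult_ac)
  \<comment> \<open>finitely many gluing points suffice, so that one neighbourhood serves all of them\<close>
  have "eventually (\<lambda>q. \<forall>r\<in>of_nat ` {..n}. A q (1, 0, r / B, 1 - r) = multiplier \<Lambda> q * A q (r / B, 1 - r, 0, 1)) (nhds p)"
    using gl by (intro eventually_ball_finite) auto
  with continuous_eventually_noteq[OF multiplier_continuous L]
  have ev: "eventually (\<lambda>q. \<forall>j\<le>n. c 0 j q = 0) (nhds p)"
  proof eventually_elim
    case (elim q)
    have "(\<Sum>j\<le>n. c 0 j q * r ^ j) = multiplier \<Lambda> q * (\<Sum>j\<le>n. c 0 j q * (r - 1) ^ j)" if "r \<in> of_nat ` {..n}" for r
      using elim(2)[rule_format, OF that] by (simp add: c(2) gluing_point split)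
    from no_invariant_polynomial[OF elim(1) this] show ?case by blast
  qed
  define A' where "A' = (\<lambda>q P. \<Sum>i<n. \<Sum>j\<le>n. c (Suc i) j q * (u P ^ i * v P ^ j))"
  have "poly_in p U u v A'"
    unfolding A'_def by (intro poly_in_sum poly_in_scale poly_in_monomial c(1))
  moreover have "near p (\<lambda>q. A q P) (\<lambda>q. u P * A' q P)" if P: "P \<in> U" for P
    using ev by eventually_elim (simp add: c(2)[OF P] split A'_def)
  ultimately show ?thesis by blast
qed

text \<open>A function in the module is (A + s C) times the exponential.  Its s-component C is the symbol of
an operator; applying that operator to the second generator and subtracting
removes C.  The rest is a polynomial in u and v that satisfies the gluing condition,
hence u times the symbol of an operator, which is applied to the first generator.\<close>

lemma Gen_generates:
  assumes L: "multiplier \<Lambda> p \<noteq> 1" and \<phi>: "\<phi> \<in> M_Omega p \<Lambda> g g\<^sub>1 g\<^sub>2"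
  shows "\<exists>T. (\<forall>i. T $ i \<in> carrier (diff_ring p)) \<and> \<phi> = op_comb p g T (Gen p \<Lambda>)"
proof -
  obtain k where "\<phi> \<in> M_Omega_level p \<Lambda> g g\<^sub>1 g\<^sub>2 k" using \<phi> unfolding M_Omega_def by blast
  then obtain h where h: "\<forall>i j. analytic_at2 (h i j) p"
    and \<phi>h: "\<phi> = section_of p (\<lambda>q P. bihom k k (\<lambda>i j. h i j q) P / g P ^ k)" and gl: "glues p \<Lambda> \<phi>"
    unfolding M_level_iff by blast
  have "quadric_poly p (\<lambda>q P. bihom k k (\<lambda>i j. h i j q) P / g P ^ k)"
    by (rule quadric_poly_bihom) (simp add: h)
  then obtain A C where A: "poly_in p U u v A" and C: "poly_in p U u v C"
    and AC: "\<And>q P. P \<in> U \<Longrightarrow> bihom k k (\<lambda>i j. h i j q) P / g P ^ k = A q P + s P * C q P"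
    by (rule quadric_polyE) blast
  have \<phi>AC: "\<phi> P = germ p (\<lambda>q. (A q P + s P * C q P) * E P q)" if "P \<in> U" for P
    using that by (simp add: \<phi>h section_of_def flip: AC)
  obtain n c where c: "\<And>i j. analytic_at2 (c i j) p"
    "\<And>q P. P \<in> U \<Longrightarrow> C q P = Gpoly n c q P"
    using C[folded poly_in_change] by (rule poly_inE) blast
  have c': "\<forall>i j. analytic_at2 (c i j) p" using c(1) by blast
  obtain A2 where A2: "poly_in p U G\<^sub>1 G\<^sub>2 A2"
    and T2: "\<And>P. P \<in> U \<Longrightarrow> diff_op p n c (section_of p (gen2 \<Lambda>) P) = germ p (\<lambda>q. (A2 q P + s P * C q P) * E P q)"
  proof -
    obtain A2 where "poly_in p U G\<^sub>1 G\<^sub>2 A2" and *: "\<forall>P\<in>U. diff_op p n c (section_of p (gen2 \<Lambda>) P) =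
        germ p (\<lambda>q. (A2 q P + s P * Gpoly n c q P) * E P q)"
      using diff_op_gen2[OF c' L, of n] by blast
    then show ?thesis using that[of A2] by (simp add: c(2))
  qed
  define A3 where "A3 = (\<lambda>q P. A q P + - 1 * A2 q P)"
  have A3: "poly_in p U u v A3" unfolding A3_def
    by (intro poly_in_add poly_in_scale A A2[unfolded poly_in_change] analytic_at2_const)
  define \<psi> where "\<psi> = (\<lambda>P\<in>U. diff_op p n c (section_of p (gen2 \<Lambda>) P))"
  have \<psi>: "\<psi> = section_of p (\<lambda>q P. A2 q P + s P * C q P)"
    unfolding \<psi>_def section_of_def[of p "\<lambda>q P. A2 q P + s P * C q P"] by (intro restrict_ext) (simp add: T2)
  have dc: "diff_op p n c \<in> carrier (diff_ring p)" using c(1) by (auto simp: diff_ring_def)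
  have gl\<psi>: "glues p \<Lambda> \<psi>"
    unfolding \<psi>_def using gen2_in_level[OF L] by (intro diff_op_glues[OF dc] gen2_germ[OF L]) (auto simp: M_level_iff)
  have "near p (\<lambda>q. A3 q (1, 0, r / B, 1 - r)) (\<lambda>q. multiplier \<Lambda> q * A3 q (r / B, 1 - r, 0, 1))" for r
  proof -
    have "\<phi> = section_of p (\<lambda>q P. A q P + s P * C q P)"
      unfolding \<phi>h section_of_def by (intro restrict_ext arg_cong[of _ _ "germ p"] ext) (simp only: AC)
    from gl[unfolded glues_section[OF this], rule_format, OF gluing_point(1)[of r]]
      gl\<psi>[unfolded glues_section[OF \<psi>], rule_format, OF gluing_point(1)[of r]]
    show ?thesis
    proof eventually_elim
      case (elim q)
      have "A3 q P = (A q P + s P * C q P) - (A2 q P + s P * C q P)" for P by (simp add: A3_def)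
      then show ?case by (simp only: elim right_diff_distrib)
    qed
  qed
  then obtain A4 where A4: "poly_in p U u v A4" "\<And>P. P \<in> U \<Longrightarrow> near p (\<lambda>q. A3 q P) (\<lambda>q. u P * A4 q P)"
    using polynomial_gluing[OF L A3] by blast
  obtain n' d where d: "\<And>i j. analytic_at2 (d i j) p"
    "\<And>q P. P \<in> U \<Longrightarrow> A4 q P = Gpoly n' d q P"
    using A4(1)[folded poly_in_change] by (rule poly_inE) blast
  define T :: "(germ \<Rightarrow> germ) ^ 2" where "T = (\<chi> i. if i = 1 then diff_op p n' d else diff_op p n c)"
  have "T $ i \<in> carrier (diff_ring p)" for i
    using c(1) d(1) by (auto simp: T_def diff_ring_def)
  moreover have "\<phi> = op_comb p g T (Gen p \<Lambda>)"
  proof (rule extensionalityI[of _ U])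
    show "\<phi> \<in> extensional U" by (simp add: \<phi>h section_of_def)
    show "op_comb p g T (Gen p \<Lambda>) \<in> extensional U" by (simp add: op_comb_def)
    fix P assume P: "P \<in> U"
    have T1: "diff_op p n' d (section_of p gen1 P) = germ p (\<lambda>q. u P * A4 q P * E P q)"
      using diff_op_section[OF P, of p n' d "u P"] P by (simp add: section_of_def gen1_def d(2))
    have "op_comb p g T (Gen p \<Lambda>) P = germ p (\<lambda>q. u P * A4 q P * E P q + (A2 q P + s P * C q P) * E P q)"
      using P by (simp add: op_comb_def T_def T1 T2 germ_add)
    also have "\<dots> = \<phi> P"
      unfolding \<phi>AC[OF P] germ_eq_iff using A4(2)[OF P]
      by eventually_elim (simp add: A3_def algebra_simps)
    finally show "\<phi> P = op_comb p g T (Gen p \<Lambda>) P" ..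
  qed
  ultimately show ?thesis by blast
qed

theorem Gen_is_basis:
  assumes L: "multiplier \<Lambda> p \<noteq> 1"
  shows "is_basis p g (M_Omega p \<Lambda> g g\<^sub>1 g\<^sub>2) (Gen p \<Lambda>)"
    and "Gen p \<Lambda> $ i \<in> M_Omega_level p \<Lambda> g g\<^sub>1 g\<^sub>2 1"
proof -
  have lev: "Gen p \<Lambda> $ i \<in> M_Omega_level p \<Lambda> g g\<^sub>1 g\<^sub>2 1" for i
    using exhaust_2[of i] gen1_in_level[of p \<Lambda>] gen2_in_level[OF L] by (elim disjE) simp_all
  then show "Gen p \<Lambda> $ i \<in> M_Omega_level p \<Lambda> g g\<^sub>1 g\<^sub>2 1" .
  show "is_basis p g (M_Omega p \<Lambda> g g\<^sub>1 g\<^sub>2) (Gen p \<Lambda>)"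
    unfolding is_basis_def
  proof (intro conjI allI ballI impI)
    show "Gen p \<Lambda> $ i \<in> M_Omega p \<Lambda> g g\<^sub>1 g\<^sub>2" for i
      unfolding M_Omega_def using lev[of i] by (intro UN_I[of 1]) auto
  qed (use Gen_generates[OF L] op_comb_Gen_zero[OF L] in blast)+
qed

end

section \<open>Action of differential operators on germs\<close>

lemma diff_ring_app:
  assumes T: "T \<in> carrier (diff_ring p)" and x: "x \<in> carrier (germ_ring p)"
  shows "T x \<in> carrier (germ_ring p)"
    and "y \<in> carrier (germ_ring p) \<Longrightarrow> T (x \<oplus>\<^bsub>germ_ring p\<^esub> y) = T x \<oplus>\<^bsub>germ_ring p\<^esub> T y"
    and "T (germ p (\<lambda>_. c) \<otimes>\<^bsub>germ_ring p\<^esub> x) = germ p (\<lambda>_. c) \<otimes>\<^bsub>germ_ring p\<^esub> T x"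
proof -
  obtain F where F: "realizes p F T" using T by (auto simp: diff_ring_carrier_iff)
  then have dF: "is_diff_op p F" by (simp add: realizes_def)
  obtain f where f: "analytic_at2 f p" "x = germ p f" using x by (rule germ_carrierE)
  have Tx: "T x = germ p (F f)" using realizes_app[OF F f(1)] f(2) by simp
  show "T x \<in> carrier (germ_ring p)"
    unfolding Tx by (rule germ_carrierI[OF is_diff_op_analytic[OF dF f(1)]])
  show "T (x \<oplus>\<^bsub>germ_ring p\<^esub> y) = T x \<oplus>\<^bsub>germ_ring p\<^esub> T y" if y: "y \<in> carrier (germ_ring p)"
  proof -
    obtain h where h: "analytic_at2 h p" "y = germ p h" using y by (rule germ_carrierE)
    have "T (x \<oplus>\<^bsub>germ_ring p\<^esub> y) = germ p (F (\<lambda>q. f q + h q))"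
      using realizes_app[OF F analytic_at2_add[OF f(1) h(1)]] by (simp add: f h germ_add)
    also have "\<dots> = germ p (\<lambda>q. F f q + F h q)"
      unfolding germ_eq_iff by (rule is_diff_op_linear(1)[OF dF f(1) h(1)])
    finally show ?thesis using realizes_app[OF F h(1)] h(2) by (simp add: Tx germ_add)
  qed
  have "T (germ p (\<lambda>_. c) \<otimes>\<^bsub>germ_ring p\<^esub> x) = germ p (F (\<lambda>q. c * f q))"
    using realizes_app[OF F analytic_at2_cmult[OF f(1)]] by (simp add: f germ_mult)
  also have "\<dots> = germ p (\<lambda>q. c * F f q)"
    unfolding germ_eq_iff by (rule is_diff_op_linear(2)[OF dF f(1) f(1)])
  finally show "T (germ p (\<lambda>_. c) \<otimes>\<^bsub>germ_ring p\<^esub> x) = germ p (\<lambda>_. c) \<otimes>\<^bsub>germ_ring p\<^esub> T x"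
    by (simp add: Tx germ_mult)
qed

lemma diff_ring_ops_app:
  assumes "x \<in> carrier (germ_ring p)"
  shows "(S \<oplus>\<^bsub>diff_ring p\<^esub> T) x = S x \<oplus>\<^bsub>germ_ring p\<^esub> T x"
    "(S \<otimes>\<^bsub>diff_ring p\<^esub> T) x = S (T x)"
    "\<one>\<^bsub>diff_ring p\<^esub> x = x" "\<zero>\<^bsub>diff_ring p\<^esub> x = \<zero>\<^bsub>germ_ring p\<^esub>"
  using assms by (simp_all add: diff_ring_def compose_def)

text \<open>Elements of the ring of differential operators are only meaningful on germs of analytic functions.\<close>

definition germ_valued :: "plane \<Rightarrow> (hcoord \<Rightarrow> complex) \<Rightarrow> (hcoord \<Rightarrow> germ) ^ 2 \<Rightarrow> bool" where
  "germ_valued p g \<Psi> \<longleftrightarrow> (\<forall>i. \<forall>P\<in>nonvanishing g. (\<Psi> $ i) P \<in> carrier (germ_ring p))"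

lemma germ_valuedD: "germ_valued p g \<Psi> \<Longrightarrow> P \<in> nonvanishing g \<Longrightarrow> (\<Psi> $ i) P \<in> carrier (germ_ring p)"
  by (auto simp: germ_valued_def)

lemma mat2_carrierD: "T \<in> carrier (mat2_ring R) \<Longrightarrow> T $ i $ j \<in> carrier R"
  by (simp add: mat2_ring_def)

lemma op_comb_add:
  assumes "germ_valued p g \<Psi>" "\<And>j. T $ j \<in> carrier (diff_ring p)" "\<And>j. S $ j \<in> carrier (diff_ring p)" "P \<in> nonvanishing g"
  shows "op_comb p g (\<chi> j. T $ j \<oplus>\<^bsub>diff_ring p\<^esub> S $ j) \<Psi> P = op_comb p g T \<Psi> P \<oplus>\<^bsub>germ_ring p\<^esub> op_comb p g S \<Psi> P"
proof -
  interpret R: cring "germ_ring p" by (rule cring_germ_ring)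
  show ?thesis
    using assms(4) germ_valuedD[OF assms(1,4)]
    by (simp add: op_comb_def diff_ring_ops_app diff_ring_app(1)[OF assms(2)] diff_ring_app(1)[OF assms(3)] R.a_ac)
qed

lemma op_comb_fun_mult:
  assumes "germ_valued p g \<Psi>" "\<And>j. T $ j \<in> carrier (diff_ring p)" "P \<in> nonvanishing g"
  shows "op_comb p g T (fun_mult p g l \<Psi>) P = germ p (\<lambda>_. l P) \<otimes>\<^bsub>germ_ring p\<^esub> op_comb p g T \<Psi> P"
proof -
  interpret R: cring "germ_ring p" by (rule cring_germ_ring)
  show ?thesis
    using assms(3) germ_valuedD[OF assms(1,3)]
    by (simp add: op_comb_def fun_mult_def diff_ring_app[OF assms(2)] R.r_distr germ_carrierI)
qed

lemma mat_act_mult: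
  assumes "germ_valued p g \<Psi>" "T \<in> carrier (mat2_ring (diff_ring p))" "S \<in> carrier (mat2_ring (diff_ring p))"
  shows "mat_act p g (T \<otimes>\<^bsub>mat2_ring (diff_ring p)\<^esub> S) \<Psi> = mat_act p g T (mat_act p g S \<Psi>)"
proof -
  interpret R: cring "germ_ring p" by (rule cring_germ_ring)
  interpret D: ring "diff_ring p" by (rule ring_diff_ring)
  note T = mat2_carrierD[OF assms(2)] and S = mat2_carrierD[OF assms(3)]
  have "op_comb p g ((T \<otimes>\<^bsub>mat2_ring (diff_ring p)\<^esub> S) $ i) \<Psi> P = op_comb p g (T $ i) (mat_act p g S \<Psi>) P"
    if P: "P \<in> nonvanishing g" for i P
    using P germ_valuedD[OF assms(1) P]
    by (simp add: op_comb_def mat_act_def mat2_ring_def diff_ring_ops_app diff_ring_app[OF T] diff_ring_app[OF S] R.a_ac)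
  then have "op_comb p g ((T \<otimes>\<^bsub>mat2_ring (diff_ring p)\<^esub> S) $ i) \<Psi> = op_comb p g (T $ i) (mat_act p g S \<Psi>)" for i
    by (intro extensionalityI[of _ "nonvanishing g"]) (simp_all add: op_comb_def)
  then show ?thesis by (simp add: mat_act_def vec_eq_iff)
qed

section \<open>The ring of functions\<close>

context gluing_data
begin

lemma g_power: "\<exists>a. \<forall>P. g P ^ N = bihom N N a P"
  using bihom_power[of 1 1 _ N] unfolding g bilin_eq_bihom by simp

text \<open>Unlike the local description, this one makes closure under the ring operations a matter of common denominators.\<close>

lemma A_ring_iff:
  "l \<in> carrier (A_ring g) \<longleftrightarrow> l \<in> extensional U \<and> (\<exists>N a. \<forall>P\<in>U. l P = bihom N N a P / g P ^ N) \<and>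
     (\<forall>t1 t2. (1, 0, t1, t2) \<in> U \<longrightarrow> l (1, 0, t1, t2) = l (t1, t2, 0, 1))"
proof
  assume l: "l \<in> carrier (A_ring g)"
  then have "l \<in> extensional U" "\<forall>t1 t2. (1, 0, t1, t2) \<in> U \<longrightarrow> l (1, 0, t1, t2) = l (t1, t2, 0, 1)"
    unfolding A_ring_def by simp_all
  with A_ring_global[OF g g_nz l]
  show "l \<in> extensional U \<and> (\<exists>N a. \<forall>P\<in>U. l P = bihom N N a P / g P ^ N) \<and>
     (\<forall>t1 t2. (1, 0, t1, t2) \<in> U \<longrightarrow> l (1, 0, t1, t2) = l (t1, t2, 0, 1))" by blast
next
  assume l: "l \<in> extensional U \<and> (\<exists>N a. \<forall>P\<in>U. l P = bihom N N a P / g P ^ N) \<and>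
     (\<forall>t1 t2. (1, 0, t1, t2) \<in> U \<longrightarrow> l (1, 0, t1, t2) = l (t1, t2, 0, 1))"
  then obtain N a where a: "\<forall>P\<in>U. l P = bihom N N a P / g P ^ N" by blast
  obtain b where b: "\<forall>P. g P ^ N = bihom N N b P" using g_power by blast
  have "\<forall>P\<^sub>0\<in>U. \<exists>m n a b. bihom m n b P\<^sub>0 \<noteq> 0 \<and>
      (\<forall>P\<in>U. bihom m n b P \<noteq> 0 \<longrightarrow> l P = bihom m n a P / bihom m n b P)"
  proof
    fix P\<^sub>0 assume "P\<^sub>0 \<in> U"
    then have "bihom N N b P\<^sub>0 \<noteq> 0" unfolding b[rule_format, symmetric] by (simp add: U_iff)
    moreover have "\<forall>P\<in>U. bihom N N b P \<noteq> 0 \<longrightarrow> l P = bihom N N a P / bihom N N b P"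
      unfolding b[rule_format, symmetric] using a by blast
    ultimately show "\<exists>m n a b. bihom m n b P\<^sub>0 \<noteq> 0 \<and>
      (\<forall>P\<in>U. bihom m n b P \<noteq> 0 \<longrightarrow> l P = bihom m n a P / bihom m n b P)" by blast
  qed
  then show "l \<in> carrier (A_ring g)"
    using l unfolding A_ring_def by simp
qed

lemma A_ring_carrierE:
  assumes "l \<in> carrier (A_ring g)"
  obtains N a where "\<And>P. P \<in> U \<Longrightarrow> l P = bihom N N a P / g P ^ N" "l \<in> extensional U"
    "\<And>t1 t2. (1, 0, t1, t2) \<in> U \<Longrightarrow> l (1, 0, t1, t2) = l (t1, t2, 0, 1)"
  using assms unfolding A_ring_iff by blast

lemma A_ring_carrierI:
  assumes "\<And>P. P \<in> U \<Longrightarrow> f P = bihom N N a P / g P ^ N"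
    "\<And>t1 t2. (1, 0, t1, t2) \<in> U \<Longrightarrow> f (1, 0, t1, t2) = f (t1, t2, 0, 1)"
  shows "restrict f U \<in> carrier (A_ring g)"
  unfolding A_ring_iff using assms glue_U by auto

lemma A_ring_simps:
  "mult (A_ring g) k l = (\<lambda>P\<in>U. k P * l P)" "add (A_ring g) k l = (\<lambda>P\<in>U. k P + l P)"
  "one (A_ring g) = (\<lambda>P\<in>U. 1)" "zero (A_ring g) = (\<lambda>P\<in>U. 0)"
  by (simp_all add: A_ring_def)

lemma A_ring_const: "(\<lambda>P\<in>U. c) \<in> carrier (A_ring g)"
  by (rule A_ring_carrierI[of _ 0 "\<lambda>_ _. c"]) (auto simp: bihom_def)

lemma A_ring_closed:
  assumes "k \<in> carrier (A_ring g)" "l \<in> carrier (A_ring g)"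
  shows "(\<lambda>P\<in>U. k P * l P) \<in> carrier (A_ring g)" "(\<lambda>P\<in>U. k P + l P) \<in> carrier (A_ring g)"
proof -
  obtain N a where k: "\<And>P. P \<in> U \<Longrightarrow> k P = bihom N N a P / g P ^ N"
    "\<And>t1 t2. (1, 0, t1, t2) \<in> U \<Longrightarrow> k (1, 0, t1, t2) = k (t1, t2, 0, 1)"
    using assms(1) by (rule A_ring_carrierE) blast
  obtain M b where l: "\<And>P. P \<in> U \<Longrightarrow> l P = bihom M M b P / g P ^ M"
    "\<And>t1 t2. (1, 0, t1, t2) \<in> U \<Longrightarrow> l (1, 0, t1, t2) = l (t1, t2, 0, 1)"
    using assms(2) by (rule A_ring_carrierE) blast
  show "(\<lambda>P\<in>U. k P * l P) \<in> carrier (A_ring g)"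
  proof (rule A_ring_carrierI)
    show "k P * l P = bihom (N + M) (N + M) (conv N N M M a b) P / g P ^ (N + M)" if "P \<in> U" for P
      using that by (simp add: k(1) l(1) bihom_mult[symmetric] power_add)
  qed (simp only: k(2) l(2))
  obtain gN where gN: "\<forall>P. g P ^ N = bihom N N gN P" using g_power by blast
  obtain gM where gM: "\<forall>P. g P ^ M = bihom M M gM P" using g_power by blast
  show "(\<lambda>P\<in>U. k P + l P) \<in> carrier (A_ring g)"
  proof (rule A_ring_carrierI)
    fix P assume P: "P \<in> U"
    have "k P + l P = (bihom N N a P * g P ^ M + g P ^ N * bihom M M b P) / g P ^ (N + M)"
      using P by (simp add: k l U_iff power_add add_divide_distrib)
    also have "\<dots> = bihom (N + M) (N + M) (\<lambda>i j. conv N N M M a gM i j + conv N N M M gN b i j) P / g P ^ (N + M)"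
      unfolding bihom_add[symmetric] bihom_mult[symmetric] gN[rule_format, symmetric] gM[rule_format, symmetric] ..
    finally show "k P + l P = bihom (N + M) (N + M) (\<lambda>i j. conv N N M M a gM i j + conv N N M M gN b i j) P / g P ^ (N + M)" .
  qed (simp only: k(2) l(2))
qed

lemma A_ring_eqI:
  assumes "k \<in> carrier (A_ring g)" "l \<in> carrier (A_ring g)" "\<And>P. P \<in> U \<Longrightarrow> k P = l P"
  shows "k = l"
  by (rule extensionalityI[of _ U]) (use assms A_ring_iff in auto)

lemma ring_A_ring: "ring (A_ring g)"
proof -
  have neg: "\<exists>m\<in>carrier (A_ring g). m \<oplus>\<^bsub>A_ring g\<^esub> l = \<zero>\<^bsub>A_ring g\<^esub>" if l: "l \<in> carrier (A_ring g)" for l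
    using A_ring_closed(1)[OF A_ring_const[of "- 1"] l]
    by (intro bexI[of _ "\<lambda>P\<in>U. (\<lambda>P\<in>U. - 1) P * l P"]) (auto simp: A_ring_simps intro!: restrict_ext)
  show ?thesis
  proof (rule ringI)
    show "abelian_group (A_ring g)"
    proof (rule abelian_groupI[OF _ _ _ _ _ neg])
      fix l assume l: "l \<in> carrier (A_ring g)"
      show "\<zero>\<^bsub>A_ring g\<^esub> \<oplus>\<^bsub>A_ring g\<^esub> l = l"
        unfolding A_ring_simps by (rule A_ring_eqI[OF A_ring_closed(2)[OF A_ring_const l] l]) simp
    qed (auto simp: A_ring_simps A_ring_closed A_ring_const add_ac intro!: restrict_ext)
    show "monoid (A_ring g)"
    proof (rule monoidI)
      fix l assume l: "l \<in> carrier (A_ring g)"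
      show "\<one>\<^bsub>A_ring g\<^esub> \<otimes>\<^bsub>A_ring g\<^esub> l = l"
        unfolding A_ring_simps by (rule A_ring_eqI[OF A_ring_closed(1)[OF A_ring_const l] l]) simp
      show "l \<otimes>\<^bsub>A_ring g\<^esub> \<one>\<^bsub>A_ring g\<^esub> = l"
        unfolding A_ring_simps by (rule A_ring_eqI[OF A_ring_closed(1)[OF l A_ring_const] l]) simp
    qed (auto simp: A_ring_simps A_ring_closed A_ring_const mult_ac intro!: restrict_ext)
  qed (auto simp: A_ring_simps distrib_left distrib_right intro!: restrict_ext)
qed

section \<open>The embedding attached to a basis\<close>

lemma section_germ:
  assumes "\<And>P. P \<in> U \<Longrightarrow> analytic_at2 (\<lambda>q. f q P) p" "P \<in> U"
  shows "section_of p f P \<in> carrier (germ_ring p)"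
proof -
  have "analytic_at2 (\<lambda>q. f q P * E P q) p" using assms by (intro analytic_at2_mult E_analytic) auto
  then show ?thesis using assms(2) by (auto simp: section_of_def)
qed

lemma M_Omega_germ:
  assumes "\<phi> \<in> M_Omega p \<Lambda> g g\<^sub>1 g\<^sub>2" "P \<in> U"
  shows "\<phi> P \<in> carrier (germ_ring p)"
proof -
  obtain k where "\<phi> \<in> M_Omega_level p \<Lambda> g g\<^sub>1 g\<^sub>2 k" using assms(1) unfolding M_Omega_def by blast
  then obtain h where h: "\<forall>i j. analytic_at2 (h i j) p"
    and \<phi>h: "\<phi> = section_of p (\<lambda>q P. bihom k k (\<lambda>i j. h i j q) P / g P ^ k)"
    unfolding M_level_iff by blast
  have "analytic_at2 (\<lambda>q. bihom k k (\<lambda>i j. h i j q) P / g P ^ k) p" for P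
  proof -
    obtain z1 z2 w1 w2 where P: "P = (z1, z2, w1, w2)" by (cases P)
    have "analytic_at2 (\<lambda>q. (1 / g P ^ k) * (\<Sum>i\<le>k. \<Sum>j\<le>k. h i j q * z1 ^ i * z2 ^ (k - i) * w1 ^ j * w2 ^ (k - j))) p"
      using h by (intro analytic_at2_mult analytic_at2_sum analytic_at2_const) auto
    then show ?thesis by (simp add: bihom_def P)
  qed
  then show ?thesis unfolding \<phi>h by (intro section_germ assms(2))
qed

lemma M_Omega_mult:
  assumes l: "l \<in> carrier (A_ring g)" and \<phi>: "\<phi> \<in> M_Omega p \<Lambda> g g\<^sub>1 g\<^sub>2"
  shows "(\<lambda>P\<in>U. germ p (\<lambda>_. l P) \<otimes>\<^bsub>germ_ring p\<^esub> \<phi> P) \<in> M_Omega p \<Lambda> g g\<^sub>1 g\<^sub>2"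
proof -
  obtain k where k: "k \<ge> 1" "\<phi> \<in> M_Omega_level p \<Lambda> g g\<^sub>1 g\<^sub>2 k" using \<phi> unfolding M_Omega_def by auto
  obtain h where h: "\<forall>i j. analytic_at2 (h i j) p"
    and \<phi>h: "\<phi> = section_of p (\<lambda>q P. bihom k k (\<lambda>i j. h i j q) P / g P ^ k)" and gl: "glues p \<Lambda> \<phi>"
    using k(2) unfolding M_level_iff by blast
  obtain N a where a: "\<And>P. P \<in> U \<Longrightarrow> l P = bihom N N a P / g P ^ N"
    and lgl: "\<And>t1 t2. (1, 0, t1, t2) \<in> U \<Longrightarrow> l (1, 0, t1, t2) = l (t1, t2, 0, 1)"
    using l by (rule A_ring_carrierE) blast
  define h' where "h' = (\<lambda>i j q. conv N N k k a (\<lambda>i j. h i j q) i j)"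
  have an: "\<forall>i j. analytic_at2 (h' i j) p"
    unfolding h'_def using h by (intro allI bihom_conv_analytic) auto
  let ?\<psi> = "\<lambda>P\<in>U. germ p (\<lambda>_. l P) \<otimes>\<^bsub>germ_ring p\<^esub> \<phi> P"
  have mult: "?\<psi> = section_of p (\<lambda>q P. l P * (bihom k k (\<lambda>i j. h i j q) P / g P ^ k))"
    unfolding section_of_def by (rule restrict_ext) (simp add: \<phi>h section_of_def germ_mult mult.assoc)
  also have "\<dots> = section_of p (\<lambda>q P. bihom (N + k) (N + k) (\<lambda>i j. h' i j q) P / g P ^ (N + k))"
    unfolding section_of_def
    by (intro restrict_ext arg_cong[of _ _ "germ p"] ext) (simp add: a h'_def bihom_mult[symmetric] power_add)
  finally have \<psi>: "?\<psi> = section_of p (\<lambda>q P. bihom (N + k) (N + k) (\<lambda>i j. h' i j q) P / g P ^ (N + k))" .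
  have "glues p \<Lambda> ?\<psi>"
    unfolding glues_section[OF mult]
  proof (intro allI impI)
    fix t1 t2 assume t: "(1, 0, t1, t2) \<in> U"
    from gl[unfolded glues_section[OF \<phi>h], rule_format, OF t]
    show "near p (\<lambda>q. l (1, 0, t1, t2) * (bihom k k (\<lambda>i j. h i j q) (1, 0, t1, t2) / g (1, 0, t1, t2) ^ k))
       (\<lambda>q. multiplier \<Lambda> q * (l (t1, t2, 0, 1) * (bihom k k (\<lambda>i j. h i j q) (t1, t2, 0, 1) / g (t1, t2, 0, 1) ^ k)))"
      by eventually_elim (simp only: lgl[OF t] mult.left_commute)
  qed
  with an \<psi> have "?\<psi> \<in> M_Omega_level p \<Lambda> g g\<^sub>1 g\<^sub>2 (N + k)"
    unfolding M_level_iff by blast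
  then show ?thesis unfolding M_Omega_def using k(1) by (intro UN_I[of "N + k"]) auto
qed

text \<open>Multiplication by a function l maps the module to itself, so l \<Psi> has unique coordinates with respect to
the basis \<Psi>, and these are the matrix D l.  For products, D k (D l \<Psi>) = D k (l \<Psi>) = l (D k \<Psi>) = k l \<Psi>,
since differential operators commute with functions of P.  If D k = D l, then k and l act in the same way on every element of the module, in particular on the first
standard generator, which is nonzero on a dense set of points.\<close>

lemma embedding_of_basis:
  assumes basis: "is_basis p g (M_Omega p \<Lambda> g g\<^sub>1 g\<^sub>2) \<Psi>"
  shows "\<exists>D. ring_embedding (A_ring g) (mat2_ring (diff_ring p)) D \<and>
     (\<forall>l\<in>carrier (A_ring g). \<forall>T\<in>carrier (mat2_ring (diff_ring p)).
        mat_act p g T \<Psi> = fun_mult p g l \<Psi> \<longleftrightarrow> T = D l)"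
proof -
  let ?O = "germ_ring p" and ?D = "diff_ring p" and ?M = "mat2_ring (diff_ring p)" and ?A = "A_ring g"
  interpret R: cring ?O by (rule cring_germ_ring)
  interpret DR: ring ?D by (rule ring_diff_ring)
  interpret MR: ring ?M by (rule ring_mat2_ring[OF ring_diff_ring])
  interpret AR: ring ?A by (rule ring_A_ring)
  have \<Psi>M: "\<Psi> $ i \<in> M_Omega p \<Lambda> g g\<^sub>1 g\<^sub>2" for i using basis by (simp add: is_basis_def)
  have gv: "germ_valued p g \<Psi>" using M_Omega_germ[OF \<Psi>M] by (simp add: germ_valued_def)
  have gen: "\<exists>T. (\<forall>i. T $ i \<in> carrier ?D) \<and> \<phi> = op_comb p g T \<Psi>" if "\<phi> \<in> M_Omega p \<Lambda> g g\<^sub>1 g\<^sub>2" for \<phi>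
    using basis that unfolding is_basis_def by blast
  have free: "T $ i = \<zero>\<^bsub>?D\<^esub>"
    if "\<And>i. T $ i \<in> carrier ?D" "op_comb p g T \<Psi> = (\<lambda>P\<in>U. \<zero>\<^bsub>?O\<^esub>)" for T i
    using basis that unfolding is_basis_def by blast
  have row_unique: "T = S"
    if T: "\<And>i. T $ i \<in> carrier ?D" and S: "\<And>i. S $ i \<in> carrier ?D"
      and eq: "op_comb p g T \<Psi> = op_comb p g S \<Psi>" for T S :: "(germ \<Rightarrow> germ) ^ 2"
  proof -
    define W :: "(germ \<Rightarrow> germ) ^ 2" where "W = (\<chi> j. T $ j \<ominus>\<^bsub>?D\<^esub> S $ j)"
    have W: "W $ j \<in> carrier ?D" for j by (simp add: W_def T S)
    have WS: "W $ j \<oplus>\<^bsub>?D\<^esub> S $ j = T $ j" for j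
      using T[of j] S[of j] by (simp add: W_def DR.minus_eq DR.a_assoc DR.l_neg)
    have "op_comb p g W \<Psi> P = \<zero>\<^bsub>?O\<^esub>" if P: "P \<in> U" for P
    proof -
      have cl: "op_comb p g V \<Psi> P \<in> carrier ?O" if "\<And>i. V $ i \<in> carrier ?D" for V
        using P germ_valuedD[OF gv P] that by (simp add: op_comb_def diff_ring_app)
      have "op_comb p g W \<Psi> P \<oplus>\<^bsub>?O\<^esub> op_comb p g S \<Psi> P = op_comb p g T \<Psi> P"
        using op_comb_add[OF gv W S P] by (simp add: WS vec_lambda_eta)
      then show ?thesis unfolding eq using cl[OF W] cl[OF S] by simp
    qed
    then have "op_comb p g W \<Psi> = (\<lambda>P\<in>U. \<zero>\<^bsub>?O\<^esub>)"
      by (intro extensionalityI[of _ U]) (simp_all add: op_comb_def)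
    from free[OF W this] have "W $ j = \<zero>\<^bsub>?D\<^esub>" for j .
    then show ?thesis using WS S by (simp add: vec_eq_iff)
  qed
  have unique: "T = S"
    if "T \<in> carrier ?M" "S \<in> carrier ?M"
      "mat_act p g T \<Psi> = mat_act p g S \<Psi>" for T S
  proof -
    have "T $ i = S $ i" for i
      using that by (intro row_unique) (auto simp: mat2_carrierD mat_act_def vec_eq_iff)
    then show ?thesis by (simp add: vec_eq_iff)
  qed
  have exist: "\<exists>T\<in>carrier ?M. mat_act p g T \<Psi> = fun_mult p g l \<Psi>"
    if l: "l \<in> carrier ?A" for l
  proof -
    have "\<forall>i. \<exists>T. (\<forall>j. T $ j \<in> carrier ?D) \<and> fun_mult p g l \<Psi> $ i = op_comb p g T \<Psi>"
      using gen[OF M_Omega_mult[OF l \<Psi>M]] by (simp add: fun_mult_def)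
    then obtain T where T: "\<And>i j. T i $ j \<in> carrier ?D" "\<And>i. fun_mult p g l \<Psi> $ i = op_comb p g (T i) \<Psi>"
      by metis
    then show ?thesis
      by (intro bexI[of _ "\<chi> i. T i"]) (auto simp: mat_act_def mat2_ring_def vec_eq_iff)
  qed
  define D where "D = (\<lambda>l. SOME T. T \<in> carrier ?M \<and> mat_act p g T \<Psi> = fun_mult p g l \<Psi>)"
  have D: "D l \<in> carrier ?M" "mat_act p g (D l) \<Psi> = fun_mult p g l \<Psi>"
    if "l \<in> carrier ?A" for l
    using someI_ex[of "\<lambda>T. T \<in> carrier ?M \<and> mat_act p g T \<Psi> = fun_mult p g l \<Psi>"] exist[OF that]
    unfolding D_def by blast+
  have char: "mat_act p g T \<Psi> = fun_mult p g l \<Psi> \<longleftrightarrow> T = D l"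
    if "l \<in> carrier ?A" "T \<in> carrier ?M" for l T
    using D[OF that(1)] unique[OF that(2)] by metis
  have germc: "germ p (\<lambda>_. c) \<in> carrier ?O" for c by auto
  have fm: "(fun_mult p g l \<Psi> $ i) P = germ p (\<lambda>_. l P) \<otimes>\<^bsub>?O\<^esub> (\<Psi> $ i) P" if "P \<in> U" for l i P
    using that by (simp add: fun_mult_def)
  have act_eqI: "mat_act p g T \<Psi> = fun_mult p g l \<Psi>"
    if "\<And>i P. P \<in> U \<Longrightarrow> op_comb p g (T $ i) \<Psi> P = germ p (\<lambda>_. l P) \<otimes>\<^bsub>?O\<^esub> (\<Psi> $ i) P" for T l
  proof -
    have "op_comb p g (T $ i) \<Psi> = fun_mult p g l \<Psi> $ i" for i
      by (rule extensionalityI[of _ U]) (simp_all add: that fm, simp_all add: op_comb_def fun_mult_def)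
    then show ?thesis by (simp add: mat_act_def vec_eq_iff)
  qed
  have Dapp: "op_comb p g (D l $ i) \<Psi> P = germ p (\<lambda>_. l P) \<otimes>\<^bsub>?O\<^esub> (\<Psi> $ i) P"
    if "l \<in> carrier ?A" "P \<in> U" for l i P
  proof -
    have "op_comb p g (D l $ i) \<Psi> = fun_mult p g l \<Psi> $ i"
      using D(2)[OF that(1)] by (simp add: mat_act_def vec_eq_iff)
    then show ?thesis using fm[OF that(2)] by simp
  qed
  have hom: "ring_hom_ring ?A ?M D"
  proof (rule ring_hom_ringI[OF ring_A_ring ring_mat2_ring[OF ring_diff_ring]])
    fix k l assume k: "k \<in> carrier ?A" and l: "l \<in> carrier ?A"
    have "D k \<otimes>\<^bsub>?M\<^esub> D l = D (k \<otimes>\<^bsub>?A\<^esub> l)"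
    proof (rule iffD1[OF char])
      show "k \<otimes>\<^bsub>?A\<^esub> l \<in> carrier ?A" using k l by simp
      show "D k \<otimes>\<^bsub>?M\<^esub> D l \<in> carrier ?M" using D k l by simp
      show "mat_act p g (D k \<otimes>\<^bsub>?M\<^esub> D l) \<Psi> = fun_mult p g (k \<otimes>\<^bsub>?A\<^esub> l) \<Psi>"
      proof (rule act_eqI)
        fix i P assume P: "P \<in> U"
        have "op_comb p g ((D k \<otimes>\<^bsub>?M\<^esub> D l) $ i) \<Psi> P = op_comb p g (D k $ i) (fun_mult p g l \<Psi>) P"
          using mat_act_mult[OF gv D(1)[OF k] D(1)[OF l]] unfolding D(2)[OF l] by (simp add: mat_act_def vec_eq_iff)
        also have "\<dots> = germ p (\<lambda>_. l P) \<otimes>\<^bsub>?O\<^esub> (germ p (\<lambda>_. k P) \<otimes>\<^bsub>?O\<^esub> (\<Psi> $ i) P)"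
          using op_comb_fun_mult[OF gv mat2_carrierD[OF D(1)[OF k]] P] Dapp[OF k P] by simp
        also have "\<dots> = germ p (\<lambda>_. (k \<otimes>\<^bsub>?A\<^esub> l) P) \<otimes>\<^bsub>?O\<^esub> (\<Psi> $ i) P"
          using P germ_valuedD[OF gv P, of i] germc
          by (simp add: A_ring_simps germ_mult[symmetric] R.m_ac)
        finally show "op_comb p g ((D k \<otimes>\<^bsub>?M\<^esub> D l) $ i) \<Psi> P =
            germ p (\<lambda>_. (k \<otimes>\<^bsub>?A\<^esub> l) P) \<otimes>\<^bsub>?O\<^esub> (\<Psi> $ i) P" .
      qed
    qed
    then show "D (k \<otimes>\<^bsub>?A\<^esub> l) = D k \<otimes>\<^bsub>?M\<^esub> D l" ..
    have "D k \<oplus>\<^bsub>?M\<^esub> D l = D (k \<oplus>\<^bsub>?A\<^esub> l)"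
    proof (rule iffD1[OF char])
      show "k \<oplus>\<^bsub>?A\<^esub> l \<in> carrier ?A" using k l by simp
      show "D k \<oplus>\<^bsub>?M\<^esub> D l \<in> carrier ?M" using D k l by simp
      show "mat_act p g (D k \<oplus>\<^bsub>?M\<^esub> D l) \<Psi> = fun_mult p g (k \<oplus>\<^bsub>?A\<^esub> l) \<Psi>"
      proof (rule act_eqI)
        fix i P assume P: "P \<in> U"
        have "(D k \<oplus>\<^bsub>?M\<^esub> D l) $ i = (\<chi> j. D k $ i $ j \<oplus>\<^bsub>?D\<^esub> D l $ i $ j)"
          by (simp add: mat2_ring_def vec_eq_iff)
        then have "op_comb p g ((D k \<oplus>\<^bsub>?M\<^esub> D l) $ i) \<Psi> P =
            germ p (\<lambda>_. k P) \<otimes>\<^bsub>?O\<^esub> (\<Psi> $ i) P \<oplus>\<^bsub>?O\<^esub> germ p (\<lambda>_. l P) \<otimes>\<^bsub>?O\<^esub> (\<Psi> $ i) P"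
          using op_comb_add[OF gv mat2_carrierD[OF D(1)[OF k]] mat2_carrierD[OF D(1)[OF l]] P] Dapp[OF k P] Dapp[OF l P] by simp
        also have "\<dots> = germ p (\<lambda>_. (k \<oplus>\<^bsub>?A\<^esub> l) P) \<otimes>\<^bsub>?O\<^esub> (\<Psi> $ i) P"
          using P germ_valuedD[OF gv P, of i] germc
          by (simp add: A_ring_simps germ_add[symmetric] R.l_distr)
        finally show "op_comb p g ((D k \<oplus>\<^bsub>?M\<^esub> D l) $ i) \<Psi> P =
            germ p (\<lambda>_. (k \<oplus>\<^bsub>?A\<^esub> l) P) \<otimes>\<^bsub>?O\<^esub> (\<Psi> $ i) P" .
      qed
    qed
    then show "D (k \<oplus>\<^bsub>?A\<^esub> l) = D k \<oplus>\<^bsub>?M\<^esub> D l" ..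
  next
    have "\<one>\<^bsub>?M\<^esub> = D \<one>\<^bsub>?A\<^esub>"
    proof (rule iffD1[OF char])
      show "mat_act p g \<one>\<^bsub>?M\<^esub> \<Psi> = fun_mult p g \<one>\<^bsub>?A\<^esub> \<Psi>"
      proof (rule act_eqI)
        fix i P assume P: "P \<in> U"
        show "op_comb p g (\<one>\<^bsub>?M\<^esub> $ i) \<Psi> P = germ p (\<lambda>_. \<one>\<^bsub>?A\<^esub> P) \<otimes>\<^bsub>?O\<^esub> (\<Psi> $ i) P"
          using P germ_valuedD[OF gv P] exhaust_2[of i]
          by (auto simp: op_comb_def mat2_ring_def A_ring_simps diff_ring_ops_app germ_one[symmetric])
      qed
    qed simp_all
    then show "D \<one>\<^bsub>?A\<^esub> = \<one>\<^bsub>?M\<^esub>" ..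
  qed (rule D(1))
  have "inj_on D (carrier ?A)"
  proof (rule inj_onI)
    fix k l assume k: "k \<in> carrier ?A" and l: "l \<in> carrier ?A" and eq: "D k = D l"
    then have fmeq: "fun_mult p g k \<Psi> = fun_mult p g l \<Psi>" using D(2) by metis
    have "section_of p gen1 \<in> M_Omega p \<Lambda> g g\<^sub>1 g\<^sub>2"
      using gen1_in_level[of p \<Lambda>] unfolding M_Omega_def by (intro UN_I[of 1]) auto
    from gen[OF this] obtain T where T: "\<And>i. T $ i \<in> carrier ?D" "section_of p gen1 = op_comb p g T \<Psi>"
      by blast
    have kl: "(k P - l P) * u P = 0" if P: "P \<in> U" for P
    proof -
      have "germ p (\<lambda>_. k P) \<otimes>\<^bsub>?O\<^esub> section_of p gen1 P = germ p (\<lambda>_. l P) \<otimes>\<^bsub>?O\<^esub> section_of p gen1 P"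
        unfolding T(2) using op_comb_fun_mult[OF gv T(1) P, of k] op_comb_fun_mult[OF gv T(1) P, of l] by (simp add: fmeq)
      then have "near p (\<lambda>q. k P * (u P * E P q)) (\<lambda>q. l P * (u P * E P q))"
        using P by (simp only: section_of_def restrict_apply' germ_mult germ_eq_iff gen1_def)
      then have "k P * (u P * E P p) = l P * (u P * E P p)" by (rule eventually_nhds_x_imp_x)
      then show ?thesis using E_nonzero[of P p] by (auto simp: algebra_simps)
    qed
    obtain N a where a: "\<And>P. P \<in> U \<Longrightarrow> k P = bihom N N a P / g P ^ N" using k by (rule A_ring_carrierE) blast
    obtain M b where b: "\<And>P. P \<in> U \<Longrightarrow> l P = bihom M M b P / g P ^ M" using l by (rule A_ring_carrierE) blast
    \<comment> \<open>the identity k = l, multiplied by the denominators\<close>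
    define f where "f = (\<lambda>P. bihom N N a P * bilin \<alpha> \<beta> \<gamma> \<delta> P ^ M - bihom M M b P * bilin \<alpha> \<beta> \<gamma> \<delta> P ^ N)"
    have lf: "linepoly f" unfolding f_def by (intro linepoly_diff linepoly_mult linepoly_power linepoly_bihom linepoly_bilin)
    have lu: "linepoly (\<lambda>P. uform P * g P)" unfolding uform_def g by (intro linepoly_mult linepoly_bilin)
    have prod0: "f P * (uform P * g P) = 0" for P
    proof (cases "P \<in> U")
      case True
      then have gP: "g P \<noteq> 0" by (simp add: U_iff)
      show ?thesis
      proof (cases "uform P = 0")
        case False
        then have "k P = l P" using kl[OF True] gP by (simp add: u_def)
        then show ?thesis using a[OF True] b[OF True] gP by (simp add: f_def g frac_eq_eq)
      qed simp
    qed (simp add: U_iff)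
    obtain Q where Q: "Q \<in> U" "u Q = 1" using point_exists[of 1 "csqrt (4 + 4 * \<kappa>)" 0] by auto
    then have "uform Q * g Q \<noteq> 0" by (auto simp: u_def U_iff)
    from linepoly_cancel[OF lf lu prod0 this] have f0: "f P = 0" for P .
    have "k P = l P" if P: "P \<in> U" for P
      using f0[of P] a[OF P] b[OF P] P by (simp add: f_def g[symmetric] U_iff frac_eq_eq)
    then show "k = l" by (rule A_ring_eqI[OF k l])
  qed
  with hom have "ring_embedding ?A ?M D" by (simp add: ring_embedding_def)
  with char show ?thesis by blast
qed

end

theorem corollary2:
  fixes B \<Lambda> \<alpha> \<beta> \<gamma> \<delta> \<alpha>\<^sub>1 \<beta>\<^sub>1 \<gamma>\<^sub>1 \<delta>\<^sub>1 \<alpha>\<^sub>2 \<beta>\<^sub>2 \<gamma>\<^sub>2 \<delta>\<^sub>2 c\<^sub>1 c\<^sub>2 x\<^sub>0 y\<^sub>0 :: complex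
    and g g\<^sub>1 g\<^sub>2 :: "hcoord \<Rightarrow> complex"
  assumes g: "g = bilin \<alpha> \<beta> \<gamma> \<delta>"
    and g1: "g\<^sub>1 = bilin \<alpha>\<^sub>1 \<beta>\<^sub>1 \<gamma>\<^sub>1 \<delta>\<^sub>1"
    and g2: "g\<^sub>2 = bilin \<alpha>\<^sub>2 \<beta>\<^sub>2 \<gamma>\<^sub>2 \<delta>\<^sub>2"
    and B: "B \<noteq> 0"
    and glue: "\<forall>t1 t2. g (1, 0, t1, t2) - B * g (t1, t2, 0, 1) = 0"
    and g_nz: "g (0, 1, 0, 1) \<noteq> 0"
    and glue1: "\<forall>t1 t2. g\<^sub>1 (1, 0, t1, t2) - B * g\<^sub>1 (t1, t2, 0, 1) - c\<^sub>1 * g (1, 0, t1, t2) = 0"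
    and glue2: "\<forall>t1 t2. g\<^sub>2 (1, 0, t1, t2) - B * g\<^sub>2 (t1, t2, 0, 1) - c\<^sub>2 * g (1, 0, t1, t2) = 0"
    and indep: "\<forall>a b c :: complex. (\<forall>P. a * g P + b * g\<^sub>1 P + c * g\<^sub>2 P = 0) \<longrightarrow> a = 0 \<and> b = 0 \<and> c = 0"
    and discr1: "(\<gamma> * \<delta>\<^sub>1 - \<gamma>\<^sub>1 * \<delta>)^2 + 2 * \<gamma> * \<delta> * c\<^sub>1 * (\<gamma> * \<delta>\<^sub>1 - \<gamma>\<^sub>1 * \<delta>)
                   + \<delta>^2 * (\<gamma> - 2 * B * \<delta>)^2 * c\<^sub>1^2 \<noteq> 0"
    and discr2: "(\<gamma> * \<delta>\<^sub>2 - \<gamma>\<^sub>2 * \<delta>)^2 + 2 * \<gamma> * \<delta> * c\<^sub>2 * (\<gamma> * \<delta>\<^sub>2 - \<gamma>\<^sub>2 * \<delta>)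
                   + \<delta>^2 * (\<gamma> - 2 * B * \<delta>)^2 * c\<^sub>2^2 \<noteq> 0"
  shows "(\<exists>D. ring_embedding (A_ring g) (mat2_ring (diff_ring (x\<^sub>0, y\<^sub>0))) D) \<and>
         (\<forall>\<Psi>. is_basis (x\<^sub>0, y\<^sub>0) g (M_Omega (x\<^sub>0, y\<^sub>0) \<Lambda> g g\<^sub>1 g\<^sub>2) \<Psi> \<longrightarrow>
            (\<exists>D. ring_embedding (A_ring g) (mat2_ring (diff_ring (x\<^sub>0, y\<^sub>0))) D \<and>
                 (\<forall>l\<in>carrier (A_ring g). \<forall>T\<in>carrier (mat2_ring (diff_ring (x\<^sub>0, y\<^sub>0))).
                    mat_act (x\<^sub>0, y\<^sub>0) g T \<Psi> = fun_mult (x\<^sub>0, y\<^sub>0) g l \<Psi> \<longleftrightarrow> T = D l))) \<and>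
         (\<Lambda> * exp (- (c\<^sub>1 * x\<^sub>0 + c\<^sub>2 * y\<^sub>0)) \<noteq> 1 \<longrightarrow>
            (\<exists>\<Psi>. is_basis (x\<^sub>0, y\<^sub>0) g (M_Omega (x\<^sub>0, y\<^sub>0) \<Lambda> g g\<^sub>1 g\<^sub>2) \<Psi> \<and>
                 (\<forall>i. \<Psi> $ i \<in> M_Omega_level (x\<^sub>0, y\<^sub>0) \<Lambda> g g\<^sub>1 g\<^sub>2 1)))"
proof -
  interpret gluing_data B \<alpha> \<beta> \<gamma> \<delta> \<alpha>\<^sub>1 \<beta>\<^sub>1 \<gamma>\<^sub>1 \<delta>\<^sub>1 \<alpha>\<^sub>2 \<beta>\<^sub>2 \<gamma>\<^sub>2 \<delta>\<^sub>2 c\<^sub>1 c\<^sub>2 g g\<^sub>1 g\<^sub>2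
    by unfold_locales (fact g g1 g2 B glue g_nz glue1 glue2 indep)+
  \<comment> \<open>For \<Lambda> = 0 the multiplier is 0, so a basis exists; the ring of functions does not involve \<Lambda>.\<close>
  have "multiplier 0 (x\<^sub>0, y\<^sub>0) \<noteq> 1" by (simp add: multiplier_def)
  then have "is_basis (x\<^sub>0, y\<^sub>0) g (M_Omega (x\<^sub>0, y\<^sub>0) 0 g g\<^sub>1 g\<^sub>2) (Gen (x\<^sub>0, y\<^sub>0) 0)"
    by (rule Gen_is_basis)
  from embedding_of_basis[OF this]
  have 1: "\<exists>D. ring_embedding (A_ring g) (mat2_ring (diff_ring (x\<^sub>0, y\<^sub>0))) D" by blast
  have 3: "\<exists>\<Psi>. is_basis (x\<^sub>0, y\<^sub>0) g (M_Omega (x\<^sub>0, y\<^sub>0) \<Lambda> g g\<^sub>1 g\<^sub>2) \<Psi> \<and>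
      (\<forall>i. \<Psi> $ i \<in> M_Omega_level (x\<^sub>0, y\<^sub>0) \<Lambda> g g\<^sub>1 g\<^sub>2 1)"
    if "\<Lambda> * exp (- (c\<^sub>1 * x\<^sub>0 + c\<^sub>2 * y\<^sub>0)) \<noteq> 1"
  proof -
    have "multiplier \<Lambda> (x\<^sub>0, y\<^sub>0) \<noteq> 1" using that by (simp only: multiplier_def fst_conv snd_conv not_False_eq_True)
    from Gen_is_basis[OF this] show ?thesis by blast
  qed
  show ?thesis
    using 1 embedding_of_basis[of "(x\<^sub>0, y\<^sub>0)" \<Lambda>] 3 by blast
qed

end
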